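(* Let $\gamma$ be the Gauss measure on $\mathbb{R}^n$ and let $\mathcal{L}$ be the Ornstein--Uhlenbeck operator on $L^2(\gamma)$. For each $u\in\mathbb{R}\setminus\{0\}$ and for each $r\in\mathbb{R}^+$ (i.e. $r>0$) the operator $(r\mathcal{I}+\mathcal{L})^{iu}$ is unbounded from $\mathfrak{h}^1(\gamma)$ to $L^1(\gamma)$.
   Context: $\gamma$ is the probability measure on $\mathbb{R}^n$ with density $x\mapsto \pi^{-n/2}e^{-|x|^2}$ with respect to Lebesgue measure. $\mathcal{L}$ is the closure in $L^2(\gamma)$ of the operator $\mathcal{L}_0=-\tfrac12\Delta+x\cdot\nabla$ with domain $C_c^\infty(\mathbb{R}^n)$, where $\Delta$ and $\nabla$ are the Euclidean Laplacian and gradient. Its spectral resolution is $\mathcal{L}f=\sum_{j\ge0}j\,\mathcal{P}_jf$, where $\mathcal{P}_j$ is the orthogonal projection of $L^2(\gamma)$ onto the linear span of the Hermite polynomials of degree $j$ in $n$ variables. $\mathcal{I}$ is the identity, and $(r\mathcal{I}+\mathcal{L})^{iu}$ is defined spectrally by $(r\mathcal{I}+\mathcal{L})^{iu}f=\sum_{j\ge 0}(r+j)^{iu}\mathcal{P}_jf$ for $f\in L^2(\gamma)$. Balls are Euclidean; $c_B,r_B$ denote the centre and radius of a ball $B$. $\|\cdot\|_2$ is the norm of $L^2(\gamma)$. A ball $B$ is admissible if $r_B\le \min(1,1/|c_B|)$ (with $1/0=\infty$). An $H^1(\gamma)$-atom is either the constant function $1$ or a function $a\in L^1(\gamma)$ supported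 in an admissible ball $B$ with $\|a\|_2\le \gamma(B)^{-1/2}$ and $\int a\,d\gamma=0$. A global atom is a function $a\in L^2(\gamma)$ with support contained in a ball $B$ of radius exactly $\min(1,1/|c_B|)$ such that $\|a\|_2\le\gamma(B)^{-1/2}$ (no cancellation required). An $\mathfrak{h}^1(\gamma)$-atom is either an $H^1(\gamma)$-atom or a global atom. The space $\mathfrak{h}^1(\gamma)$ is the set of all $f=\sum_j\lambda_j a_j$ with $a_j$ $\mathfrak{h}^1(\gamma)$-atoms and $\sum_j|\lambda_j|<\infty$, normed by the infimum of $\sum_j|\lambda_j|$ over all such decompositions. An operator defined on $L^2(\gamma)$, hence on finite linear combinations of $\mathfrak{h}^1(\gamma)$-atoms, is unbounded from $\mathfrak{h}^1(\gamma)$ to $L^1(\gamma)$ if it does not extend to a bounded linear operator from $\mathfrak{h}^1(\gamma)$ to $L^1(\gamma)$. *)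

theory Defs
  imports "HOL-Analysis.Analysis" "HOL-Computational_Algebra.Polynomial"
begin

text \<open>
  All function spaces consist of complex-valued functions. Elements of
  \<open>L\<^sup>1(\<gamma>)\<close> and \<open>L\<^sup>2(\<gamma>)\<close> are represented by Borel measurable functions, and
  everything below is invariant under modification on \<open>\<gamma>\<close>-null sets; in particular ``supported
  in \<open>B\<close>'' means vanishing almost everywhere outside \<open>B\<close>, so that it is immaterial whether balls are
  taken open or closed.
\<close>

definition gauss :: "(real ^ 'n) measure" where
  "gauss = density lborel (\<lambda>x. ennreal (pi powr (- real CARD('n) / 2) * exp (- (norm x)\<^sup>2)))"

definition L1 :: "(real ^ 'n \<Rightarrow> complex) set" where
  "L1 = {f. integrable gauss f}"

definition L1_norm :: "(real ^ 'n \<Rightarrow> complex) \<Rightarrow> real" where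
  "L1_norm f = (\<integral>x. norm (f x) \<partial>gauss)"

definition L2 :: "(real ^ 'n \<Rightarrow> complex) set" where
  "L2 = {f \<in> borel_measurable gauss. integrable gauss (\<lambda>x. (norm (f x))\<^sup>2)}"

definition L2_norm :: "(real ^ 'n \<Rightarrow> complex) \<Rightarrow> real" where
  "L2_norm f = sqrt (\<integral>x. (norm (f x))\<^sup>2 \<partial>gauss)"

definition L2_inner :: "(real ^ 'n \<Rightarrow> complex) \<Rightarrow> (real ^ 'n \<Rightarrow> complex) \<Rightarrow> complex" where
  "L2_inner f g = (\<integral>x. f x * cnj (g x) \<partial>gauss)"

text \<open>
  The Hermite polynomials for the weight \<open>exp (- t\<^sup>2)\<close>. The recursion is the Rodrigues
  formula \<open>H\<^sub>k(t) = (-1)\<^sup>k exp (t\<^sup>2) (d/dt)\<^sup>k exp (- t\<^sup>2)\<close>, differentiated once.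
\<close>

primrec hermite :: "nat \<Rightarrow> real poly" where
  "hermite 0 = 1"
| "hermite (Suc k) = [:0, 2:] * hermite k - pderiv (hermite k)"

definition hermite_multi :: "('n \<Rightarrow> nat) \<Rightarrow> real ^ 'n \<Rightarrow> real" where
  "hermite_multi \<alpha> x = (\<Prod>i\<in>UNIV. poly (hermite (\<alpha> i)) (x $ i))"

text \<open>The complex linear span of the Hermite polynomials of degree \<open>j\<close> in \<open>n\<close> variables; the index
  set of the sum is finite.\<close>

definition hermite_space :: "nat \<Rightarrow> (real ^ 'n \<Rightarrow> complex) set" where
  "hermite_space j =
     {p. \<exists>c :: ('n \<Rightarrow> nat) \<Rightarrow> complex.
           p = (\<lambda>x. \<Sum>\<alpha> | (\<Sum>i\<in>UNIV. \<alpha> i) = j. c \<alpha> * of_real (hermite_multi \<alpha> x))}"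

text \<open>The orthogonal projection of \<open>L\<^sup>2(\<gamma>)\<close> onto \<open>hermite_space j\<close>. The polynomial \<open>p\<close> is unique as a
  function, not merely almost everywhere, because nonempty open sets have positive \<open>\<gamma>\<close>-measure.\<close>

definition hermite_proj :: "nat \<Rightarrow> (real ^ 'n \<Rightarrow> complex) \<Rightarrow> real ^ 'n \<Rightarrow> complex" where
  "hermite_proj j f =
     (THE p. p \<in> hermite_space j \<and> (\<forall>q\<in>hermite_space j. L2_inner (\<lambda>x. f x - p x) q = 0))"

text \<open>
  The Ornstein--Uhlenbeck operator \<open>\<L>\<close> has the spectral resolution \<open>\<L> = \<Sum>j. j P\<^sub>j\<close> with
  \<open>P\<^sub>j = hermite_proj j\<close>, and \<open>m(\<L>) f = \<Sum>j. m(j) P\<^sub>j f\<close> with convergence in \<open>L\<^sup>2(\<gamma>)\<close>.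
  The choice operator picks a representative of this element of \<open>L\<^sup>2(\<gamma>)\<close>.
  \<open>OU_imag_power r u\<close> is \<open>(r \<I> + \<L>)\<^bsup>iu\<^esup>\<close>.
\<close>

definition OU_spectral :: "(nat \<Rightarrow> complex) \<Rightarrow> (real ^ 'n \<Rightarrow> complex) \<Rightarrow> real ^ 'n \<Rightarrow> complex" where
  "OU_spectral m f =
     (SOME g. g \<in> L2 \<and>
        (\<lambda>N. L2_norm (\<lambda>x. g x - (\<Sum>j<N. m j * hermite_proj j f x))) \<longlonglongrightarrow> 0)"

definition OU_imag_power ::
    "real \<Rightarrow> real \<Rightarrow> (real ^ 'n \<Rightarrow> complex) \<Rightarrow> real ^ 'n \<Rightarrow> complex" where
  "OU_imag_power r u =
     OU_spectral (\<lambda>j. complex_of_real (r + real j) powr (\<i> * complex_of_real u))"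

definition adm_radius :: "real ^ 'n \<Rightarrow> real" where
  "adm_radius c = (if c = 0 then 1 else min 1 (1 / norm c))"

definition supported_in :: "(real ^ 'n \<Rightarrow> complex) \<Rightarrow> (real ^ 'n) set \<Rightarrow> bool" where
  "supported_in a B \<longleftrightarrow> (AE x in gauss. x \<notin> B \<longrightarrow> a x = 0)"

definition H1_atom :: "(real ^ 'n \<Rightarrow> complex) \<Rightarrow> bool" where
  "H1_atom a \<longleftrightarrow>
     (a \<in> borel_measurable gauss \<and> (AE x in gauss. a x = 1)) \<or>
     (\<exists>c \<rho>. 0 < \<rho> \<and> \<rho> \<le> adm_radius c \<and>
        a \<in> L1 \<and> a \<in> L2 \<and> supported_in a (ball c \<rho>) \<and>
        L2_norm a \<le> measure gauss (ball c \<rho>) powr (- 1 / 2) \<and>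
        (\<integral>x. a x \<partial>gauss) = 0)"

definition global_atom :: "(real ^ 'n \<Rightarrow> complex) \<Rightarrow> bool" where
  "global_atom a \<longleftrightarrow>
     (\<exists>c. a \<in> L2 \<and> supported_in a (ball c (adm_radius c)) \<and>
        L2_norm a \<le> measure gauss (ball c (adm_radius c)) powr (- 1 / 2))"

definition h1_atom :: "(real ^ 'n \<Rightarrow> complex) \<Rightarrow> bool" where
  "h1_atom a \<longleftrightarrow> H1_atom a \<or> global_atom a"

text \<open>Atoms have \<open>L\<^sup>1(\<gamma>)\<close>-norm at most \<open>1\<close>, so atomic series with absolutely summable coefficients
  converge in \<open>L\<^sup>1(\<gamma>)\<close>, which is the sense of the equality \<open>f = \<Sum>j. \<lambda>\<^sub>j a\<^sub>j\<close> here.\<close>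

definition atomic_decomp ::
    "(real ^ 'n \<Rightarrow> complex) \<Rightarrow> (nat \<Rightarrow> complex) \<Rightarrow> (nat \<Rightarrow> real ^ 'n \<Rightarrow> complex) \<Rightarrow> bool" where
  "atomic_decomp f l a \<longleftrightarrow>
     f \<in> L1 \<and> (\<forall>j. h1_atom (a j)) \<and> summable (\<lambda>j. norm (l j)) \<and>
     (\<lambda>N. L1_norm (\<lambda>x. f x - (\<Sum>j<N. l j * a j x))) \<longlonglongrightarrow> 0"

definition h1 :: "(real ^ 'n \<Rightarrow> complex) set" where
  "h1 = {f. \<exists>l a. atomic_decomp f l a}"

definition h1_norm :: "(real ^ 'n \<Rightarrow> complex) \<Rightarrow> real" where
  "h1_norm f = Inf {(\<Sum>j. norm (l j)) | l. \<exists>a. atomic_decomp f l a}"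

definition h1_fin :: "(real ^ 'n \<Rightarrow> complex) set" where
  "h1_fin = {f. \<exists>N (l :: nat \<Rightarrow> complex) a.
               (\<forall>k<N. h1_atom (a k)) \<and> f = (\<lambda>x. \<Sum>k<N. l k * a k x)}"

text \<open>Linearity and boundedness imply that \<open>T\<close> respects almost everywhere equality, since
  \<open>h1_norm f = 0\<close> whenever \<open>f\<close> is measurable and vanishes almost everywhere.\<close>

definition bounded_linear_h1_L1 ::
    "((real ^ 'n \<Rightarrow> complex) \<Rightarrow> real ^ 'n \<Rightarrow> complex) \<Rightarrow> bool" where
  "bounded_linear_h1_L1 T \<longleftrightarrow>
     (\<forall>f\<in>h1. T f \<in> L1) \<and>
     (\<forall>f\<in>h1. \<forall>g\<in>h1. AE x in gauss. T (\<lambda>y. f y + g y) x = T f x + T g x) \<and>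
     (\<forall>f\<in>h1. \<forall>c. AE x in gauss. T (\<lambda>y. c * f y) x = c * T f x) \<and>
     (\<exists>C. \<forall>f\<in>h1. L1_norm (T f) \<le> C * h1_norm f)"

definition unbounded_h1_L1 ::
    "((real ^ 'n \<Rightarrow> complex) \<Rightarrow> real ^ 'n \<Rightarrow> complex) \<Rightarrow> bool" where
  "unbounded_h1_L1 S \<longleftrightarrow>
     \<not> (\<exists>T. bounded_linear_h1_L1 T \<and> (\<forall>f\<in>h1_fin. AE x in gauss. T f x = S f x))"

end

(* Idea. Let m j = (r + j)^(iu), which has modulus 1, and let the test functions be finite sums
   psi(x_k / R) with psi(y) = sum b_i exp(i eta_i y). Exponentials have explicit Hermite expansions, so
   the pairing of the operator, applied to the normalised indicator of the ball of radius 1/R about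
   R e_k, with such a test function is an explicit series. As R grows, the second order part of the
   Ornstein-Uhlenbeck operator disappears and the drift remains: the limit is ((r + y d/dy)^(iu) psi)(1).
   Boundedness from h^1 to L^1 would therefore bound this functional by sup |psi|.

   Up to a constant factor the functional is the integral of t^(-iu) times the derivative of
   exp(-rt) psi(exp(-t)) over t > 0. Taking for psi the binomial series of (1 - q exp(i(y - 1)))^(iu),
   which is bounded by exp(pi |u|) uniformly in q < 1, the integrand behaves like a constant multiple
   of 1/t for 1 - q << t << 1, and the functional diverges logarithmically as q tends to 1. *)

theory Submission
  imports Defs "HOL-Probability.Sinc_Integral"
begin

section \<open>The Gauss measure as a product measure\<close>

text \<open>For functions of y = x_k / R alone, -1/2 Laplacian + x . gradient becomes y d/dy minus
  (2 R^2)^-1 d^2/dy^2, and the admissible ball about R e_k shrinks to y = 1. The powers y^j are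
  eigenfunctions of y d/dy with eigenvalue j, so the degree j Hermite part of exp(i eta y) tends to
  (i eta y)^j / j!. Global atoms may have mass one, so the limit sees a point value. The constant
  factor is Gamma(1 - iu), from l^(iu) Gamma(1 - iu) = integral of t^(-iu) l exp(-l t). The weight
  l, which produces the derivative, makes the integrand integrable at 0; t^(-iu-1) would not be. The
  obstacle is the oscillation of t^(-iu), which can destroy a logarithm coming from a derivative of
  size 1/t. The exponent iu of the test function is chosen against it: 1 - q exp(i(exp(-t) - 1)) is
  close to it, its power iu cancels t^(-iu) up to a constant, and differentiation supplies u/t. The
  parameter q cuts off the singularity at y = 1 and makes the series converge absolutely, so finite
  sums approximate it uniformly in y.\<close>

definition gauss1_density :: "real \<Rightarrow> real" where
  "gauss1_density t = exp (- t\<^sup>2) / sqrt pi"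

definition gauss1 :: "real measure" where
  "gauss1 = density lborel (\<lambda>t. ennreal (gauss1_density t))"

lemma gauss1_density_eq_normal_density: "gauss1_density t = normal_density 0 (sqrt (1 / 2)) t"
  by (simp add: gauss1_density_def normal_density_def real_sqrt_divide power_divide)

lemma gauss1_density_nonneg [simp]: "gauss1_density t \<ge> 0"
  by (simp add: gauss1_density_def)

lemma gauss1_density_measurable [measurable]: "gauss1_density \<in> borel_measurable borel"
  unfolding gauss1_density_def by measurable

lemma sets_gauss1 [simp, measurable_cong]: "sets gauss1 = sets borel"
  by (simp add: gauss1_def)

lemma space_gauss1 [simp]: "space gauss1 = UNIV"
  by (simp add: gauss1_def)

lemma prob_space_gauss1: "prob_space gauss1"
proof -
  have "gauss1 = density lborel (\<lambda>t. ennreal (normal_density 0 (sqrt (1 / 2)) t))"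
    by (simp add: gauss1_def gauss1_density_eq_normal_density)
  then show ?thesis
    using prob_space_normal_density[of "sqrt (1 / 2)" 0] by simp
qed

lemma gauss_density_eq_prod:
  "pi powr (- real CARD('n) / 2) * exp (- (norm x)\<^sup>2) = (\<Prod>i\<in>UNIV. gauss1_density (x $ i))"
  for x :: "real ^ 'n"
proof -
  have "pi powr (- real CARD('n) / 2) = (1 / sqrt pi) ^ CARD('n)"
    by (simp add: powr_half_sqrt [symmetric] powr_minus_divide powr_realpow [symmetric] powr_powr
        power_one_over)
  moreover have "exp (- (norm x)\<^sup>2) = (\<Prod>i\<in>UNIV. exp (- (x $ i)\<^sup>2))"
    by (simp add: exp_sum [symmetric] sum_negf norm_vec_def L2_set_def sum_nonneg)
  ultimately show ?thesis
    by (simp add: gauss1_density_def prod_dividef power_one_over field_simps)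
qed

lemma gauss_density_prod: "gauss = density lborel (\<lambda>x :: real ^ 'n. ennreal (\<Prod>i\<in>UNIV. gauss1_density (x $ i)))"
  unfolding gauss_def gauss_density_eq_prod ..

lemma sets_gauss [simp, measurable_cong]: "sets gauss = sets borel"
  by (simp add: gauss_def)

lemma space_gauss [simp]: "space gauss = UNIV"
  by (simp add: gauss_def)

lemma measurable_gauss [simp]: "measurable gauss M = measurable borel M"
  by (rule measurable_cong_sets) auto

context
begin

interpretation product_sigma_finite "\<lambda>_. lborel :: real measure"
  by standard

text \<open>Lebesgue measure on a Euclidean space is the image of a product measure indexed by basis
  vectors, not by coordinates. The bijection \<open>e\<close> translates between the two, and Fubini
  for products does the rest.\<close>

lemma lborel_prod_components:
  fixes f :: "'n :: finite \<Rightarrow> real \<Rightarrow> 'b :: {real_normed_field, banach, second_countable_topology}"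
  assumes "\<And>i. integrable lborel (f i)"
  shows "integrable lborel (\<lambda>x :: real ^ 'n. \<Prod>i\<in>UNIV. f i (x $ i))"
    and "(\<integral>x. (\<Prod>i\<in>UNIV. f i (x $ i)) \<partial>(lborel :: (real ^ 'n) measure)) = (\<Prod>i\<in>UNIV. \<integral>t. f i t \<partial>lborel)"
proof -
  define e :: "'n \<Rightarrow> real ^ 'n" where "e i = axis i 1" for i
  have inj: "inj e"
    by (auto simp: inj_def e_def axis_eq_axis)
  have Basis: "(Basis :: (real ^ 'n) set) = range e"
    by (auto simp: Basis_vec_def e_def)
  define g where "g b = f (inv e b)" for b
  have reindex: "(\<Prod>b\<in>Basis. h (inv e b)) = (\<Prod>i\<in>UNIV. h i)" for h :: "'n \<Rightarrow> 'b"
    unfolding Basis using inj by (subst prod.reindex) auto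
  have g: "integrable lborel (g b)" for b
    using assms by (simp add: g_def)
  have comp: "(\<Prod>i\<in>UNIV. f i ((\<Sum>b\<in>Basis. w b *\<^sub>R b) $ i)) = (\<Prod>b\<in>Basis. g b (w b))" for w
  proof -
    have "(\<Sum>b\<in>Basis. w b *\<^sub>R b) $ i = w (e i)" for i
    proof -
      have "(\<Sum>b\<in>Basis. w b *\<^sub>R b) $ i = (\<Sum>b\<in>Basis. w b *\<^sub>R b) \<bullet> e i"
        by (simp add: e_def inner_axis)
      also have "\<dots> = w (e i)"
        by (subst inner_sum_left_Basis) (auto simp: Basis)
      finally show ?thesis .
    qed
    moreover have "(\<Prod>b\<in>Basis. g b (w b)) = (\<Prod>i\<in>UNIV. g (e i) (w (e i)))"
      unfolding Basis using inj by (subst prod.reindex) auto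
    ultimately show ?thesis
      using inj by (simp add: g_def)
  qed
  have [measurable]: "f i \<in> borel_measurable borel" for i
    using assms[of i] by simp
  have meas: "(\<lambda>x :: real ^ 'n. \<Prod>i\<in>UNIV. f i (x $ i)) \<in> borel_measurable borel"
    by measurable
  have meas': "(\<lambda>w. \<Sum>b\<in>Basis. w b *\<^sub>R b) \<in> (\<Pi>\<^sub>M b\<in>(Basis :: (real ^ 'n) set). lborel) \<rightarrow>\<^sub>M borel"
    by measurable
  let ?P = "\<Pi>\<^sub>M b\<in>(Basis :: (real ^ 'n) set). (lborel :: real measure)"
  let ?f = "\<lambda>x :: real ^ 'n. \<Prod>i\<in>UNIV. f i (x $ i)"
  have "integrable ?P (\<lambda>w. ?f (\<Sum>b\<in>Basis. w b *\<^sub>R b))"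
    unfolding comp by (rule product_integrable_prod) (simp_all add: g)
  then show "integrable lborel ?f"
    by (subst lborel_eq, subst integrable_distr_eq[OF meas' meas])
  have "(\<integral>x. ?f x \<partial>lborel) = (\<integral>w. ?f (\<Sum>b\<in>Basis. w b *\<^sub>R b) \<partial>?P)"
    by (subst lborel_eq, rule integral_distr[OF meas' meas])
  also have "\<dots> = (\<Prod>b\<in>(Basis :: (real ^ 'n) set). \<integral>t. g b t \<partial>lborel)"
    unfolding comp by (rule product_integral_prod) (simp_all add: g)
  also have "\<dots> = (\<Prod>i\<in>UNIV. \<integral>t. f i t \<partial>lborel)"
    unfolding g_def using reindex[of "\<lambda>i. \<integral>t. f i t \<partial>lborel"] by simp
  finally show "(\<integral>x. (\<Prod>i\<in>UNIV. f i (x $ i)) \<partial>(lborel :: (real ^ 'n) measure)) = (\<Prod>i\<in>UNIV. \<integral>t. f i t \<partial>lborel)" .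
qed

end

lemma gauss_prod:
  fixes f :: "'n :: finite \<Rightarrow> real \<Rightarrow> 'b :: {real_normed_field, banach, second_countable_topology}"
  assumes "\<And>i. integrable gauss1 (f i)"
  shows integrable_gauss_prod: "integrable gauss (\<lambda>x :: real ^ 'n. \<Prod>i\<in>UNIV. f i (x $ i))"
    and integral_gauss_prod:
      "(\<integral>x. (\<Prod>i\<in>UNIV. f i (x $ i)) \<partial>(gauss :: (real ^ 'n) measure)) = (\<Prod>i\<in>UNIV. \<integral>t. f i t \<partial>gauss1)"
proof -
  have [measurable]: "f i \<in> borel_measurable borel" for i
    using borel_measurable_integrable[OF assms[of i]] by simp
  have i: "integrable lborel (\<lambda>t. gauss1_density t *\<^sub>R f i t)" for i
    using assms[of i] unfolding gauss1_def by (subst (asm) integrable_density) auto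
  have eq: "(\<Prod>i\<in>UNIV. gauss1_density (x $ i) *\<^sub>R f i (x $ i)) = (\<Prod>i\<in>UNIV. gauss1_density (x $ i)) *\<^sub>R (\<Prod>i\<in>UNIV. f i (x $ i))" for x :: "real ^ 'n"
    by (simp add: scaleR_conv_of_real prod.distrib)
  show "integrable gauss (\<lambda>x :: real ^ 'n. \<Prod>i\<in>UNIV. f i (x $ i))"
    unfolding gauss_density_prod using lborel_prod_components(1)[where f = "\<lambda>i t. gauss1_density t *\<^sub>R f i t", OF i]
    by (subst integrable_density) (auto simp: prod_nonneg eq)
  show "(\<integral>x. (\<Prod>i\<in>UNIV. f i (x $ i)) \<partial>(gauss :: (real ^ 'n) measure)) = (\<Prod>i\<in>UNIV. \<integral>t. f i t \<partial>gauss1)"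
    unfolding gauss_density_prod gauss1_def using lborel_prod_components(2)[where f = "\<lambda>i t. gauss1_density t *\<^sub>R f i t", OF i]
    by (subst (1 2) integral_density) (auto simp: prod_nonneg eq)
qed

lemma prob_space_gauss: "prob_space (gauss :: (real ^ 'n) measure)"
proof -
  interpret g: prob_space gauss1 by (rule prob_space_gauss1)
  have "integrable gauss (\<lambda>x :: real ^ 'n. 1 :: real)"
    using integrable_gauss_prod[where 'n = 'n and f = "\<lambda>_ _. 1 :: real"] by simp
  then have fin: "emeasure (gauss :: (real ^ 'n) measure) UNIV \<noteq> \<infinity>"
    by (simp add: integrable_iff_bounded)
  have "measure (gauss :: (real ^ 'n) measure) UNIV = 1"
    using integral_gauss_prod[where 'n = 'n and f = "\<lambda>_ _. 1 :: real"] g.prob_space by simp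
  with fin show ?thesis
    by (intro prob_spaceI) (simp add: emeasure_eq_ennreal_measure)
qed

text \<open>Completing the square gives c|t| \<le> t^2/2 + c^2/2, which leaves half of the Gaussian
  exponent, a multiple of the standard normal density.\<close>

lemma integrable_gauss1_exp_abs: "integrable gauss1 (\<lambda>t. exp (c * \<bar>t\<bar>))"
proof -
  have "integrable lborel (\<lambda>t. exp (c\<^sup>2 / 2) * sqrt 2 * normal_density 0 1 t)"
    by (intro integrable_mult_right) simp
  then have "integrable lborel (\<lambda>t. gauss1_density t *\<^sub>R exp (c * \<bar>t\<bar>))"
  proof (rule Bochner_Integration.integrable_bound)
    show "AE t in lborel. norm (gauss1_density t *\<^sub>R exp (c * \<bar>t\<bar>)) \<le> norm (exp (c\<^sup>2 / 2) * sqrt 2 * normal_density 0 1 t)"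
    proof (rule AE_I2)
      fix t :: real
      have "0 \<le> (\<bar>t\<bar> - c)\<^sup>2" by simp
      then have "- t\<^sup>2 + c * \<bar>t\<bar> \<le> c\<^sup>2 / 2 - t\<^sup>2 / 2"
        by (simp add: power2_eq_square algebra_simps)
      then have "exp (- t\<^sup>2 + c * \<bar>t\<bar>) \<le> exp (c\<^sup>2 / 2 - t\<^sup>2 / 2)" by simp
      then have "exp (- t\<^sup>2 + c * \<bar>t\<bar>) / sqrt pi \<le> exp (c\<^sup>2 / 2 - t\<^sup>2 / 2) / sqrt pi"
        by (simp add: divide_right_mono)
      also have "\<dots> = exp (c\<^sup>2 / 2) * sqrt 2 * normal_density 0 1 t"
        by (simp add: normal_density_def real_sqrt_mult mult_exp_exp)
      finally show "norm (gauss1_density t *\<^sub>R exp (c * \<bar>t\<bar>)) \<le> norm (exp (c\<^sup>2 / 2) * sqrt 2 * normal_density 0 1 t)"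
        by (simp add: gauss1_density_def mult_exp_exp field_simps)
    qed
  qed measurable
  then show ?thesis
    unfolding gauss1_def by (subst integrable_density) auto
qed

lemma poly_div_exp_tendsto_0: "((\<lambda>t. poly p t / exp t) \<longlongrightarrow> (0 :: real)) at_top"
proof -
  have "((\<lambda>t. \<Sum>i\<le>degree p. coeff p i * (t ^ i / exp t)) \<longlongrightarrow> (\<Sum>i\<le>degree p. coeff p i * 0)) at_top"
    by (intro tendsto_intros tendsto_power_div_exp_0)
  then show ?thesis
    by (simp add: poly_altdef sum_divide_distrib)
qed

text \<open>The quotient by exp tends to 0 at infinity and is bounded on the remaining compact
  interval; the negative half-line is reached through p(-t).\<close>

lemma abs_poly_le_exp: "\<exists>K. \<forall>t. \<bar>poly p t\<bar> \<le> K * exp \<bar>t :: real\<bar>"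
proof -
  have bd: "\<exists>K. \<forall>t\<ge>0. \<bar>poly q t\<bar> \<le> K * exp t" for q :: "real poly"
  proof -
    have "eventually (\<lambda>t. \<bar>poly q t / exp t\<bar> < 1) at_top"
      using tendsto_rabs[OF poly_div_exp_tendsto_0[of q]] by (rule order_tendstoD) simp
    then obtain N where N: "\<And>t. t \<ge> N \<Longrightarrow> \<bar>poly q t / exp t\<bar> < 1"
      by (auto simp: eventually_at_top_linorder)
    have "compact ((\<lambda>t. poly q t / exp t) ` {0..max 0 N})"
      by (intro compact_continuous_image continuous_intros) auto
    then obtain B where B: "\<And>t. t \<in> {0..max 0 N} \<Longrightarrow> \<bar>poly q t / exp t\<bar> \<le> B"
      using compact_imp_bounded bounded_iff by (metis (no_types, lifting) imageI real_norm_def)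
    have "\<bar>poly q t\<bar> \<le> max B 1 * exp t" if "t \<ge> 0" for t
    proof -
      have "\<bar>poly q t / exp t\<bar> \<le> max B 1"
        using N[of t] B[of t] that by (cases "t \<le> N") (auto simp: le_max_iff_disj)
      then show ?thesis by (simp add: abs_divide field_simps)
    qed
    then show ?thesis by blast
  qed
  obtain K1 where K1: "\<And>t. t \<ge> 0 \<Longrightarrow> \<bar>poly p t\<bar> \<le> K1 * exp t"
    using bd by blast
  obtain K2 where K2: "\<And>t. t \<ge> 0 \<Longrightarrow> \<bar>poly (pcompose p [:0, -1:]) t\<bar> \<le> K2 * exp t"
    using bd by blast
  have "\<bar>poly p t\<bar> \<le> max K1 K2 * exp \<bar>t\<bar>" for t
  proof (cases "t \<ge> 0")
    case True
    then show ?thesis using K1[of t] by (smt (verit) exp_gt_zero mult_right_mono)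
  next
    case False
    then have "\<bar>poly p t\<bar> \<le> K2 * exp (- t)"
      using K2[of "- t"] unfolding poly_pcompose by simp
    also have "\<dots> \<le> max K1 K2 * exp \<bar>t\<bar>"
      using False by (auto intro!: mult_right_mono)
    finally show ?thesis .
  qed
  then show ?thesis by blast
qed

section \<open>Hermite polynomials in one variable\<close>

lemma borel_measurable_poly [measurable]: "poly p \<in> borel_measurable borel" for p :: "real poly"
  by (intro borel_measurable_continuous_onI continuous_intros)

lemma integrable_poly_gauss1: "integrable gauss1 (poly p)"
proof -
  obtain K where K: "\<And>t. \<bar>poly p t\<bar> \<le> K * exp \<bar>t\<bar>"
    using abs_poly_le_exp by blast
  have "integrable gauss1 (\<lambda>t. K * exp (1 * \<bar>t\<bar>))"
    by (intro integrable_mult_right integrable_gauss1_exp_abs)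
  then show ?thesis
  proof (rule Bochner_Integration.integrable_bound)
    show "AE t in gauss1. norm (poly p t) \<le> norm (K * exp (1 * \<bar>t\<bar>))"
      using K by (intro AE_I2) (smt (verit) mult_1 real_norm_def)
  qed simp
qed

lemma poly_mult_gauss1_density_tendsto_0: "((\<lambda>t. poly p t * gauss1_density t) \<longlongrightarrow> 0) at_top"
proof (rule Lim_null_comparison)
  show "((\<lambda>t. \<bar>poly p t / exp t\<bar>) \<longlongrightarrow> 0) at_top"
    using tendsto_rabs[OF poly_div_exp_tendsto_0[of p]] by simp
  show "eventually (\<lambda>t. norm (poly p t * gauss1_density t) \<le> \<bar>poly p t / exp t\<bar>) at_top"
    using eventually_ge_at_top[of 1]
  proof eventually_elim
    case (elim t)
    have "t * 1 \<le> t * t" using elim by (intro mult_left_mono) auto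
    then have "exp (- t\<^sup>2) \<le> exp (- t)" by (simp add: power2_eq_square)
    moreover have "1 \<le> sqrt pi" using pi_ge_two by simp
    ultimately have "gauss1_density t \<le> exp (- t) / 1"
      unfolding gauss1_density_def by (intro frac_le) auto
    then have "\<bar>poly p t\<bar> * gauss1_density t \<le> \<bar>poly p t\<bar> * exp (- t)"
      by (intro mult_left_mono) auto
    then show ?case by (simp add: abs_mult exp_minus divide_inverse)
  qed
qed

text \<open>The integrand times the Gaussian density is minus the derivative of p times that
  density, which vanishes at both ends. The combination is the one in the recursion of
  \<open>hermite\<close>, so each step of that recursion is an integration by parts.\<close>

lemma gauss1_by_parts: "(\<integral>t. poly ([:0, 2:] * p - pderiv p) t \<partial>gauss1) = 0"
proof -
  define f where "f t = poly (pderiv p - [:0, 2:] * p) t * gauss1_density t" for t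
  have int: "integrable lborel f"
    using integrable_poly_gauss1[of "pderiv p - [:0, 2:] * p"]
    unfolding gauss1_def f_def by (subst (asm) integrable_real_density) (auto simp: mult.commute)
  have gauss1_density': "(gauss1_density has_real_derivative (- 2 * t * gauss1_density t)) (at t)" for t
    unfolding gauss1_density_def by (auto intro!: derivative_eq_intros simp: field_simps)
  have "(LBINT t=-\<infinity>..\<infinity>. f t) = 0 - 0"
  proof (rule interval_integral_FTC_integrable)
    fix t :: real
    show "((\<lambda>t. poly p t * gauss1_density t) has_vector_derivative f t) (at t)"
      unfolding has_real_derivative_iff_has_vector_derivative [symmetric] f_def
      by (rule derivative_eq_intros gauss1_density' poly_DERIV refl)+ (simp add: algebra_simps)
    show "isCont f t"
      unfolding f_def gauss1_density_def by (intro continuous_intros) auto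
  next
    show "set_integrable lborel (einterval (- \<infinity>) \<infinity>) f"
      using int by (simp add: set_integrable_def)
    show "(((\<lambda>t. poly p t * gauss1_density t) \<circ> real_of_ereal) \<longlongrightarrow> 0) (at_left \<infinity>)"
      unfolding ereal_tendsto_simps by (rule poly_mult_gauss1_density_tendsto_0)
    have "((\<lambda>t. poly (pcompose p [:0, -1:]) t * gauss1_density t) \<longlongrightarrow> 0) at_top"
      by (rule poly_mult_gauss1_density_tendsto_0)
    then have "((\<lambda>t. poly p (- t) * gauss1_density (- t)) \<longlongrightarrow> 0) at_top"
      by (simp add: poly_pcompose gauss1_density_def)
    then show "(((\<lambda>t. poly p t * gauss1_density t) \<circ> real_of_ereal) \<longlongrightarrow> 0) (at_right (-\<infinity>))"
      unfolding ereal_tendsto_simps filterlim_at_bot_mirror .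
  qed simp
  then have "(\<integral>t. f t \<partial>lborel) = 0"
    by (simp add: interval_integral_to_infinity_eq interval_lebesgue_integral_def set_lebesgue_integral_def)
  moreover have "(\<integral>t. poly ([:0, 2:] * p - pderiv p) t \<partial>gauss1) = (\<integral>t. - f t \<partial>lborel)"
    unfolding gauss1_def
    by (subst integral_real_density)
      (auto simp: f_def algebra_simps intro!: Bochner_Integration.integral_cong)
  ultimately show ?thesis by simp
qed

text \<open>Differentiate the recursion once: after the induction hypothesis, the terms with
  derivatives are 2(k+1) times the recursion for H_k again.\<close>

lemma pderiv_hermite_Suc: "pderiv (hermite (Suc k)) = smult (2 * real (Suc k)) (hermite k)"
proof (induction k)
  case 0
  show ?case by (simp add: pderiv_pCons)
next
  case (Suc k)
  have "pderiv (hermite (Suc (Suc k))) =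
      smult 2 (hermite (Suc k)) + [:0, 2:] * pderiv (hermite (Suc k)) - pderiv (pderiv (hermite (Suc k)))"
    by (subst hermite.simps(2)) (simp only: pderiv_diff pderiv_mult, simp add: pderiv_pCons)
  also have "\<dots> = smult 2 (hermite (Suc k)) + smult (2 * real (Suc k)) (hermite (Suc k))"
    unfolding Suc.IH by (simp add: pderiv_smult smult_diff_right)
  also have "\<dots> = smult (2 * real (Suc (Suc k))) (hermite (Suc k))"
    by (simp add: smult_add_left [symmetric] del: hermite.simps)
  finally show ?case .
qed

lemma hermite_Suc_Suc:
  "hermite (Suc (Suc k)) = [:0, 2:] * hermite (Suc k) - smult (2 * real (Suc k)) (hermite k)"
  by (subst hermite.simps(2)) (simp only: pderiv_hermite_Suc)

lemma integral_hermite_Suc_mult: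
  "(\<integral>t. poly (hermite (Suc k) * p) t \<partial>gauss1) = (\<integral>t. poly (hermite k * pderiv p) t \<partial>gauss1)"
proof -
  have "[:0, 2:] * (hermite k * p) - pderiv (hermite k * p) = hermite (Suc k) * p - hermite k * pderiv p"
    by (simp add: pderiv_mult algebra_simps)
  then show ?thesis
    using gauss1_by_parts[of "hermite k * p"] integrable_poly_gauss1
    by (simp add: Bochner_Integration.integral_diff del: hermite.simps poly_mult)
qed

text \<open>Each raising step moves across as a derivative, which lowers the other index and
  contributes a factor 2(k+1), until one index is zero.\<close>

lemma integral_hermite_hermite:
  "(\<integral>t. poly (hermite m * hermite n) t \<partial>gauss1) = (if m = n then 2 ^ n * fact n else 0)"
proof (induction m arbitrary: n)
  case 0
  interpret prob_space gauss1 by (rule prob_space_gauss1)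
  show ?case
  proof (cases n)
    case (Suc k)
    then show ?thesis
      using integral_hermite_Suc_mult[of k 1] by (simp add: mult.commute del: hermite.simps(2))
  qed (use prob_space in simp)
next
  case (Suc m)
  show ?case
  proof (cases n)
    case 0
    then show ?thesis using integral_hermite_Suc_mult[of m 1] by simp
  next
    case (Suc k)
    have "(\<integral>t. poly (hermite (Suc m) * hermite (Suc k)) t \<partial>gauss1)
        = 2 * real (Suc k) * (\<integral>t. poly (hermite m * hermite k) t \<partial>gauss1)"
      unfolding integral_hermite_Suc_mult pderiv_hermite_Suc mult_smult_right poly_smult
      by (rule integral_mult_right_zero)
    then show ?thesis
      unfolding \<open>n = Suc k\<close> Suc.IH by (simp del: hermite.simps)
  qed
qed

text \<open>The Taylor coefficients of exp(- z^2) at 0.\<close>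

definition hcoef :: "nat \<Rightarrow> real" where
  "hcoef m = (if even m then (-1) ^ (m div 2) / fact (m div 2) else 0)"

lemma hcoef_rec: "real (Suc (Suc m)) * hcoef (Suc (Suc m)) = - 2 * hcoef m"
proof (cases "even m")
  case True
  then obtain b where "m = 2 * b" by blast
  moreover have "real (Suc (Suc (2 * b))) = 2 * real (Suc b)" by simp
  ultimately show ?thesis
    by (simp add: hcoef_def del: of_nat_Suc)
qed (simp add: hcoef_def)

text \<open>The coefficients of \<open>exp (2 x z) * exp (- z\<^sup>2)\<close>; the recursion below is the differential equation
  \<open>F' = (2 x - 2 z) F\<close>.\<close>

lemma hermite_Cauchy_product:
  "poly (hermite k) x / fact k = (\<Sum>i\<le>k. (2 * x) ^ i / fact i * hcoef (k - i))"
proof -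
  define G where "G = Abs_fps hcoef"
  define F where "F = fps_exp (2 * x) * G"
  have "fps_deriv G = - (2 * fps_X * G)"
  proof (rule fps_ext)
    fix n
    show "fps_nth (fps_deriv G) n = fps_nth (- (2 * fps_X * G)) n"
    proof (cases n)
      case 0
      then show ?thesis by (simp add: G_def hcoef_def mult.assoc)
    next
      case (Suc m)
      then show ?thesis
        using hcoef_rec[of m]
        by (simp add: G_def mult.assoc numeral_fps_const)
    qed
  qed
  then have "fps_deriv F = fps_const (2 * x) * F - fps_const 2 * (fps_X * F)"
    by (simp add: F_def algebra_simps numeral_fps_const)
  then have rec: "real (Suc n) * fps_nth F (Suc n) = 2 * x * fps_nth F n - 2 * fps_nth (fps_X * F) n" for n
    by (metis fps_deriv_nth fps_mult_left_const_nth fps_sub_nth Suc_eq_plus1)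
  have F0: "fps_nth F 0 = 1"
    by (simp add: F_def G_def hcoef_def)
  have "poly (hermite k) x / fact k = fps_nth F k \<and> poly (hermite (Suc k)) x / fact (Suc k) = fps_nth F (Suc k)"
  proof (induction k)
    case 0
    then show ?case using rec[of 0] F0 by simp
  next
    case (Suc k)
    have "poly (hermite (Suc (Suc k))) x = 2 * x * poly (hermite (Suc k)) x - 2 * real (Suc k) * poly (hermite k) x"
      by (subst hermite_Suc_Suc) (simp del: hermite.simps of_nat_Suc)
    also have "\<dots> = fact (Suc k) * (2 * x * fps_nth F (Suc k) - 2 * fps_nth F k)"
    proof -
      have 0: "poly (hermite k) x = fact k * fps_nth F k"
        and 1: "poly (hermite (Suc k)) x = fact (Suc k) * fps_nth F (Suc k)"
        using Suc.IH by (simp_all add: divide_eq_eq mult.commute del: fact_Suc hermite.simps)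
      show ?thesis
        unfolding 0 1 by (simp add: algebra_simps)
    qed
    also have "\<dots> = fact (Suc k) * (real (Suc (Suc k)) * fps_nth F (Suc (Suc k)))"
      using rec[of "Suc k"] by simp
    also have "\<dots> = fact (Suc (Suc k)) * fps_nth F (Suc (Suc k))"
      by (subst fact_Suc [of "Suc k"]) (simp add: mult_ac del: fact_Suc of_nat_Suc)
    finally have "poly (hermite (Suc (Suc k))) x / fact (Suc (Suc k)) = fps_nth F (Suc (Suc k))"
      by (simp del: fact_Suc hermite.simps)
    with Suc.IH show ?case by blast
  qed
  then show ?thesis
    by (simp add: F_def G_def fps_mult_nth atLeast0AtMost)
qed

lemma sums_even:
  fixes f :: "nat \<Rightarrow> 'a :: real_normed_vector"
  assumes "f sums s"
  shows "(\<lambda>n. if even n then f (n div 2) else 0) sums s"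
proof (subst sums_mono_reindex [symmetric])
  show "strict_mono (\<lambda>n :: nat. 2 * n)" by (simp add: strict_mono_def)
qed (use assms in auto)

lemma hcoef_sums: "(\<lambda>m. of_real (hcoef m) * z ^ m) sums exp (- z\<^sup>2)"
  for z :: "'a :: {real_normed_field, banach}"
proof -
  have "(\<lambda>m. (- z\<^sup>2) ^ m /\<^sub>R fact m) sums exp (- z\<^sup>2)"
    by (rule exp_converges)
  from sums_even[OF this] show ?thesis
    by (rule back_subst[where P = "\<lambda>f. f sums _"])
      (auto simp: hcoef_def fun_eq_iff scaleR_conv_of_real power_minus' power_mult [symmetric]
        elim!: evenE simp: field_simps)
qed

lemma abs_hcoef_sums: "(\<lambda>m. \<bar>hcoef m\<bar> * t ^ m) sums exp (t\<^sup>2)" for t :: real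
proof -
  have "(\<lambda>m. (t\<^sup>2) ^ m /\<^sub>R fact m) sums exp (t\<^sup>2)"
    by (rule exp_converges)
  from sums_even[OF this] show ?thesis
    by (rule back_subst[where P = "\<lambda>f. f sums _"])
      (auto simp: hcoef_def fun_eq_iff power_mult [symmetric] abs_divide elim!: evenE simp: field_simps)
qed

text \<open>Cauchy product of the series of exp(2 x z) and exp(- z^2). Complex \<open>z\<close>
  matters: imaginary values give the Hermite expansion of a plane wave.\<close>

lemma hermite_generating:
  fixes z :: complex
  shows "(\<lambda>k. of_real (poly (hermite k) x) * z ^ k / fact k) sums exp (2 * of_real x * z - z\<^sup>2)"
proof -
  let ?a = "\<lambda>i. (2 * of_real x * z) ^ i /\<^sub>R fact i"
  let ?b = "\<lambda>m. of_real (hcoef m) * z ^ m"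
  have "summable (\<lambda>i. norm (?a i))"
    by (rule summable_norm_exp)
  moreover have "summable (\<lambda>m. norm (?b m))"
    using sums_summable[OF abs_hcoef_sums[of "norm z"]] by (simp add: norm_mult norm_power)
  ultimately have "(\<lambda>k. \<Sum>i\<le>k. ?a i * ?b (k - i)) sums (suminf ?a * suminf ?b)"
    by (rule Cauchy_product_sums)
  also have "suminf ?a * suminf ?b = exp (2 * of_real x * z - z\<^sup>2)"
    using hcoef_sums[of z] exp_converges[of "2 * of_real x * z"]
    by (simp add: sums_iff mult_exp_exp)
  also have "(\<lambda>k. \<Sum>i\<le>k. ?a i * ?b (k - i)) = (\<lambda>k. of_real (poly (hermite k) x) * z ^ k / fact k)"
  proof
    fix k
    have "(\<Sum>i\<le>k. ?a i * ?b (k - i)) = (\<Sum>i\<le>k. of_real ((2 * x) ^ i / fact i * hcoef (k - i)) * z ^ k)"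
    proof (rule sum.cong)
      fix i assume "i \<in> {..k}"
      then have "z ^ k = z ^ i * z ^ (k - i)" by (simp add: power_add [symmetric])
      then show "?a i * ?b (k - i) = of_real ((2 * x) ^ i / fact i * hcoef (k - i)) * z ^ k"
        by (simp add: scaleR_conv_of_real field_simps power_mult_distrib)
    qed simp
    also have "\<dots> = of_real (poly (hermite k) x / fact k) * z ^ k"
      unfolding hermite_Cauchy_product by (simp add: sum_distrib_right)
    finally show "(\<Sum>i\<le>k. ?a i * ?b (k - i)) = of_real (poly (hermite k) x) * z ^ k / fact k"
      by simp
  qed
  finally show ?thesis .
qed

text \<open>Absolute values in the Cauchy product only replace exp(- t^2) by exp(t^2). The bound is
  the same for all \<open>N\<close>, so it can serve as a majorant.\<close>

lemma sum_abs_hermite_le: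
  assumes "t \<ge> 0"
  shows "(\<Sum>k<N. \<bar>poly (hermite k) x\<bar> * t ^ k / fact k) \<le> exp (2 * \<bar>x\<bar> * t + t\<^sup>2)"
proof -
  let ?a = "\<lambda>i. (2 * \<bar>x\<bar> * t) ^ i /\<^sub>R fact i"
  let ?b = "\<lambda>m. \<bar>hcoef m\<bar> * t ^ m"
  let ?c = "\<lambda>k. \<Sum>i\<le>k. ?a i * ?b (k - i)"
  have "summable (\<lambda>i. norm (?a i))"
    by (rule summable_norm_exp)
  moreover have "summable (\<lambda>m. norm (?b m))"
    using sums_summable[OF abs_hcoef_sums[of t]] assms by (simp add: norm_mult norm_power)
  ultimately have "?c sums (suminf ?a * suminf ?b)"
    by (rule Cauchy_product_sums)
  also have "suminf ?a * suminf ?b = exp (2 * \<bar>x\<bar> * t + t\<^sup>2)"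
    using abs_hcoef_sums[of t] exp_converges[of "2 * \<bar>x\<bar> * t"]
    by (simp add: sums_iff mult_exp_exp)
  finally have c: "?c sums exp (2 * \<bar>x\<bar> * t + t\<^sup>2)" .
  have "\<bar>poly (hermite k) x\<bar> * t ^ k / fact k \<le> ?c k" for k
  proof -
    have "\<bar>poly (hermite k) x\<bar> * t ^ k / fact k = \<bar>poly (hermite k) x / fact k\<bar> * t ^ k"
      by simp
    also have "\<dots> \<le> (\<Sum>i\<le>k. \<bar>(2 * x) ^ i / fact i * hcoef (k - i)\<bar>) * t ^ k"
      unfolding hermite_Cauchy_product using assms by (intro mult_right_mono sum_abs) auto
    also have "\<dots> = ?c k"
      unfolding sum_distrib_right
    proof (rule sum.cong)
      fix i assume "i \<in> {..k}"
      then have "t ^ k = t ^ i * t ^ (k - i)" by (simp add: power_add [symmetric])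
      then show "\<bar>(2 * x) ^ i / fact i * hcoef (k - i)\<bar> * t ^ k = ?a i * ?b (k - i)"
        by (simp add: abs_mult power_abs field_simps power_mult_distrib)
    qed simp
    finally show ?thesis .
  qed
  then have "(\<Sum>k<N. \<bar>poly (hermite k) x\<bar> * t ^ k / fact k) \<le> (\<Sum>k<N. ?c k)"
    by (rule sum_mono)
  also have "\<dots> \<le> suminf ?c"
    using sums_summable[OF c] assms
    by (intro sum_le_suminf) (auto intro!: sum_nonneg mult_nonneg_nonneg)
  also have "\<dots> = exp (2 * \<bar>x\<bar> * t + t\<^sup>2)"
    using c by (simp add: sums_iff)
  finally show ?thesis .
qed

lemma abs_hermite_le:
  assumes "t \<ge> 0"
  shows "\<bar>poly (hermite k) x\<bar> * t ^ k / fact k \<le> exp (2 * \<bar>x\<bar> * t + t\<^sup>2)"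
proof -
  have "\<bar>poly (hermite k) x\<bar> * t ^ k / fact k \<le> (\<Sum>k<Suc k. \<bar>poly (hermite k) x\<bar> * t ^ k / fact k)"
    using assms by (intro member_le_sum) auto
  also have "\<dots> \<le> exp (2 * \<bar>x\<bar> * t + t\<^sup>2)"
    using assms by (rule sum_abs_hermite_le)
  finally show ?thesis .
qed

section \<open>The Hilbert space \<open>L\<^sup>2(\<gamma>)\<close>\<close>

lemma L2_iff: "f \<in> L2 \<longleftrightarrow> f \<in> borel_measurable borel \<and> integrable gauss (\<lambda>x. (norm (f x))\<^sup>2)"
  by (simp add: L2_def)

lemma L2_measurable: "f \<in> L2 \<Longrightarrow> f \<in> borel_measurable borel"
  by (simp add: L2_iff)

lemma L2_integrable_mult:
  assumes "f \<in> L2" "g \<in> L2"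
  shows "integrable gauss (\<lambda>x. f x * g x)"
proof -
  have "integrable gauss (\<lambda>x. (norm (f x))\<^sup>2 + (norm (g x))\<^sup>2)"
    using assms by (simp add: L2_iff)
  then show ?thesis
  proof (rule Bochner_Integration.integrable_bound)
    show "(\<lambda>x. f x * g x) \<in> borel_measurable gauss"
      using assms[THEN L2_measurable] by simp
    show "AE x in gauss. norm (f x * g x) \<le> norm ((norm (f x))\<^sup>2 + (norm (g x))\<^sup>2)"
    proof (rule AE_I2)
      fix x
      have "2 * (norm (f x) * norm (g x)) \<le> (norm (f x))\<^sup>2 + (norm (g x))\<^sup>2"
        using sum_squares_bound[of "norm (f x)" "norm (g x)"] by simp
      moreover have "0 \<le> norm (f x) * norm (g x)" by simp
      ultimately have "norm (f x) * norm (g x) \<le> (norm (f x))\<^sup>2 + (norm (g x))\<^sup>2"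
        by linarith
      then show "norm (f x * g x) \<le> norm ((norm (f x))\<^sup>2 + (norm (g x))\<^sup>2)"
        unfolding norm_mult by simp
    qed
  qed
qed

lemma L2_cmult: "f \<in> L2 \<Longrightarrow> (\<lambda>x. c * f x) \<in> L2"
  by (auto simp: L2_iff norm_mult power_mult_distrib)

lemma L2_cnj:
  assumes "f \<in> L2"
  shows "(\<lambda>x. cnj (f x)) \<in> L2"
proof -
  have "cnj \<in> borel_measurable borel"
    by (intro borel_measurable_continuous_onI continuous_intros)
  from measurable_compose[OF L2_measurable[OF assms] this] show ?thesis
    using assms by (simp add: L2_iff)
qed

lemma L2_add:
  assumes "f \<in> L2" "g \<in> L2"
  shows "(\<lambda>x. f x + g x) \<in> L2"
proof -
  have "integrable gauss (\<lambda>x. 2 * ((norm (f x))\<^sup>2 + (norm (g x))\<^sup>2))"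
    using assms by (simp add: L2_iff)
  then have "integrable gauss (\<lambda>x. (norm (f x + g x))\<^sup>2)"
  proof (rule Bochner_Integration.integrable_bound)
    show "(\<lambda>x. (norm (f x + g x))\<^sup>2) \<in> borel_measurable gauss"
      using assms[THEN L2_measurable] by simp
    show "AE x in gauss. norm ((norm (f x + g x))\<^sup>2) \<le> norm (2 * ((norm (f x))\<^sup>2 + (norm (g x))\<^sup>2))"
    proof (rule AE_I2)
      fix x
      have "(norm (f x + g x))\<^sup>2 \<le> (norm (f x) + norm (g x))\<^sup>2"
        by (intro power_mono norm_triangle_ineq) simp
      also have "\<dots> \<le> 2 * ((norm (f x))\<^sup>2 + (norm (g x))\<^sup>2)"
        using sum_squares_bound[of "norm (f x)" "norm (g x)"] by (simp add: power2_sum)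
      finally show "norm ((norm (f x + g x))\<^sup>2) \<le> norm (2 * ((norm (f x))\<^sup>2 + (norm (g x))\<^sup>2))"
        by simp
    qed
  qed
  then show ?thesis
    using assms[THEN L2_measurable] by (simp add: L2_iff)
qed

lemma L2_diff:
  assumes "f \<in> L2" "g \<in> L2"
  shows "(\<lambda>x. f x - g x) \<in> L2"
  using L2_add[OF assms(1) L2_cmult[OF assms(2), of "-1"]] by simp

lemma L2_zero: "(\<lambda>x. 0) \<in> L2"
  by (simp add: L2_iff)

lemma L2_sum: "(\<And>i. i \<in> I \<Longrightarrow> f i \<in> L2) \<Longrightarrow> (\<lambda>x. \<Sum>i\<in>I. f i x) \<in> L2"
  by (induction I rule: infinite_finite_induct) (simp_all add: L2_zero L2_add)

lemma L2_bounded: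
  assumes "f \<in> borel_measurable borel" "\<And>x. norm (f x) \<le> K"
  shows "f \<in> L2"
proof -
  interpret prob_space "gauss :: (real ^ 'n) measure" by (rule prob_space_gauss)
  have "(norm (f x))\<^sup>2 \<le> K\<^sup>2" for x
    using assms(2) by (intro power_mono) auto
  then show ?thesis
    using assms by (auto simp: L2_iff intro!: integrable_const_bound[of _ "K\<^sup>2"])
qed

lemma L2_integrable: "f \<in> L2 \<Longrightarrow> integrable gauss f"
  using L2_integrable_mult[of f "\<lambda>_. 1"] L2_bounded[of "\<lambda>_. 1" 1] by simp

lemma L2_norm_nonneg: "0 \<le> L2_norm f"
  by (simp add: L2_norm_def)

lemma L2_norm_square: "(L2_norm f)\<^sup>2 = (\<integral>x. (norm (f x))\<^sup>2 \<partial>gauss)"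
  by (simp add: L2_norm_def)

lemma L2_norm_square_ennreal:
  "f \<in> L2 \<Longrightarrow> ennreal ((L2_norm f)\<^sup>2) = (\<integral>\<^sup>+x. ennreal ((norm (f x))\<^sup>2) \<partial>gauss)"
  unfolding L2_norm_square by (subst nn_integral_eq_integral) (auto simp: L2_iff)

lemma L2_norm_cmult: "L2_norm (\<lambda>x. c * f x) = norm c * L2_norm f"
  by (simp add: L2_norm_def norm_mult power_mult_distrib real_sqrt_mult)

lemma L2_Cauchy_Schwarz:
  assumes "f \<in> L2" "g \<in> L2"
  shows "norm (\<integral>x. f x * g x \<partial>gauss) \<le> L2_norm f * L2_norm g"
proof -
  let ?I = "\<integral>x. norm (f x * g x) \<partial>gauss"
  have meas [measurable]: "f \<in> borel_measurable borel" "g \<in> borel_measurable borel"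
    using assms by (auto simp: L2_iff)
  have "(ennreal ?I)\<^sup>2 = (\<integral>\<^sup>+x. ennreal (norm (f x)) * ennreal (norm (g x)) \<partial>gauss)\<^sup>2"
    using integrable_norm[OF L2_integrable_mult[OF assms]]
    by (subst nn_integral_eq_integral [symmetric]) (auto simp: norm_mult ennreal_mult)
  also have "\<dots> \<le> (\<integral>\<^sup>+x. (ennreal (norm (f x)))\<^sup>2 \<partial>gauss) * (\<integral>\<^sup>+x. (ennreal (norm (g x)))\<^sup>2 \<partial>gauss)"
    by (rule Cauchy_Schwarz_nn_integral) auto
  also have "\<dots> = ennreal ((L2_norm f * L2_norm g)\<^sup>2)"
    using assms by (simp add: power_mult_distrib ennreal_mult L2_norm_square_ennreal ennreal_power)
  finally have "?I\<^sup>2 \<le> (L2_norm f * L2_norm g)\<^sup>2"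
    by (simp add: ennreal_power)
  then have "?I \<le> L2_norm f * L2_norm g"
    by (rule power2_le_imp_le) (simp add: L2_norm_nonneg)
  then show ?thesis
    using integral_norm_bound[of gauss "\<lambda>x. f x * g x"] by linarith
qed

lemma L2_Pythagoras:
  assumes "f \<in> L2" "g \<in> L2" "L2_inner f g = 0"
  shows "(L2_norm (\<lambda>x. f x + g x))\<^sup>2 = (L2_norm f)\<^sup>2 + (L2_norm g)\<^sup>2"
proof -
  define h where "h x = f x * cnj (g x)" for x
  have int: "integrable gauss h"
    unfolding h_def using assms L2_integrable_mult L2_cnj by blast
  have "(norm (f x + g x))\<^sup>2 = (norm (f x))\<^sup>2 + (norm (g x))\<^sup>2 + 2 * Re (h x)" for x
    unfolding cmod_power2 h_def by (simp add: power2_eq_square algebra_simps)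
  then have "(L2_norm (\<lambda>x. f x + g x))\<^sup>2 = (L2_norm f)\<^sup>2 + (L2_norm g)\<^sup>2 + (\<integral>x. 2 * Re (h x) \<partial>gauss)"
    unfolding L2_norm_square using assms int by (simp add: L2_iff)
  also have "(\<integral>x. 2 * Re (h x) \<partial>gauss) = 2 * Re (L2_inner f g)"
    unfolding L2_inner_def h_def [symmetric] using int by simp
  finally show ?thesis using assms by simp
qed

lemma L2_inner_sum_left:
  assumes "\<And>i. i \<in> I \<Longrightarrow> f i \<in> L2" "g \<in> L2"
  shows "L2_inner (\<lambda>x. \<Sum>i\<in>I. f i x) g = (\<Sum>i\<in>I. L2_inner (f i) g)"
  unfolding L2_inner_def sum_distrib_right
  by (rule Bochner_Integration.integral_sum) (use assms L2_integrable_mult L2_cnj in blast)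

lemma L2_norm_sum_orthogonal:
  assumes "finite J" "\<And>j. j \<in> J \<Longrightarrow> v j \<in> L2" "\<And>i j. i \<in> J \<Longrightarrow> j \<in> J \<Longrightarrow> i \<noteq> j \<Longrightarrow> L2_inner (v i) (v j) = 0"
  shows "(L2_norm (\<lambda>x. \<Sum>j\<in>J. v j x))\<^sup>2 = (\<Sum>j\<in>J. (L2_norm (v j))\<^sup>2)"
  using assms
proof (induction J rule: finite_induct)
  case empty
  show ?case by (simp add: L2_norm_def)
next
  case (insert j J)
  have "L2_inner (\<lambda>x. \<Sum>i\<in>J. v i x) (v j) = (\<Sum>i\<in>J. L2_inner (v i) (v j))"
    using insert.prems by (intro L2_inner_sum_left) auto
  also have "\<dots> = 0"
    using insert by (intro sum.neutral) auto
  finally have "L2_inner (\<lambda>x. \<Sum>i\<in>J. v i x) (v j) = 0" .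
  then have "(L2_norm (\<lambda>x. (\<Sum>i\<in>J. v i x) + v j x))\<^sup>2
      = (L2_norm (\<lambda>x. \<Sum>i\<in>J. v i x))\<^sup>2 + (L2_norm (v j))\<^sup>2"
    using insert by (intro L2_Pythagoras L2_sum) auto
  then show ?case
    using insert by (simp add: add.commute)
qed

text \<open>The Riesz-Fischer theorem for representatives. It supplies the limit that the choice
  operator in \<open>OU_spectral\<close> refers to.\<close>

lemma L2_complete:
  fixes s :: "nat \<Rightarrow> real ^ 'n \<Rightarrow> complex"
  assumes L2: "\<And>n. s n \<in> L2"
    and Cauchy: "\<And>e. e > 0 \<Longrightarrow> \<exists>N. \<forall>m\<ge>N. \<forall>n\<ge>N. (L2_norm (\<lambda>x. s m x - s n x))\<^sup>2 < e"
  shows "\<exists>g\<in>L2. (\<lambda>n. L2_norm (\<lambda>x. g x - s n x)) \<longlonglongrightarrow> 0"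
proof -
  have [measurable]: "s n \<in> borel_measurable borel" for n
    using L2 by (simp add: L2_iff)
  \<comment> \<open>Squared norms below 4^-k along a subsequence remain summable after
    multiplication by the weight 2^k used below.\<close>
  have "\<forall>k :: nat. \<exists>N. \<forall>m\<ge>N. \<forall>n\<ge>N. (L2_norm (\<lambda>x. s m x - s n x))\<^sup>2 < (1 / 4) ^ k"
    using Cauchy by simp
  then obtain N where N: "\<And>k m n. m \<ge> N k \<Longrightarrow> n \<ge> N k \<Longrightarrow> (L2_norm (\<lambda>x. s m x - s n x))\<^sup>2 < (1 / 4) ^ k"
    by metis
  define \<phi> where "\<phi> k = (\<Sum>i\<le>k. N i)" for k
  have \<phi>: "\<phi> k \<ge> N j" if "k \<ge> j" for k j
    unfolding \<phi>_def using that by (intro member_le_sum) auto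
  define d where "d k x = s (\<phi> (Suc k)) x - s (\<phi> k) x" for k x
  have [measurable]: "d k \<in> borel_measurable borel" for k
    unfolding d_def by measurable
  have d_L2: "d k \<in> L2" for k
    unfolding d_def by (intro L2_diff L2)
  define g where "g x = lim (\<lambda>k. s (\<phi> k) x)" for x
  have [measurable]: "g \<in> borel_measurable borel"
    unfolding g_def by measurable
  have "(\<integral>\<^sup>+x. (\<Sum>k. ennreal (2 ^ k * (norm (d k x))\<^sup>2)) \<partial>gauss)
      = (\<Sum>k. ennreal (2 ^ k * (L2_norm (d k))\<^sup>2))"
    by (subst nn_integral_suminf)
      (simp_all add: ennreal_mult nn_integral_cmult L2_norm_square_ennreal[OF d_L2])
  also have "\<dots> \<le> (\<Sum>k. ennreal ((1 / 2) ^ k))"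
  proof (intro suminf_le ennreal_leI)
    fix k :: nat
    have "(L2_norm (d k))\<^sup>2 \<le> (1 / 4) ^ k"
      unfolding d_def using N[OF \<phi> \<phi>, of k "Suc k" k] by simp
    then have "2 ^ k * (L2_norm (d k))\<^sup>2 \<le> 2 ^ k * (1 / 4) ^ k"
      by simp
    also have "\<dots> = (1 / 2) ^ k"
      unfolding power_mult_distrib [symmetric] by simp
    finally show "2 ^ k * (L2_norm (d k))\<^sup>2 \<le> (1 / 2 :: real) ^ k" .
  qed auto
  also have "\<dots> < \<infinity>"
    by (subst suminf_ennreal2) (auto simp: less_top)
  finally have "AE x in gauss. (\<Sum>k. ennreal (2 ^ k * (norm (d k x))\<^sup>2)) \<noteq> \<infinity>"
    by (intro nn_integral_PInf_AE) auto
  then have conv: "AE x in gauss. (\<lambda>k. s (\<phi> k) x) \<longlonglongrightarrow> g x"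
  proof eventually_elim
    case (elim x)
    have "summable (\<lambda>k. 2 ^ k * (norm (d k x))\<^sup>2)"
      using elim by (intro summable_suminf_not_top) auto
    then have "summable (\<lambda>k. (1 / 2) ^ k + 2 ^ k * (norm (d k x))\<^sup>2)"
      by (intro summable_add) auto
    then have "summable (\<lambda>k. norm (d k x))"
    proof (rule summable_comparison_test')
      fix k :: nat
      define a :: real where "a = 2 ^ k"
      have a: "a > 0" "(1 / 2 :: real) ^ k = 1 / a"
        by (simp_all add: a_def power_one_over)
      \<comment> \<open>With N the norm of \<open>d k x\<close>, expanding and halving gives a N
        \<le> 1 + (a N)^2. Thus summability of 2^k N^2 yields absolute convergence of the
        increments.\<close>
      have "0 \<le> (1 - a * norm (d k x))\<^sup>2 + 1 + (a * norm (d k x))\<^sup>2" by simp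
      then have "a * norm (d k x) \<le> a * (1 / a + a * (norm (d k x))\<^sup>2)"
        using a by (simp add: power2_eq_square algebra_simps)
      then show "norm (norm (d k x)) \<le> (1 / 2) ^ k + 2 ^ k * (norm (d k x))\<^sup>2"
        unfolding a(2) using a(1) by (simp add: a_def)
    qed
    then have "summable (\<lambda>k. d k x)"
      by (rule summable_norm_cancel)
    then have "convergent (\<lambda>n. s (\<phi> 0) x + (\<Sum>k<n. d k x))"
      unfolding summable_iff_convergent by (intro convergent_add convergent_const)
    moreover have "(\<lambda>n. s (\<phi> 0) x + (\<Sum>k<n. d k x)) = (\<lambda>n. s (\<phi> n) x)"
      unfolding d_def using sum_lessThan_telescope[of "\<lambda>k. s (\<phi> k) x"] by (simp add: fun_eq_iff)
    ultimately show ?case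
      unfolding g_def by (simp add: convergent_LIMSEQ_iff)
  qed
  \<comment> \<open>Fatou along the subsequence turns the Cauchy estimate into one against the limit
    \<open>g\<close>, valid for every late \<open>n\<close>, so the whole sequence
    converges.\<close>
  have bound: "(\<lambda>x. g x - s n x) \<in> L2 \<and> (L2_norm (\<lambda>x. g x - s n x))\<^sup>2 \<le> (1 / 4) ^ j" if "n \<ge> N j" for n j
  proof -
    have "(\<integral>\<^sup>+x. ennreal ((norm (g x - s n x))\<^sup>2) \<partial>gauss)
        = (\<integral>\<^sup>+x. liminf (\<lambda>k. ennreal ((norm (s (\<phi> k) x - s n x))\<^sup>2)) \<partial>gauss)"
    proof (rule nn_integral_cong_AE)
      show "AE x in gauss. ennreal ((norm (g x - s n x))\<^sup>2) = liminf (\<lambda>k. ennreal ((norm (s (\<phi> k) x - s n x))\<^sup>2))"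
        using conv
      proof eventually_elim
        case (elim x)
        then have "(\<lambda>k. ennreal ((norm (s (\<phi> k) x - s n x))\<^sup>2)) \<longlonglongrightarrow> ennreal ((norm (g x - s n x))\<^sup>2)"
          by (intro tendsto_intros)
        then show ?case
          by (intro lim_imp_Liminf [symmetric]) simp_all
      qed
    qed
    also have "\<dots> \<le> liminf (\<lambda>k. \<integral>\<^sup>+x. ennreal ((norm (s (\<phi> k) x - s n x))\<^sup>2) \<partial>gauss)"
      by (rule nn_integral_liminf) measurable
    also have "\<dots> = liminf (\<lambda>k. ennreal ((L2_norm (\<lambda>x. s (\<phi> k) x - s n x))\<^sup>2))"
      by (subst L2_norm_square_ennreal) (auto intro: L2_diff L2)
    also have "\<dots> \<le> limsup (\<lambda>k. ennreal ((L2_norm (\<lambda>x. s (\<phi> k) x - s n x))\<^sup>2))"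
      by (rule Liminf_le_Limsup) simp
    also have "\<dots> \<le> ennreal ((1 / 4) ^ j)"
    proof (rule Limsup_bounded)
      show "\<forall>\<^sub>F k in sequentially. ennreal ((L2_norm (\<lambda>x. s (\<phi> k) x - s n x))\<^sup>2) \<le> ennreal ((1 / 4) ^ j)"
        using eventually_ge_at_top[of j]
      proof eventually_elim
        case (elim k)
        show ?case
          using N[OF \<phi>[OF elim] that] by (intro ennreal_leI) simp
      qed
    qed
    finally have le: "(\<integral>\<^sup>+x. ennreal ((norm (g x - s n x))\<^sup>2) \<partial>gauss) \<le> ennreal ((1 / 4) ^ j)" .
    then have "(\<integral>\<^sup>+x. ennreal ((norm (g x - s n x))\<^sup>2) \<partial>gauss) < \<infinity>"
      by (rule le_less_trans) simp
    then have L2': "(\<lambda>x. g x - s n x) \<in> L2"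
      by (auto simp: L2_iff integrable_iff_bounded)
    with le show ?thesis
      by (simp add: L2_norm_square_ennreal [symmetric])
  qed
  have "g \<in> L2"
    using L2_add[OF bound[of 0 "N 0", THEN conjunct1] L2[of "N 0"]] by simp
  moreover have "(\<lambda>n. (L2_norm (\<lambda>x. g x - s n x))\<^sup>2) \<longlonglongrightarrow> 0"
  proof (rule LIMSEQ_I)
    fix e :: real assume "e > 0"
    then obtain j where j: "(1 / 4) ^ j < e"
      using real_arch_pow_inv[of e "1 / 4"] by auto
    show "\<exists>no. \<forall>n\<ge>no. norm ((L2_norm (\<lambda>x. g x - s n x))\<^sup>2 - 0) < e"
      using bound[of j] j by (intro exI[of _ "N j"]) force
  qed
  then have "(\<lambda>n. sqrt ((L2_norm (\<lambda>x. g x - s n x))\<^sup>2)) \<longlonglongrightarrow> sqrt 0"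
    by (rule tendsto_real_sqrt)
  then have "(\<lambda>n. L2_norm (\<lambda>x. g x - s n x)) \<longlonglongrightarrow> 0"
    by (simp add: L2_norm_nonneg)
  ultimately show ?thesis by blast
qed

section \<open>Hermite projections and spectral multipliers\<close>

text \<open>A class closed under products and contained in \<open>L2\<close>. The majorant is a
  product over coordinates so that its Gaussian integral factors.\<close>

definition exp_growth :: "(real ^ 'n \<Rightarrow> complex) \<Rightarrow> bool" where
  "exp_growth f \<longleftrightarrow> f \<in> borel_measurable borel \<and>
     (\<exists>K c. \<forall>x. norm (f x) \<le> K * (\<Prod>i\<in>UNIV. exp (c * \<bar>x $ i\<bar>)))"

lemma exp_growthI:
  assumes "f \<in> borel_measurable borel" "\<And>x. norm (f x) \<le> K * (\<Prod>i\<in>UNIV. exp (c * \<bar>x $ i\<bar>))"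
  shows "exp_growth f"
  using assms by (auto simp: exp_growth_def)

lemma integrable_prod_exp_abs: "integrable gauss (\<lambda>x :: real ^ 'n. \<Prod>i\<in>UNIV. exp (c * \<bar>x $ i\<bar>))"
  by (rule integrable_gauss_prod[where f = "\<lambda>_ t. exp (c * \<bar>t\<bar>)"]) (rule integrable_gauss1_exp_abs)

lemma exp_growth_mult:
  assumes "exp_growth f" "exp_growth g"
  shows "exp_growth (\<lambda>x. f x * g x)"
proof -
  obtain K c where f: "f \<in> borel_measurable borel" "\<And>x. norm (f x) \<le> K * (\<Prod>i\<in>UNIV. exp (c * \<bar>x $ i\<bar>))"
    using assms(1) by (auto simp: exp_growth_def)
  obtain L d where g: "g \<in> borel_measurable borel" "\<And>x. norm (g x) \<le> L * (\<Prod>i\<in>UNIV. exp (d * \<bar>x $ i\<bar>))"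
    using assms(2) by (auto simp: exp_growth_def)
  show ?thesis
  proof (rule exp_growthI)
    show "(\<lambda>x. f x * g x) \<in> borel_measurable borel"
      using f(1) g(1) by (rule borel_measurable_times)
    fix x
    have "norm (f x * g x) \<le> (K * (\<Prod>i\<in>UNIV. exp (c * \<bar>x $ i\<bar>))) * (L * (\<Prod>i\<in>UNIV. exp (d * \<bar>x $ i\<bar>)))"
      unfolding norm_mult using f(2)[of x] g(2)[of x] order_trans[OF norm_ge_zero f(2)]
      by (intro mult_mono) auto
    then show "norm (f x * g x) \<le> (K * L) * (\<Prod>i\<in>UNIV. exp ((c + d) * \<bar>x $ i\<bar>))"
      by (simp add: distrib_right exp_add prod.distrib mult_ac)
  qed
qed

lemma exp_growth_integrable:
  fixes f :: "real ^ 'n \<Rightarrow> complex"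
  assumes "exp_growth f"
  shows "integrable gauss f"
proof -
  obtain K c where f: "f \<in> borel_measurable borel" "\<And>x. norm (f x) \<le> K * (\<Prod>i\<in>UNIV. exp (c * \<bar>x $ i\<bar>))"
    using assms by (auto simp: exp_growth_def)
  have "integrable gauss (\<lambda>x :: real ^ 'n. K * (\<Prod>i\<in>UNIV. exp (c * \<bar>x $ i\<bar>)))"
    by (intro integrable_mult_right integrable_prod_exp_abs)
  then show ?thesis
    by (rule Bochner_Integration.integrable_bound) (use f in \<open>auto intro: AE_I2 order_trans[OF _ abs_ge_self]\<close>)
qed

lemma exp_growth_L2:
  assumes "exp_growth f"
  shows "f \<in> L2"
proof -
  have f: "f \<in> borel_measurable borel"
    using assms by (simp add: exp_growth_def)
  have "integrable gauss (\<lambda>x. norm (f x * f x))"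
    by (intro integrable_norm exp_growth_integrable exp_growth_mult assms)
  then show ?thesis
    using f by (simp add: L2_iff norm_mult power2_eq_square)
qed

definition hermite_norm2 :: "('n :: finite \<Rightarrow> nat) \<Rightarrow> real" where
  "hermite_norm2 \<alpha> = (\<Prod>i\<in>UNIV. 2 ^ \<alpha> i * fact (\<alpha> i))"

lemma hermite_norm2_nonzero [simp]: "hermite_norm2 \<alpha> \<noteq> 0"
  by (simp add: hermite_norm2_def)

lemma hermite_multi_measurable [measurable]: "hermite_multi \<alpha> \<in> borel_measurable borel"
  unfolding hermite_multi_def by measurable

lemma exp_growth_hermite_multi: "exp_growth (\<lambda>x. of_real (hermite_multi \<alpha> x))"
proof -
  have "\<forall>i. \<exists>K. \<forall>t. \<bar>poly (hermite (\<alpha> i)) t\<bar> \<le> K * exp \<bar>t\<bar>"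
    using abs_poly_le_exp by blast
  then obtain K where K: "\<And>i t. \<bar>poly (hermite (\<alpha> i)) t\<bar> \<le> K i * exp \<bar>t\<bar>"
    by metis
  show ?thesis
  proof (rule exp_growthI)
    fix x
    have "norm (complex_of_real (hermite_multi \<alpha> x)) \<le> (\<Prod>i\<in>UNIV. K i * exp \<bar>x $ i\<bar>)"
      unfolding hermite_multi_def norm_of_real abs_prod using K by (intro prod_mono) auto
    then show "norm (complex_of_real (hermite_multi \<alpha> x)) \<le> (\<Prod>i\<in>UNIV. K i) * (\<Prod>i\<in>UNIV. exp (1 * \<bar>x $ i\<bar>))"
      by (simp add: prod.distrib)
  qed simp
qed

lemma L2_hermite_multi: "(\<lambda>x. of_real (hermite_multi \<alpha> x)) \<in> L2"
  by (rule exp_growth_L2[OF exp_growth_hermite_multi])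

lemma integral_hermite_multi:
  "(\<integral>x. complex_of_real (hermite_multi \<alpha> x) * of_real (hermite_multi \<beta> x) \<partial>(gauss :: (real ^ 'n) measure))
    = (if \<alpha> = \<beta> then of_real (hermite_norm2 \<alpha>) else 0)"
proof -
  have "(\<integral>x. hermite_multi \<alpha> x * hermite_multi \<beta> x \<partial>(gauss :: (real ^ 'n) measure))
      = (\<integral>x. (\<Prod>i\<in>UNIV. poly (hermite (\<alpha> i) * hermite (\<beta> i)) (x $ i)) \<partial>(gauss :: (real ^ 'n) measure))"
    by (simp add: hermite_multi_def prod.distrib)
  also have "\<dots> = (\<Prod>i\<in>UNIV. \<integral>t. poly (hermite (\<alpha> i) * hermite (\<beta> i)) t \<partial>gauss1)"
    by (rule integral_gauss_prod) (rule integrable_poly_gauss1)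
  also have "\<dots> = (if \<alpha> = \<beta> then hermite_norm2 \<alpha> else 0)"
    unfolding integral_hermite_hermite hermite_norm2_def by (auto simp: fun_eq_iff)
  finally show ?thesis
    by (simp add: of_real_mult [symmetric] del: of_real_mult)
qed

abbreviation multi_index :: "nat \<Rightarrow> ('n :: finite \<Rightarrow> nat) set" where
  "multi_index j \<equiv> {\<alpha>. (\<Sum>i\<in>UNIV. \<alpha> i) = j}"

lemma finite_multi_index [simp]: "finite (multi_index j :: ('n :: finite \<Rightarrow> nat) set)"
proof -
  have "multi_index j \<subseteq> (\<Pi>\<^sub>E i\<in>(UNIV :: 'n set). {..j})"
  proof
    fix \<alpha> :: "'n \<Rightarrow> nat" assume "\<alpha> \<in> multi_index j"
    then have "\<alpha> i \<le> j" for i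
      using member_le_sum[of i UNIV \<alpha>] by auto
    then show "\<alpha> \<in> (\<Pi>\<^sub>E i\<in>(UNIV :: 'n set). {..j})"
      by auto
  qed
  then show ?thesis
    by (rule finite_subset) (intro finite_PiE; simp)
qed

lemma hermite_spaceI: "(\<lambda>x. \<Sum>\<alpha>\<in>multi_index j. c \<alpha> * of_real (hermite_multi \<alpha> x)) \<in> hermite_space j"
  unfolding hermite_space_def by (intro CollectI exI) (rule refl)

lemma hermite_space_cnj:
  assumes "p \<in> hermite_space j"
  shows "(\<lambda>x. cnj (p x)) \<in> hermite_space j"
proof -
  obtain c where "p = (\<lambda>x. \<Sum>\<alpha>\<in>multi_index j. c \<alpha> * of_real (hermite_multi \<alpha> x))"
    using assms by (auto simp: hermite_space_def)
  then have "(\<lambda>x. cnj (p x)) = (\<lambda>x. \<Sum>\<alpha>\<in>multi_index j. cnj (c \<alpha>) * of_real (hermite_multi \<alpha> x))"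
    by simp
  then show ?thesis
    by (simp only: hermite_spaceI)
qed

lemma hermite_space_basis: "(\<lambda>x. of_real (hermite_multi \<alpha> x)) \<in> hermite_space (\<Sum>i\<in>UNIV. \<alpha> i)"
proof -
  have "(\<lambda>x. complex_of_real (hermite_multi \<alpha> x)) =
      (\<lambda>x. \<Sum>\<beta>\<in>multi_index (\<Sum>i\<in>UNIV. \<alpha> i). (if \<beta> = \<alpha> then 1 else 0) * of_real (hermite_multi \<beta> x))"
    by (simp add: if_distrib[of "\<lambda>c. c * _"] cong: if_cong)
  then show ?thesis
    by (simp only: hermite_spaceI)
qed

lemma hermite_space_L2:
  assumes "p \<in> hermite_space j"
  shows "p \<in> L2"
proof -
  obtain c where "p = (\<lambda>x. \<Sum>\<alpha>\<in>multi_index j. c \<alpha> * of_real (hermite_multi \<alpha> x))"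
    using assms by (auto simp: hermite_space_def)
  then show ?thesis
    by (auto intro!: L2_sum L2_cmult L2_hermite_multi)
qed

lemma integral_hermite_space:
  assumes f: "f \<in> L2" and p: "p = (\<lambda>x. \<Sum>\<alpha>\<in>I. c \<alpha> * of_real (hermite_multi \<alpha> x))"
  shows "(\<integral>x. f x * p x \<partial>gauss) = (\<Sum>\<alpha>\<in>I. c \<alpha> * (\<integral>x. f x * of_real (hermite_multi \<alpha> x) \<partial>gauss))"
proof -
  have int: "integrable gauss (\<lambda>x. f x * of_real (hermite_multi \<alpha> x))" for \<alpha>
    by (rule L2_integrable_mult[OF f L2_hermite_multi])
  have "f x * p x = (\<Sum>\<alpha>\<in>I. c \<alpha> * (f x * of_real (hermite_multi \<alpha> x)))" for x
    by (simp add: p sum_distrib_left mult_ac)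
  then show ?thesis
    using int by (simp add: Bochner_Integration.integral_sum)
qed

lemma integral_hermite_space_multi:
  fixes p :: "real ^ 'n \<Rightarrow> complex"
  assumes p: "p = (\<lambda>x. \<Sum>\<alpha>\<in>I. c \<alpha> * of_real (hermite_multi \<alpha> x))" and "finite I"
  shows "(\<integral>x. p x * of_real (hermite_multi \<beta> x) \<partial>gauss) = (if \<beta> \<in> I then c \<beta> * of_real (hermite_norm2 \<beta>) else 0)"
proof -
  have "(\<integral>x. p x * of_real (hermite_multi \<beta> x) \<partial>gauss)
      = (\<integral>x. of_real (hermite_multi \<beta> x) * p x \<partial>gauss)"
    by (simp add: mult.commute)
  also have "\<dots> = (\<Sum>\<alpha>\<in>I. c \<alpha> * (if \<beta> = \<alpha> then of_real (hermite_norm2 \<beta>) else 0))"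
    by (subst integral_hermite_space[OF L2_hermite_multi p])
      (simp add: integral_hermite_multi)
  also have "\<dots> = (if \<beta> \<in> I then c \<beta> * of_real (hermite_norm2 \<beta>) else 0)"
    using \<open>finite I\<close> by (simp add: if_distrib[of "\<lambda>x. _ * x"] cong: if_cong)
  finally show ?thesis .
qed

lemma hermite_spaces_orthogonal:
  assumes "p \<in> hermite_space i" "q \<in> hermite_space j" "i \<noteq> j"
  shows "(\<integral>x. p x * q x \<partial>gauss) = 0"
proof -
  obtain c where p: "p = (\<lambda>x. \<Sum>\<alpha>\<in>multi_index i. c \<alpha> * of_real (hermite_multi \<alpha> x))"
    using assms by (auto simp: hermite_space_def)
  obtain d where q: "q = (\<lambda>x. \<Sum>\<alpha>\<in>multi_index j. d \<alpha> * of_real (hermite_multi \<alpha> x))"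
    using assms by (auto simp: hermite_space_def)
  show ?thesis
    unfolding integral_hermite_space[OF hermite_space_L2[OF assms(1)] q]
      integral_hermite_space_multi[OF p finite_multi_index]
    using assms(3) by (intro sum.neutral) auto
qed

text \<open>Makes the definite description concrete. Testing against the orthogonal basis determines
  every coefficient of a candidate, so uniqueness holds for the polynomial as a function.\<close>

lemma hermite_proj_eq:
  assumes f: "f \<in> L2"
  shows "hermite_proj j f = (\<lambda>x. \<Sum>\<alpha>\<in>multi_index j.
           ((\<integral>y. f y * of_real (hermite_multi \<alpha> y) \<partial>gauss) / of_real (hermite_norm2 \<alpha>)) * of_real (hermite_multi \<alpha> x))"
    (is "_ = ?p")
  unfolding hermite_proj_def
proof (rule the_equality)
  have mem: "?p \<in> hermite_space j"
    by (rule hermite_spaceI)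
  have diff: "(\<integral>x. (f x - p x) * of_real (hermite_multi \<beta> x) \<partial>gauss)
      = (\<integral>x. f x * of_real (hermite_multi \<beta> x) \<partial>gauss) - (\<integral>x. p x * of_real (hermite_multi \<beta> x) \<partial>gauss)"
    if "p \<in> hermite_space j" for p \<beta>
    unfolding left_diff_distrib
    using L2_integrable_mult[OF f L2_hermite_multi] L2_integrable_mult[OF hermite_space_L2[OF that] L2_hermite_multi]
    by (rule Bochner_Integration.integral_diff)
  have "L2_inner (\<lambda>x. f x - ?p x) q = 0" if q: "q \<in> hermite_space j" for q
  proof -
    obtain d where d: "(\<lambda>x. cnj (q x)) = (\<lambda>x. \<Sum>\<alpha>\<in>multi_index j. d \<alpha> * of_real (hermite_multi \<alpha> x))"
      using hermite_space_cnj[OF q] by (auto simp: hermite_space_def)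
    have "L2_inner (\<lambda>x. f x - ?p x) q =
        (\<Sum>\<alpha>\<in>multi_index j. d \<alpha> * (\<integral>x. (f x - ?p x) * of_real (hermite_multi \<alpha> x) \<partial>gauss))"
      unfolding L2_inner_def
      by (rule integral_hermite_space[OF L2_diff[OF f hermite_space_L2[OF mem]] d])
    also have "\<dots> = 0"
      unfolding diff[OF mem] integral_hermite_space_multi[OF refl finite_multi_index]
      by (intro sum.neutral) auto
    finally show ?thesis .
  qed
  with mem show "?p \<in> hermite_space j \<and> (\<forall>q\<in>hermite_space j. L2_inner (\<lambda>x. f x - ?p x) q = 0)"
    by blast
  fix p assume "p \<in> hermite_space j \<and> (\<forall>q\<in>hermite_space j. L2_inner (\<lambda>x. f x - p x) q = 0)"
  then have p: "p \<in> hermite_space j" and orth: "\<And>q. q \<in> hermite_space j \<Longrightarrow> L2_inner (\<lambda>x. f x - p x) q = 0"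
    by auto
  obtain c where c: "p = (\<lambda>x. \<Sum>\<alpha>\<in>multi_index j. c \<alpha> * of_real (hermite_multi \<alpha> x))"
    using p by (auto simp: hermite_space_def)
  have "c \<beta> = (\<integral>y. f y * of_real (hermite_multi \<beta> y) \<partial>gauss) / of_real (hermite_norm2 \<beta>)"
    if \<beta>: "\<beta> \<in> multi_index j" for \<beta>
  proof -
    have "(\<lambda>x. complex_of_real (hermite_multi \<beta> x)) \<in> hermite_space j"
      using hermite_space_basis[of \<beta>] \<beta> by simp
    from orth[OF this] have "(\<integral>x. (f x - p x) * of_real (hermite_multi \<beta> x) \<partial>gauss) = 0"
      by (simp add: L2_inner_def)
    then show ?thesis
      using \<beta> unfolding diff[OF p] integral_hermite_space_multi[OF c finite_multi_index]
      by (simp add: field_simps)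
  qed
  then show "p = ?p"
    unfolding c by (intro ext sum.cong) auto
qed

lemma hermite_proj_mem: "f \<in> L2 \<Longrightarrow> hermite_proj j f \<in> hermite_space j"
  by (simp only: hermite_proj_eq hermite_spaceI)

lemma integral_hermite_proj:
  assumes f: "f \<in> L2" and q: "q \<in> hermite_space j"
  shows "(\<integral>x. hermite_proj j f x * q x \<partial>gauss) = (\<integral>x. f x * q x \<partial>gauss)"
proof -
  obtain d where d: "q = (\<lambda>x. \<Sum>\<alpha>\<in>multi_index j. d \<alpha> * of_real (hermite_multi \<alpha> x))"
    using q by (auto simp: hermite_space_def)
  show ?thesis
    unfolding integral_hermite_space[OF f d] integral_hermite_space[OF hermite_space_L2[OF hermite_proj_mem[OF f]] d]
      integral_hermite_space_multi[OF hermite_proj_eq[OF f] finite_multi_index]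
    by (intro sum.cong) auto
qed

lemma hermite_proj_Bessel:
  assumes f: "f \<in> L2"
  shows "(\<Sum>j<N. (L2_norm (hermite_proj j f))\<^sup>2) \<le> (L2_norm f)\<^sup>2"
proof -
  let ?P = "\<lambda>j. hermite_proj j f"
  have L2: "?P j \<in> L2" for j
    by (rule hermite_space_L2[OF hermite_proj_mem[OF f]])
  have orth: "L2_inner (?P i) (?P j) = 0" if "i \<noteq> j" for i j
    unfolding L2_inner_def
    by (rule hermite_spaces_orthogonal[OF hermite_proj_mem hermite_space_cnj[OF hermite_proj_mem] that]) (fact f)+
  have "L2_inner (\<lambda>x. \<Sum>i<N. ?P i x) (\<lambda>x. f x - (\<Sum>j<N. ?P j x)) = 0"
  proof -
    have "L2_inner (?P i) (\<lambda>x. f x - (\<Sum>j<N. ?P j x)) = 0" if "i < N" for i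
    proof -
      let ?q = "\<lambda>x. cnj (?P i x)"
      have q: "?q \<in> hermite_space i"
        by (rule hermite_space_cnj[OF hermite_proj_mem[OF f]])
      have "(\<integral>x. (f x - (\<Sum>j<N. ?P j x)) * ?q x \<partial>gauss)
          = (\<integral>x. f x * ?q x \<partial>gauss) - (\<Sum>j<N. \<integral>x. ?P j x * ?q x \<partial>gauss)"
        unfolding left_diff_distrib sum_distrib_right
        using L2_integrable_mult[OF f hermite_space_L2[OF q]] L2_integrable_mult[OF L2 hermite_space_L2[OF q]]
        by (subst Bochner_Integration.integral_diff) (auto simp: Bochner_Integration.integral_sum)
      also have "(\<Sum>j<N. \<integral>x. ?P j x * ?q x \<partial>gauss) = (\<Sum>j<N. if j = i then \<integral>x. f x * ?q x \<partial>gauss else 0)"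
      proof (rule sum.cong)
        fix j
        show "(\<integral>x. ?P j x * ?q x \<partial>gauss) = (if j = i then \<integral>x. f x * ?q x \<partial>gauss else 0)"
          using integral_hermite_proj[OF f q] hermite_spaces_orthogonal[OF hermite_proj_mem[OF f] q] by auto
      qed simp
      finally have "(\<integral>x. (f x - (\<Sum>j<N. ?P j x)) * ?q x \<partial>gauss) = 0"
        using that by simp
      moreover have "L2_inner (?P i) (\<lambda>x. f x - (\<Sum>j<N. ?P j x)) = cnj (\<integral>x. (f x - (\<Sum>j<N. ?P j x)) * ?q x \<partial>gauss)"
        unfolding L2_inner_def by (subst Bochner_Integration.integral_cnj [symmetric]) (simp add: mult.commute)
      ultimately show ?thesis by simp
    qed
    then show ?thesis
      by (subst L2_inner_sum_left) (auto intro!: L2 L2_diff f L2_sum)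
  qed
  then have "(L2_norm (\<lambda>x. (\<Sum>i<N. ?P i x) + (f x - (\<Sum>j<N. ?P j x))))\<^sup>2
      = (L2_norm (\<lambda>x. \<Sum>i<N. ?P i x))\<^sup>2 + (L2_norm (\<lambda>x. f x - (\<Sum>j<N. ?P j x)))\<^sup>2"
    by (intro L2_Pythagoras) (auto intro!: L2 L2_diff f L2_sum)
  moreover have "(L2_norm (\<lambda>x. \<Sum>i<N. ?P i x))\<^sup>2 = (\<Sum>j<N. (L2_norm (?P j))\<^sup>2)"
    by (rule L2_norm_sum_orthogonal) (auto intro: L2 orth)
  ultimately show ?thesis
    by simp
qed

text \<open>Shows that the choice in \<open>OU_spectral\<close> is backed by existence: the pieces
  are orthogonal, and by Bessel and |m j| \<le> 1 their squared norms are summable, so the partial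
  sums are Cauchy.\<close>

lemma OU_spectral:
  assumes f: "f \<in> L2" and m: "\<And>j. norm (m j) \<le> 1"
  shows OU_spectral_L2: "OU_spectral m f \<in> L2"
    and OU_spectral_tendsto:
      "(\<lambda>N. L2_norm (\<lambda>x. OU_spectral m f x - (\<Sum>j<N. m j * hermite_proj j f x))) \<longlonglongrightarrow> 0"
proof -
  let ?v = "\<lambda>j x. m j * hermite_proj j f x"
  define s where "s N x = (\<Sum>j<N. ?v j x)" for N x
  have v: "?v j \<in> L2" for j
    by (intro L2_cmult hermite_space_L2[OF hermite_proj_mem[OF f]])
  have orth: "L2_inner (?v i) (?v j) = 0" if "i \<noteq> j" for i j
  proof -
    have "L2_inner (?v i) (?v j) =
        (\<integral>x. (m i * cnj (m j)) * (hermite_proj i f x * cnj (hermite_proj j f x)) \<partial>gauss)"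
      unfolding L2_inner_def by (simp add: mult_ac)
    also have "\<dots> = 0"
      using hermite_spaces_orthogonal[OF hermite_proj_mem[OF f] hermite_space_cnj[OF hermite_proj_mem[OF f]] that]
      by simp
    finally show ?thesis .
  qed
  have "summable (\<lambda>j. (L2_norm (hermite_proj j f))\<^sup>2)"
    using hermite_proj_Bessel[OF f] by (intro summableI_nonneg_bounded) auto
  then have summable: "summable (\<lambda>j. (L2_norm (?v j))\<^sup>2)"
  proof (rule summable_comparison_test')
    fix j
    show "norm ((L2_norm (?v j))\<^sup>2) \<le> (L2_norm (hermite_proj j f))\<^sup>2"
      unfolding L2_norm_cmult using m[of j]
      by (simp add: power_mult_distrib mult_left_le_one_le power_le_one)
  qed
  have dist: "(L2_norm (\<lambda>x. s n x - s k x))\<^sup>2 = (\<Sum>j\<in>{k..<n}. (L2_norm (?v j))\<^sup>2)" if "k \<le> n" for k n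
  proof -
    have "(\<lambda>x. s n x - s k x) = (\<lambda>x. \<Sum>j\<in>{k..<n}. ?v j x)"
      unfolding s_def using that by (simp add: fun_eq_iff sum_diff_nat_ivl lessThan_atLeast0)
    then show ?thesis
      using L2_norm_sum_orthogonal[of "{k..<n}" ?v] v orth by simp
  qed
  have sym: "L2_norm (\<lambda>x. s n x - s k x) = L2_norm (\<lambda>x. s k x - s n x)" for k n
    by (simp add: L2_norm_def norm_minus_commute)
  have "\<exists>g\<in>L2. (\<lambda>n. L2_norm (\<lambda>x. g x - s n x)) \<longlonglongrightarrow> 0"
  proof (rule L2_complete)
    show "s n \<in> L2" for n
      unfolding s_def by (intro L2_sum v)
    fix e :: real assume "e > 0"
    then obtain N where N: "\<And>m n. m \<ge> N \<Longrightarrow> norm (\<Sum>j\<in>{m..<n}. (L2_norm (?v j))\<^sup>2) < e"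
      using summable unfolding summable_Cauchy by blast
    have "(L2_norm (\<lambda>x. s m x - s n x))\<^sup>2 < e" if "m \<ge> N" "n \<ge> N" for m n
    proof (cases "n \<le> m")
      case True
      then show ?thesis using dist N[OF that(2), of m] by simp
    next
      case False
      then show ?thesis using dist[of m n] N[OF that(1), of n] sym[of m n] by simp
    qed
    then show "\<exists>N. \<forall>m\<ge>N. \<forall>n\<ge>N. (L2_norm (\<lambda>x. s m x - s n x))\<^sup>2 < e"
      by blast
  qed
  then have "\<exists>g. g \<in> L2 \<and> (\<lambda>N. L2_norm (\<lambda>x. g x - (\<Sum>j<N. m j * hermite_proj j f x))) \<longlonglongrightarrow> 0"
    unfolding s_def by blast
  then have "OU_spectral m f \<in> L2 \<and>
      (\<lambda>N. L2_norm (\<lambda>x. OU_spectral m f x - (\<Sum>j<N. m j * hermite_proj j f x))) \<longlonglongrightarrow> 0"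
    unfolding OU_spectral_def by (rule someI_ex)
  then show "OU_spectral m f \<in> L2"
    and "(\<lambda>N. L2_norm (\<lambda>x. OU_spectral m f x - (\<Sum>j<N. m j * hermite_proj j f x))) \<longlonglongrightarrow> 0"
    by auto
qed

text \<open>By Cauchy-Schwarz, norm convergence passes to pairings. This and
  \<open>OU_spectral_L2\<close> are the form in which the operator enters everything below.\<close>

lemma OU_spectral_weak:
  assumes f: "f \<in> L2" and m: "\<And>j. norm (m j) \<le> 1" and g: "g \<in> L2"
  shows "(\<lambda>j. m j * (\<integral>x. hermite_proj j f x * g x \<partial>gauss)) sums (\<integral>x. OU_spectral m f x * g x \<partial>gauss)"
proof -
  let ?s = "\<lambda>N x. \<Sum>j<N. m j * hermite_proj j f x"
  have s: "?s N \<in> L2" for N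
    by (intro L2_sum L2_cmult hermite_space_L2[OF hermite_proj_mem[OF f]])
  have sum: "(\<integral>x. ?s N x * g x \<partial>gauss) = (\<Sum>j<N. m j * (\<integral>x. hermite_proj j f x * g x \<partial>gauss))" for N
    unfolding sum_distrib_right mult.assoc
    using L2_integrable_mult[OF hermite_space_L2[OF hermite_proj_mem[OF f]] g]
    by (subst Bochner_Integration.integral_sum) auto
  have "(\<lambda>N. (\<integral>x. OU_spectral m f x * g x \<partial>gauss) - (\<integral>x. ?s N x * g x \<partial>gauss)) \<longlonglongrightarrow> 0"
  proof (rule Lim_null_comparison)
    show "\<forall>\<^sub>F N in sequentially. norm ((\<integral>x. OU_spectral m f x * g x \<partial>gauss) - (\<integral>x. ?s N x * g x \<partial>gauss))
        \<le> L2_norm (\<lambda>x. OU_spectral m f x - ?s N x) * L2_norm g"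
    proof (rule always_eventually, rule allI)
      fix N
      have "(\<integral>x. OU_spectral m f x * g x \<partial>gauss) - (\<integral>x. ?s N x * g x \<partial>gauss)
          = (\<integral>x. (OU_spectral m f x - ?s N x) * g x \<partial>gauss)"
        unfolding left_diff_distrib
        by (rule Bochner_Integration.integral_diff [symmetric];
            intro L2_integrable_mult OU_spectral_L2[OF f m] s g)
      then show "norm ((\<integral>x. OU_spectral m f x * g x \<partial>gauss) - (\<integral>x. ?s N x * g x \<partial>gauss))
          \<le> L2_norm (\<lambda>x. OU_spectral m f x - ?s N x) * L2_norm g"
        using L2_Cauchy_Schwarz[OF L2_diff[OF OU_spectral_L2[OF f m] s] g] by simp
    qed
    show "(\<lambda>N. L2_norm (\<lambda>x. OU_spectral m f x - ?s N x) * L2_norm g) \<longlonglongrightarrow> 0"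
      by (rule tendsto_mult_left_zero[OF OU_spectral_tendsto[OF f m]])
  qed
  then show ?thesis
    unfolding sums_def sum [symmetric] by (rule Lim_transform2[OF tendsto_const])
qed

section \<open>Exponential test functions and transport limit\<close>

text \<open>The degree j part of \<open>cis (\<xi> * x $ k)\<close>: the generating function at z =
  i \<xi> / 2, where exp(z^2) = exp(- \<xi>^2 / 4) compensates its factor exp(- z^2).\<close>

definition exp_mode :: "'n \<Rightarrow> real \<Rightarrow> nat \<Rightarrow> real ^ 'n \<Rightarrow> complex" where
  "exp_mode k \<xi> j x =
     of_real (exp (- \<xi>\<^sup>2 / 4)) * (\<i> * of_real \<xi> / 2) ^ j / fact j * of_real (poly (hermite j) (x $ k))"

lemma exp_mode_mem: "exp_mode k \<xi> j \<in> hermite_space j"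
proof -
  define \<alpha> where "\<alpha> i = (if i = k then j else 0)" for i
  have \<alpha>: "(\<Sum>i\<in>UNIV. \<alpha> i) = j"
    by (simp add: \<alpha>_def)
  have "hermite_multi \<alpha> x = poly (hermite j) (x $ k)" for x
  proof -
    have "hermite_multi \<alpha> x = (\<Prod>i\<in>UNIV. if i = k then poly (hermite j) (x $ k) else 1)"
      unfolding hermite_multi_def \<alpha>_def by (intro prod.cong) auto
    then show ?thesis by simp
  qed
  then have "exp_mode k \<xi> j = (\<lambda>x. \<Sum>\<beta>\<in>multi_index j.
      (if \<beta> = \<alpha> then of_real (exp (- \<xi>\<^sup>2 / 4)) * (\<i> * of_real \<xi> / 2) ^ j / fact j else 0) * of_real (hermite_multi \<beta> x))"
    using \<alpha> by (intro ext) (simp add: exp_mode_def if_distrib[of "\<lambda>c. c * _"] cong: if_cong)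
  then show ?thesis
    by (simp only: hermite_spaceI)
qed

lemma exp_mode_sums: "(\<lambda>j. exp_mode k \<xi> j x) sums cis (\<xi> * x $ k)"
proof -
  let ?z = "\<i> * complex_of_real \<xi> / 2"
  have "(\<lambda>j. of_real (exp (- \<xi>\<^sup>2 / 4)) * (of_real (poly (hermite j) (x $ k)) * ?z ^ j / fact j))
      sums (of_real (exp (- \<xi>\<^sup>2 / 4)) * exp (2 * of_real (x $ k) * ?z - ?z\<^sup>2))"
    by (intro sums_mult hermite_generating)
  also have "of_real (exp (- \<xi>\<^sup>2 / 4)) * exp (2 * of_real (x $ k) * ?z - ?z\<^sup>2) = cis (\<xi> * x $ k)"
    by (simp add: cis_conv_exp exp_of_real [symmetric] mult_exp_exp power_divide power_mult_distrib mult_ac)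
  finally show ?thesis
    by (simp add: exp_mode_def [abs_def] mult_ac)
qed

lemma norm_exp_mode:
  "norm (exp_mode k \<xi> j x) = exp (- \<xi>\<^sup>2 / 4) * (\<bar>poly (hermite j) (x $ k)\<bar> * (\<bar>\<xi>\<bar> / 2) ^ j / fact j)"
  by (simp add: exp_mode_def norm_mult norm_divide norm_power)

text \<open>The prefactor of \<open>exp_mode\<close> cancels the term exp(t^2) of
  \<open>sum_abs_hermite_le\<close> at t = |\<xi>| / 2, leaving a majorant independent of
  \<open>N\<close>.\<close>

lemma norm_sum_exp_mode_le: "norm (\<Sum>j<N. exp_mode k \<xi> j x) \<le> exp (\<bar>\<xi>\<bar> * \<bar>x $ k\<bar>)"
proof -
  have "norm (\<Sum>j<N. exp_mode k \<xi> j x)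
      \<le> exp (- \<xi>\<^sup>2 / 4) * (\<Sum>j<N. \<bar>poly (hermite j) (x $ k)\<bar> * (\<bar>\<xi>\<bar> / 2) ^ j / fact j)"
    unfolding sum_distrib_left norm_exp_mode [symmetric] by (rule norm_sum)
  also have "\<dots> \<le> exp (- \<xi>\<^sup>2 / 4) * exp (2 * \<bar>x $ k\<bar> * (\<bar>\<xi>\<bar> / 2) + (\<bar>\<xi>\<bar> / 2)\<^sup>2)"
    by (intro mult_left_mono sum_abs_hermite_le) auto
  also have "\<dots> = exp (\<bar>\<xi>\<bar> * \<bar>x $ k\<bar>)"
    by (simp add: mult_exp_exp power_divide mult.commute)
  finally show ?thesis .
qed

lemma cis_mode_measurable [measurable]: "(\<lambda>x :: real ^ 'n. cis (\<xi> * x $ k)) \<in> borel_measurable borel"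
  by (intro borel_measurable_continuous_onI continuous_intros)

lemma cis_mode_L2: "(\<lambda>x :: real ^ 'n. cis (\<xi> * x $ k)) \<in> L2"
  by (rule L2_bounded[where K = 1]) auto

text \<open>The pointwise expansion of the plane wave may be integrated against a polynomial by
  dominated convergence; orthogonality then leaves only degree j.\<close>

lemma integral_cis_mode:
  fixes k :: "'n :: finite"
  assumes g: "g \<in> hermite_space j"
  shows "(\<integral>x. g x * cis (\<xi> * x $ k) \<partial>gauss) = (\<integral>x. g x * exp_mode k \<xi> j x \<partial>gauss)"
proof -
  have L2: "exp_mode k \<xi> i \<in> L2" for i
    by (rule hermite_space_L2[OF exp_mode_mem])
  note [measurable] = L2_measurable[OF L2] L2_measurable[OF hermite_space_L2[OF g]]
  let ?w = "\<lambda>x :: real ^ 'n. complex_of_real (exp (\<bar>\<xi>\<bar> * \<bar>x $ k\<bar>))"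
  have "exp_growth ?w"
  proof (rule exp_growthI)
    fix x :: "real ^ 'n"
    have "exp (\<bar>\<xi>\<bar> * \<bar>x $ k\<bar>) \<le> exp (\<Sum>i\<in>UNIV. \<bar>\<xi>\<bar> * \<bar>x $ i\<bar>)"
      using member_le_sum[of k UNIV "\<lambda>i. \<bar>\<xi>\<bar> * \<bar>x $ i\<bar>"] by simp
    then show "norm (?w x) \<le> 1 * (\<Prod>i\<in>UNIV. exp (\<bar>\<xi>\<bar> * \<bar>x $ i\<bar>))"
      by (simp add: exp_sum)
  qed measurable
  then have w: "integrable gauss (\<lambda>x. norm (g x * ?w x))"
    by (intro integrable_norm L2_integrable_mult hermite_space_L2[OF g] exp_growth_L2)
  have lim: "(\<lambda>N. \<integral>x. g x * (\<Sum>i<N. exp_mode k \<xi> i x) \<partial>gauss) \<longlonglongrightarrow> (\<integral>x. g x * cis (\<xi> * x $ k) \<partial>gauss)"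
  proof (rule integral_dominated_convergence[OF _ _ w])
    show "AE x in gauss. (\<lambda>N. g x * (\<Sum>i<N. exp_mode k \<xi> i x)) \<longlonglongrightarrow> g x * cis (\<xi> * x $ k)"
      using exp_mode_sums unfolding sums_def by (intro AE_I2 tendsto_mult_left) auto
    show "AE x in gauss. norm (g x * (\<Sum>i<N. exp_mode k \<xi> i x)) \<le> norm (g x * ?w x)" for N
      unfolding norm_mult by (intro AE_I2 mult_left_mono) (auto simp: norm_sum_exp_mode_le)
  qed measurable
  have "(\<integral>x. g x * (\<Sum>i<N. exp_mode k \<xi> i x) \<partial>gauss) = (\<integral>x. g x * exp_mode k \<xi> j x \<partial>gauss)"
    if "N > j" for N
  proof -
    have "(\<integral>x. g x * (\<Sum>i<N. exp_mode k \<xi> i x) \<partial>gauss) = (\<Sum>i<N. \<integral>x. g x * exp_mode k \<xi> i x \<partial>gauss)"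
      unfolding sum_distrib_left
      by (rule Bochner_Integration.integral_sum) (rule L2_integrable_mult[OF hermite_space_L2[OF g] L2])
    also have "\<dots> = (\<Sum>i<N. if i = j then \<integral>x. g x * exp_mode k \<xi> j x \<partial>gauss else 0)"
      using hermite_spaces_orthogonal[OF g exp_mode_mem] by (intro sum.cong) auto
    finally show ?thesis
      using that by simp
  qed
  then have "eventually (\<lambda>N. (\<integral>x. g x * (\<Sum>i<N. exp_mode k \<xi> i x) \<partial>gauss) = (\<integral>x. g x * exp_mode k \<xi> j x \<partial>gauss)) sequentially"
    by (rule eventually_mono[OF eventually_gt_at_top])
  then have "(\<lambda>N. \<integral>x. g x * (\<Sum>i<N. exp_mode k \<xi> i x) \<partial>gauss) \<longlonglongrightarrow> (\<integral>x. g x * exp_mode k \<xi> j x \<partial>gauss)"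
    by (rule tendsto_eventually)
  with lim show ?thesis
    by (rule LIMSEQ_unique)
qed

text \<open>The projection is transferred from \<open>f\<close> to the plane wave, whose degree j
  part is explicit. Hence no information about \<open>f\<close> beyond its pairings with
  \<open>exp_mode\<close> remains.\<close>

lemma OU_spectral_cis_mode:
  assumes f: "f \<in> L2" and m: "\<And>j. norm (m j) \<le> 1"
  shows "(\<lambda>j. m j * (\<integral>x. f x * exp_mode k \<xi> j x \<partial>gauss)) sums (\<integral>x. OU_spectral m f x * cis (\<xi> * x $ k) \<partial>gauss)"
  using OU_spectral_weak[OF f m cis_mode_L2[of \<xi> k]]
  unfolding integral_cis_mode[OF hermite_proj_mem[OF f]] integral_hermite_proj[OF f exp_mode_mem] .

text \<open>The scale R of the overview is \<open>Suc n\<close>, so R \<ge> 1 and 1/R is exactly the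
  admissible radius at R e_k.\<close>

definition ball_atom :: "'n :: finite \<Rightarrow> nat \<Rightarrow> real ^ 'n \<Rightarrow> complex" where
  "ball_atom k n x = indicator (ball (axis k (real (Suc n))) (1 / real (Suc n))) x
     / of_real (measure gauss (ball (axis k (real (Suc n))) (1 / real (Suc n)) :: (real ^ 'n) set))"

lemma gauss_ball_pos:
  fixes c :: "real ^ 'n"
  assumes "\<rho> > 0"
  shows "measure gauss (ball c \<rho>) > 0"
proof -
  interpret prob_space "gauss :: (real ^ 'n) measure" by (rule prob_space_gauss)
  have "emeasure gauss (ball c \<rho>) \<noteq> 0"
  proof
    assume "emeasure gauss (ball c \<rho>) = 0"
    then have "ball c \<rho> \<in> null_sets gauss"
      by (intro null_setsI) auto
    then have "AE x in lborel. x \<notin> ball c \<rho>"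
      unfolding gauss_def by (subst (asm) null_sets_density_iff) (auto elim!: eventually_mono simp: ennreal_eq_0_iff mult_le_0_iff)
    then have "emeasure lborel (ball c \<rho>) = 0"
      by (subst (asm) AE_iff_measurable[of "ball c \<rho>"]) auto
    then have "negligible (ball c \<rho>)"
      by (simp add: negligible_iff_null_sets null_sets_completionI null_setsI)
    then show False
      using assms open_not_negligible[of "ball c \<rho>"] by simp
  qed
  then show ?thesis
    by (simp add: emeasure_eq_measure zero_less_measure_iff)
qed

lemma ball_atom_L2:
  fixes k :: "'n :: finite"
  shows "ball_atom k n \<in> L2"
proof (rule L2_bounded)
  show "ball_atom k n \<in> borel_measurable borel"
    unfolding ball_atom_def [abs_def]
    by (intro borel_measurable_divide borel_measurable_const borel_measurable_indicator) auto
  show "norm (ball_atom k n x) \<le> 1 / measure gauss (ball (axis k (real (Suc n))) (1 / real (Suc n)) :: (real ^ 'n) set)"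
    for x :: "real ^ 'n"
    by (auto simp: ball_atom_def norm_divide divide_right_mono split: split_indicator)
qed

text \<open>The normalised indicator attains the size condition with equality. It has integral one,
  so it is the global atoms, without cancellation, that admit it.\<close>

lemma ball_atom_global_atom:
  fixes k :: "'n :: finite"
  shows "global_atom (ball_atom k n)"
proof -
  define c :: "real ^ 'n" where "c = axis k (real (Suc n))"
  define B where "B = ball c (1 / real (Suc n))"
  have radius: "adm_radius c = 1 / real (Suc n)"
    by (simp add: adm_radius_def c_def axis_eq_0_iff norm_eq_sqrt_inner inner_axis_axis)
  have pos: "measure gauss B > 0"
    unfolding B_def by (rule gauss_ball_pos) simp
  have atom: "ball_atom k n x = indicator B x / of_real (measure gauss B)" for x
    by (simp add: ball_atom_def B_def c_def)
  have "(norm (ball_atom k n x))\<^sup>2 = indicator B x / (measure gauss B)\<^sup>2" for x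
    using pos by (simp add: atom norm_divide power_divide split: split_indicator)
  then have "(\<integral>x. (norm (ball_atom k n x))\<^sup>2 \<partial>gauss) = measure gauss B / (measure gauss B)\<^sup>2"
    by (simp add: B_def)
  also have "\<dots> = (measure gauss B powr (- 1 / 2))\<^sup>2"
    using pos by (simp add: powr_powr powr_minus_divide power2_eq_square flip: powr_add)
  finally have "L2_norm (ball_atom k n) = measure gauss B powr (- 1 / 2)"
    unfolding L2_norm_def by simp
  then show ?thesis
    unfolding global_atom_def
    by (intro exI[of _ c]) (auto simp: radius ball_atom_L2 supported_in_def atom B_def)
qed

text \<open>Pairing with the atom is averaging over the ball. It is applied with L a limit value,
  and with L = 0 to obtain bounds.\<close>

lemma ball_atom_average:
  fixes p :: "real ^ 'n \<Rightarrow> complex"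
  assumes p: "p \<in> L2"
    and le: "\<And>x. x \<in> ball (axis k (real (Suc n))) (1 / real (Suc n)) \<Longrightarrow> norm (p x - L) \<le> e"
  shows "norm ((\<integral>x. ball_atom k n x * p x \<partial>gauss) - L) \<le> e"
proof -
  interpret prob_space "gauss :: (real ^ 'n) measure" by (rule prob_space_gauss)
  define B where "B = ball (axis k (real (Suc n)) :: real ^ 'n) (1 / real (Suc n))"
  have pos: "measure gauss B > 0"
    unfolding B_def by (rule gauss_ball_pos) simp
  have atom: "ball_atom k n x = indicator B x / of_real (measure gauss B)" for x
    by (simp add: ball_atom_def B_def)
  have "integrable gauss (indicator B :: _ \<Rightarrow> real)"
    by (rule integrable_real_indicator) (simp_all add: B_def emeasure_eq_measure)
  then have ind: "integrable gauss (\<lambda>x. indicator B x / measure gauss B)"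
    "(\<integral>x. indicator B x / measure gauss B \<partial>gauss) = 1"
    using pos by simp_all
  have "(\<integral>x. ball_atom k n x \<partial>gauss) = (\<integral>x. complex_of_real (indicator B x / measure gauss B) \<partial>gauss)"
    unfolding atom by (intro Bochner_Integration.integral_cong) (auto split: split_indicator)
  also have "\<dots> = 1"
    unfolding integral_complex_of_real ind by simp
  finally have "(\<integral>x. ball_atom k n x * p x \<partial>gauss) - L = (\<integral>x. ball_atom k n x * (p x - L) \<partial>gauss)"
    unfolding right_diff_distrib using L2_integrable_mult[OF ball_atom_L2 p] L2_integrable[OF ball_atom_L2[of k n]]
    by (subst Bochner_Integration.integral_diff) auto
  also have "norm \<dots> \<le> (\<integral>x. e * (indicator B x / measure gauss B) \<partial>gauss)"
  proof (rule Bochner_Integration.integral_norm_bound_integral)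
    have "(\<lambda>x. p x - L) \<in> L2"
      by (intro L2_diff p L2_bounded[of _ "norm L"]) auto
    then show "integrable gauss (\<lambda>x. ball_atom k n x * (p x - L))"
      by (rule L2_integrable_mult[OF ball_atom_L2])
    show "integrable gauss (\<lambda>x. e * (indicator B x / measure gauss B))"
      by (intro integrable_mult_right ind)
    fix x
    show "norm (ball_atom k n x * (p x - L)) \<le> e * (indicator B x / measure gauss B)"
      using le[of x] pos by (auto simp: atom norm_mult norm_divide B_def divide_right_mono split: split_indicator)
  qed
  also have "\<dots> = e"
    using ind pos by simp
  finally show ?thesis .
qed

section \<open>Hermite modes of slowly varying plane waves on the distant balls\<close>

lemma ball_axis_component:
  fixes x :: "real ^ 'n"
  assumes "x \<in> ball (axis k c) \<rho>"
  shows "\<bar>x $ k - c\<bar> < \<rho>"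
proof -
  have "\<bar>(axis k c - x) $ k\<bar> \<le> norm (axis k c - x)"
    by (rule component_le_norm_cart)
  then show ?thesis
    using assms by (simp add: dist_norm axis_def)
qed

text \<open>At frequency \<eta> h the powers of h can be distributed so that x_k appears only as x_k
  h. On the balls h = 1/R and x_k h is near 1, so the right-hand side is continuous in bounded
  quantities down to h = 0.\<close>

lemma exp_mode_rescaled:
  assumes h: "h \<noteq> 0"
  shows "exp_mode k (\<eta> * h) j x = of_real (exp (- (\<eta> * h)\<^sup>2 / 4)) * (\<i> * of_real \<eta>) ^ j
     * of_real (\<Sum>i\<le>j. (x $ k * h) ^ i / fact i * hcoef (j - i) * (h / 2) ^ (j - i))"
proof -
  have "poly (hermite j) (x $ k) / fact j * (h / 2) ^ j = (\<Sum>i\<le>j. (x $ k * h) ^ i / fact i * hcoef (j - i) * (h / 2) ^ (j - i))"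
    unfolding hermite_Cauchy_product sum_distrib_right
  proof (rule sum.cong)
    fix i assume "i \<in> {..j}"
    then have "(h / 2) ^ j = (h / 2) ^ i * (h / 2) ^ (j - i)"
      by (simp add: power_add [symmetric])
    then show "(2 * x $ k) ^ i / fact i * hcoef (j - i) * (h / 2) ^ j = (x $ k * h) ^ i / fact i * hcoef (j - i) * (h / 2) ^ (j - i)"
      by (simp add: power_mult_distrib power_divide field_simps)
  qed simp
  then have eq: "(\<Sum>i\<le>j. (x $ k * h) ^ i / fact i * hcoef (j - i) * (h / 2) ^ (j - i))
      = poly (hermite j) (x $ k) / fact j * (h / 2) ^ j"
    by (rule sym)
  show ?thesis
    unfolding eq by (simp add: exp_mode_def power_mult_distrib power_divide mult_ac)
qed

lemma exp_mode_limit: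
  fixes k :: "'n :: finite"
  assumes "e > 0"
  shows "eventually (\<lambda>n. \<forall>x\<in>ball (axis k (real (Suc n)) :: real ^ 'n) (1 / real (Suc n)).
           norm (exp_mode k (\<eta> * (1 / real (Suc n))) j x - (\<i> * of_real \<eta>) ^ j / fact j) \<le> e) sequentially"
proof -
  define W :: "real \<times> real \<Rightarrow> complex" where
    "W p = of_real (exp (- (\<eta> * snd p)\<^sup>2 / 4)) * (\<i> * of_real \<eta>) ^ j
     * of_real (\<Sum>i\<le>j. (fst p) ^ i / fact i * hcoef (j - i) * (snd p / 2) ^ (j - i))" for p
  \<comment> \<open>At h = 0 only i = j survives, since 0 ^ 0 = 1 and \<open>hcoef 0\<close> is 1;
    this is the disappearance of the second-order part.\<close>
  have "(\<Sum>i\<le>j. 1 ^ i / fact i * hcoef (j - i) * (0 / 2) ^ (j - i)) = (\<Sum>i\<le>j. if i = j then 1 / fact j else 0 :: real)"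
    by (intro sum.cong) (auto simp: hcoef_def)
  then have W0: "W (1, 0) = (\<i> * of_real \<eta>) ^ j / fact j"
    by (simp add: W_def)
  have "isCont W (1, 0)"
    unfolding W_def by (intro continuous_intros) auto
  then obtain d where d: "d > 0" "\<And>p. dist p (1, 0) < d \<Longrightarrow> dist (W p) (W (1, 0)) < e"
    using assms unfolding continuous_at_eps_delta by blast
  have "(\<lambda>n. 1 / real (Suc n)) \<longlonglongrightarrow> 0"
    using LIMSEQ_inverse_real_of_nat by (simp add: divide_inverse del: of_nat_Suc)
  then have "eventually (\<lambda>n. 1 / real (Suc n) < d / 2) sequentially"
    by (rule order_tendstoD) (use d in simp)
  then show ?thesis
  proof eventually_elim
    case (elim n)
    show ?case
    proof
      fix x :: "real ^ 'n" assume x: "x \<in> ball (axis k (real (Suc n))) (1 / real (Suc n))"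
      define h where "h = 1 / real (Suc n)"
      have h: "0 < h" "h \<le> 1" "real (Suc n) * h = 1"
        by (simp_all add: h_def)
      have "\<bar>x $ k - real (Suc n)\<bar> < h"
        using ball_axis_component[OF x] by (simp add: h_def)
      \<comment> \<open>Since R h = 1, this bounds |x_k h - 1| by h, which places (x_k h, h) within
        2h of (1, 0).\<close>
      then have "\<bar>x $ k - real (Suc n)\<bar> * h \<le> h * 1"
        using h by (intro mult_mono) auto
      also have "\<bar>x $ k - real (Suc n)\<bar> * h = \<bar>(x $ k - real (Suc n)) * h\<bar>"
        using h by (simp add: abs_mult)
      also have "\<dots> = \<bar>x $ k * h - 1\<bar>"
        using h by (simp add: left_diff_distrib)
      finally have "dist (x $ k * h, h) (1, 0) \<le> 2 * h"
        using h sqrt_sum_squares_le_sum_abs[of "x $ k * h - 1" h] by (simp add: dist_Pair_Pair dist_real_def)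
      then have "dist (x $ k * h, h) (1, 0) < d"
        using elim by (simp add: h_def)
      from d(2)[OF this] have "dist (W (x $ k * h, h)) ((\<i> * of_real \<eta>) ^ j / fact j) < e"
        unfolding W0 .
      moreover have "W (x $ k * h, h) = exp_mode k (\<eta> * h) j x"
        using h by (subst exp_mode_rescaled) (auto simp: W_def)
      ultimately show "norm (exp_mode k (\<eta> * (1 / real (Suc n))) j x - (\<i> * of_real \<eta>) ^ j / fact j) \<le> e"
        by (simp add: dist_norm h_def)
    qed
  qed
qed

text \<open>A majorant summable in j and independent of n. On the ball |x_k| \<le> 2R while the
  frequency is \<eta>/R, so their product stays bounded.\<close>

lemma norm_exp_mode_ball_le:
  fixes x :: "real ^ 'n"
  assumes x: "x \<in> ball (axis k (real (Suc n))) (1 / real (Suc n))"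
  shows "norm (exp_mode k (\<eta> * (1 / real (Suc n))) j x) \<le> exp (4 * \<bar>\<eta>\<bar> + \<eta>\<^sup>2) * (1 / 2) ^ j"
proof -
  define h where "h = 1 / real (Suc n)"
  have h: "0 < h" "h \<le> 1" "real (Suc n) * h = 1"
    by (simp_all add: h_def)
  let ?\<xi> = "\<eta> * h"
  have "\<bar>x $ k\<bar> \<le> real (Suc n) + h"
    using ball_axis_component[OF x] by (simp add: h_def)
  also have "\<dots> \<le> 2 * real (Suc n)"
    using h by simp
  finally have "\<bar>?\<xi>\<bar> * \<bar>x $ k\<bar> \<le> (\<bar>\<eta>\<bar> * h) * (2 * real (Suc n))"
    using h by (simp add: abs_mult mult_left_mono del: of_nat_Suc)
  also have "\<dots> = 2 * \<bar>\<eta>\<bar> * (real (Suc n) * h)"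
    by (simp only: mult_ac)
  also have "\<dots> = 2 * \<bar>\<eta>\<bar>"
    unfolding h(3) by simp
  finally have 1: "2 * \<bar>x $ k\<bar> * \<bar>?\<xi>\<bar> \<le> 4 * \<bar>\<eta>\<bar>"
    by (simp add: mult_ac)
  have 2: "?\<xi>\<^sup>2 \<le> \<eta>\<^sup>2"
    using h by (simp add: power_mult_distrib mult_left_le power_le_one)
  have "norm (exp_mode k ?\<xi> j x) \<le> 1 * (\<bar>poly (hermite j) (x $ k)\<bar> * (\<bar>?\<xi>\<bar> / 2) ^ j / fact j)"
    unfolding norm_exp_mode by (intro mult_right_mono) auto
  \<comment> \<open>The mode carries (|\<xi>|/2)^j, but the Hermite bound is used at t = |\<xi>|;
    the spare factor is the geometric decay.\<close>
  also have "\<dots> = (\<bar>poly (hermite j) (x $ k)\<bar> * \<bar>?\<xi>\<bar> ^ j / fact j) * (1 / 2) ^ j"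
    by (simp add: power_divide)
  also have "\<dots> \<le> exp (2 * \<bar>x $ k\<bar> * \<bar>?\<xi>\<bar> + \<bar>?\<xi>\<bar>\<^sup>2) * (1 / 2) ^ j"
    by (intro mult_right_mono abs_hermite_le) auto
  also have "\<dots> \<le> exp (4 * \<bar>\<eta>\<bar> + \<eta>\<^sup>2) * (1 / 2) ^ j"
    using 1 2 by (intro mult_right_mono) auto
  finally show ?thesis
    by (simp add: h_def)
qed

text \<open>Termwise limits combine by Tannery's theorem. The value is m(y d/dy) applied to exp(i
  \<eta> y), evaluated at y = 1.\<close>

lemma OU_spectral_ball_atom_limit:
  fixes k :: "'n :: finite"
  assumes m: "\<And>j. norm (m j) \<le> 1"
  shows "(\<lambda>n. \<integral>x. OU_spectral m (ball_atom k n) x * cis (\<eta> * (1 / real (Suc n)) * x $ k) \<partial>gauss)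
    \<longlonglongrightarrow> (\<Sum>j. m j * ((\<i> * of_real \<eta>) ^ j / fact j))"
proof -
  let ?I = "\<lambda>j n. \<integral>x. ball_atom k n x * exp_mode k (\<eta> * (1 / real (Suc n))) j x \<partial>gauss"
  have L2: "exp_mode k \<xi> i \<in> L2" for \<xi> i
    by (rule hermite_space_L2[OF exp_mode_mem])
  have lim: "(\<lambda>n. m j * ?I j n) \<longlonglongrightarrow> m j * ((\<i> * of_real \<eta>) ^ j / fact j)" for j
  proof (intro tendsto_mult_left LIMSEQ_I)
    fix e :: real assume "e > 0"
    then have "eventually (\<lambda>n. \<forall>x\<in>ball (axis k (real (Suc n)) :: real ^ 'n) (1 / real (Suc n)).
        norm (exp_mode k (\<eta> * (1 / real (Suc n))) j x - (\<i> * of_real \<eta>) ^ j / fact j) \<le> e / 2) sequentially"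
      by (intro exp_mode_limit) simp
    then have "eventually (\<lambda>n. norm (?I j n - (\<i> * of_real \<eta>) ^ j / fact j) < e) sequentially"
    proof eventually_elim
      case (elim n)
      then have "norm (?I j n - (\<i> * of_real \<eta>) ^ j / fact j) \<le> e / 2"
        by (intro ball_atom_average L2) blast
      with \<open>e > 0\<close> show ?case by linarith
    qed
    then show "\<exists>no. \<forall>n\<ge>no. norm (?I j n - (\<i> * of_real \<eta>) ^ j / fact j) < e"
      by (simp add: eventually_sequentially)
  qed
  have bound: "norm (m j * ?I j n) \<le> exp (4 * \<bar>\<eta>\<bar> + \<eta>\<^sup>2) * (1 / 2) ^ j" for j n
  proof -
    have "norm (?I j n - 0) \<le> exp (4 * \<bar>\<eta>\<bar> + \<eta>\<^sup>2) * (1 / 2) ^ j"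
      using norm_exp_mode_ball_le[of _ k n \<eta> j] by (intro ball_atom_average L2) (simp only: diff_0_right)
    then have "norm (m j) * norm (?I j n) \<le> 1 * (exp (4 * \<bar>\<eta>\<bar> + \<eta>\<^sup>2) * (1 / 2) ^ j)"
      using m[of j] by (intro mult_mono) auto
    then show ?thesis
      by (simp only: norm_mult mult_1)
  qed
  have "(\<lambda>n. \<Sum>j. m j * ?I j n) \<longlonglongrightarrow> (\<Sum>j. m j * ((\<i> * of_real \<eta>) ^ j / fact j))"
  proof (rule tannerys_theorem[THEN conjunct2, THEN conjunct2])
    show "\<forall>\<^sub>F (j, n) in at_top \<times>\<^sub>F sequentially. norm (m j * ?I j n) \<le> exp (4 * \<bar>\<eta>\<bar> + \<eta>\<^sup>2) * (1 / 2) ^ j"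
      using bound by (intro always_eventually) (simp only: split_paired_All prod.case simp_thms)
  qed (use lim in \<open>auto simp del: of_nat_Suc\<close>)
  moreover have "(\<Sum>j. m j * ?I j n) = (\<integral>x. OU_spectral m (ball_atom k n) x * cis (\<eta> * (1 / real (Suc n)) * x $ k) \<partial>gauss)" for n
    by (rule sums_unique [symmetric]) (rule OU_spectral_cis_mode[OF ball_atom_L2 m])
  ultimately show ?thesis by (simp only:)
qed

text \<open>Duality between L^1 and bounded functions survives the limit: the test functions for
  different \<open>n\<close> are dilates of one function of y, so the same M serves for all of
  them.\<close>

lemma OU_spectral_bound:
  fixes k :: "'n :: finite"
  assumes m: "\<And>j. norm (m j) \<le> 1"
    and C: "\<And>n. L1_norm (OU_spectral m (ball_atom k n)) \<le> C"
    and M: "\<And>y. norm (\<Sum>i<N. b i * cis (\<eta> i * y)) \<le> M"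
  shows "norm (\<Sum>i<N. b i * (\<Sum>j. m j * ((\<i> * of_real (\<eta> i)) ^ j / fact j))) \<le> C * M"
proof -
  let ?S = "\<lambda>n. OU_spectral m (ball_atom k n)"
  let ?\<phi> = "\<lambda>i n x. cis (\<eta> i * (1 / real (Suc n)) * x $ k)"
  have S: "?S n \<in> L2" for n
    by (rule OU_spectral_L2[OF ball_atom_L2 m])
  have "(\<lambda>n. \<Sum>i<N. b i * (\<integral>x. ?S n x * ?\<phi> i n x \<partial>gauss))
      \<longlonglongrightarrow> (\<Sum>i<N. b i * (\<Sum>j. m j * ((\<i> * of_real (\<eta> i)) ^ j / fact j)))"
    by (intro tendsto_sum tendsto_mult_left OU_spectral_ball_atom_limit m)
  then have "(\<lambda>n. norm (\<Sum>i<N. b i * (\<integral>x. ?S n x * ?\<phi> i n x \<partial>gauss)))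
      \<longlonglongrightarrow> norm (\<Sum>i<N. b i * (\<Sum>j. m j * ((\<i> * of_real (\<eta> i)) ^ j / fact j)))"
    by (rule tendsto_norm)
  then show ?thesis
  proof (rule LIMSEQ_le_const2, intro exI allI impI)
    fix n :: nat
    have int: "integrable gauss (\<lambda>x. ?S n x * ?\<phi> i n x)" for i
      by (rule L2_integrable_mult[OF S cis_mode_L2])
    have "(\<Sum>i<N. b i * (\<integral>x. ?S n x * ?\<phi> i n x \<partial>gauss)) = (\<integral>x. (\<Sum>i<N. b i * (?S n x * ?\<phi> i n x)) \<partial>gauss)"
      using int by (subst Bochner_Integration.integral_sum) auto
    also have "\<dots> = (\<integral>x. ?S n x * (\<Sum>i<N. b i * ?\<phi> i n x) \<partial>gauss)"
      by (simp add: sum_distrib_left mult_ac)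
    also have "norm \<dots> \<le> (\<integral>x. M * norm (?S n x) \<partial>gauss)"
    proof (rule Bochner_Integration.integral_norm_bound_integral)
      show "integrable gauss (\<lambda>x. ?S n x * (\<Sum>i<N. b i * ?\<phi> i n x))"
        by (intro L2_integrable_mult S L2_sum L2_cmult cis_mode_L2)
      show "integrable gauss (\<lambda>x. M * norm (?S n x))"
        by (intro integrable_mult_right integrable_norm L2_integrable S)
      fix x
      have "norm (\<Sum>i<N. b i * ?\<phi> i n x) \<le> M"
        using M[of "1 / real (Suc n) * x $ k"] by (simp add: mult.assoc del: of_nat_Suc)
      then show "norm (?S n x * (\<Sum>i<N. b i * ?\<phi> i n x)) \<le> M * norm (?S n x)"
        unfolding norm_mult by (subst mult.commute) (intro mult_right_mono; simp)
    qed
    also have "\<dots> = M * L1_norm (?S n)"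
      by (simp add: L1_norm_def)
    also have "\<dots> \<le> M * C"
      using M[of 0] order_trans[OF norm_ge_zero] by (intro mult_left_mono C) blast
    finally show "norm (\<Sum>i<N. b i * (\<integral>x. ?S n x * ?\<phi> i n x \<partial>gauss)) \<le> C * M"
      by (simp add: mult.commute)
  qed
qed

section \<open>The imaginary power as an oscillatory integral\<close>

abbreviation half_line :: "real measure" where
  "half_line \<equiv> restrict_space lborel {0<..}"

lemma space_half_line [simp]: "space half_line = {0<..}"
  by (simp add: space_restrict_space)

lemma AE_half_line: "(\<And>t. t > 0 \<Longrightarrow> P t) \<Longrightarrow> AE t in half_line. P t"
  by (rule AE_I2) simp

lemma measurable_half_line [measurable (raw)]: "f \<in> borel_measurable borel \<Longrightarrow> f \<in> borel_measurable half_line"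
  by (rule measurable_restrict_space1) simp

lemma exp_half_line:
  fixes a :: real
  assumes "a > 0"
  shows integrable_exp_half_line: "integrable half_line (\<lambda>t. exp (- (a * t)))"
    and integral_exp_half_line: "(\<integral>t. exp (- (a * t)) \<partial>half_line) = 1 / a"
proof -
  show "integrable half_line (\<lambda>t. exp (- (a * t)))"
    using integrable_I0i_exp_mscale[OF assms]
    by (simp add: integrable_restrict_space set_integrable_def mult.commute)
  show "(\<integral>t. exp (- (a * t)) \<partial>half_line) = 1 / a"
    using LBINT_I0i_exp_mscale[OF assms]
    by (simp add: integral_restrict_space interval_lebesgue_integral_0_infty set_lebesgue_integral_def mult.commute)
qed

text \<open>For t > 0 this is t^(-iu); only such t enter the integrals.\<close>

definition log_osc :: "real \<Rightarrow> real \<Rightarrow> complex" where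
  "log_osc u t = cis (- (u * ln t))"

lemma norm_log_osc [simp]: "norm (log_osc u t) = 1"
  by (simp add: log_osc_def)

lemma log_osc_measurable [measurable]: "log_osc u \<in> borel_measurable borel"
proof -
  have "cis \<in> borel_measurable borel"
    by (intro borel_measurable_continuous_onI continuous_intros)
  moreover have "(\<lambda>t. - (u * ln t)) \<in> borel_measurable borel"
    by measurable
  ultimately show ?thesis
    unfolding log_osc_def [abs_def] by (rule measurable_compose[rotated])
qed

text \<open>The number Gamma(1 - iu). It is carried along as a factor and enters the final estimate
  through its norm.\<close>

definition osc_const :: "real \<Rightarrow> complex" where
  "osc_const u = (\<integral>t. log_osc u t * of_real (exp (- t)) \<partial>half_line)"

lemma integrable_log_osc_mult:
  fixes f :: "real \<Rightarrow> complex"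
  assumes [measurable]: "f \<in> borel_measurable half_line" and "a > 0" "\<And>t. t > 0 \<Longrightarrow> norm (f t) \<le> C * exp (- (a * t))"
  shows "integrable half_line (\<lambda>t. log_osc u t * f t)"
proof (rule Bochner_Integration.integrable_bound)
  show "integrable half_line (\<lambda>t. C * exp (- (a * t)))"
    by (intro integrable_mult_right integrable_exp_half_line assms)
  show "AE t in half_line. norm (log_osc u t * f t) \<le> norm (C * exp (- (a * t)))"
    using assms(3) by (intro AE_half_line) (auto simp: norm_mult intro: order_trans[OF _ abs_ge_self])
qed measurable

text \<open>Substituting s = l t turns the power l^(iu) into an integral of the exponentials exp(- l
  t), which for l = r + j are easy to sum over j.\<close>

lemma osc_const_scale:
  assumes "l > 0"
  shows "(\<integral>t. log_osc u t * of_real (l * exp (- (l * t))) \<partial>half_line) = cis (u * ln l) * osc_const u"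
proof -
  let ?f = "\<lambda>s. indicator {0<..} s *\<^sub>R (log_osc u s * of_real (exp (- s)))"
  have "osc_const u = (\<integral>s. ?f s \<partial>lborel)"
    by (simp add: osc_const_def integral_restrict_space)
  also have "\<dots> = \<bar>l\<bar> *\<^sub>R (\<integral>t. ?f (0 + l * t) \<partial>lborel)"
    using assms by (intro lborel_integral_real_affine) simp
  also have "\<dots> = (\<integral>t. of_real l * ?f (l * t) \<partial>lborel)"
    using assms by (simp add: scaleR_conv_of_real)
  also have "\<dots> = (\<integral>t. cis (- (u * ln l)) * (indicator {0<..} t *\<^sub>R (log_osc u t * of_real (l * exp (- (l * t))))) \<partial>lborel)"
  proof (rule Bochner_Integration.integral_cong)
    fix t :: real
    show "of_real l * ?f (l * t) = cis (- (u * ln l)) * (indicator {0<..} t *\<^sub>R (log_osc u t * of_real (l * exp (- (l * t)))))"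
    proof (cases "t > 0")
      case True
      have "log_osc u (l * t) = cis (- (u * ln l)) * log_osc u t"
        using True assms by (simp add: log_osc_def ln_mult cis_mult algebra_simps)
      then show ?thesis
        using True assms by simp
    next
      case False
      then have "\<not> 0 < l * t" using assms by (simp add: zero_less_mult_iff)
      with False show ?thesis by simp
    qed
  qed simp
  also have "\<dots> = cis (- (u * ln l)) * (\<integral>t. log_osc u t * of_real (l * exp (- (l * t))) \<partial>half_line)"
    by (subst integral_restrict_space, simp) (rule integral_mult_right_zero)
  finally have "cis (u * ln l) * osc_const u = (cis (u * ln l) * cis (- (u * ln l))) * (\<integral>t. log_osc u t * of_real (l * exp (- (l * t))) \<partial>half_line)"
    by simp
  then show ?thesis
    by (simp add: cis_mult)
qed

text \<open>The weight r + j is the action of r + z d/dz on exp z.\<close>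

lemma exp_series_weighted:
  fixes z :: "'a :: {real_normed_field, banach}"
  shows "(\<lambda>j. (of_real r + of_nat j) * (z ^ j / fact j)) sums ((of_real r + z) * exp z)"
proof -
  have e: "(\<lambda>j. z ^ j / fact j) sums exp z"
    using exp_converges[of z] by (simp add: scaleR_conv_of_real divide_inverse mult.commute)
  then have "(\<lambda>j. z * (z ^ j / fact j)) sums (z * exp z)"
    by (rule sums_mult)
  also have "(\<lambda>j. z * (z ^ j / fact j)) = (\<lambda>j. of_nat (Suc j) * (z ^ Suc j / fact (Suc j)))"
    by (simp add: fun_eq_iff field_simps del: of_nat_Suc)
  finally have "(\<lambda>j. of_nat j * (z ^ j / fact j)) sums (z * exp z)"
    by (subst (asm) sums_Suc_iff) simp
  with sums_mult[OF e, of "of_real r"] show ?thesis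
    by (subst distrib_right, subst distrib_right) (rule sums_add)
qed

text \<open>Each power (r + j)^(iu) is replaced by its integral, and sum and integral are exchanged.
  The integrand becomes t^(-iu) times -d/dt of exp(- r t) exp(i \<eta> exp(- t)).\<close>

lemma osc_const_exp_series:
  assumes r: "r > 0"
  shows "(\<Sum>j. cis (u * ln (r + real j)) * ((\<i> * of_real \<eta>) ^ j / fact j)) * osc_const u =
    (\<integral>t. log_osc u t * (of_real (exp (- (r * t))) * ((of_real r + \<i> * of_real (\<eta> * exp (- t))) * cis (\<eta> * exp (- t)))) \<partial>half_line)"
proof -
  let ?c = "\<lambda>j. (\<i> * of_real \<eta>) ^ j / fact j :: complex"
  let ?g = "\<lambda>j t. log_osc u t * of_real ((r + real j) * exp (- ((r + real j) * t)))"
  define f where "f j t = ?c j * ?g j t" for j t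
  have pos: "r + real j > 0" for j
    using r by simp
  have g: "integrable half_line (?g j)" for j
  proof (rule integrable_log_osc_mult[OF _ pos[of j]])
    fix t :: real
    show "norm (complex_of_real ((r + real j) * exp (- ((r + real j) * t)))) \<le> (r + real j) * exp (- ((r + real j) * t))"
      unfolding norm_of_real using pos[of j] by (simp add: abs_mult)
  qed measurable
  then have f: "integrable half_line (f j)" for j
    unfolding f_def by (intro integrable_mult_right)
  have norm_f: "norm (f j t) = \<bar>\<eta>\<bar> ^ j / fact j * ((r + real j) * exp (- ((r + real j) * t)))" for j t
    unfolding f_def norm_mult norm_of_real using pos[of j] by (simp add: norm_mult norm_divide norm_power abs_mult)
  \<comment> \<open>The weight r + j cancels the value 1/(r + j) of the exponential integral, so the
    L^1 norms form an exponential series.\<close>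
  have "(\<integral>t. norm (f j t) \<partial>half_line) = \<bar>\<eta>\<bar> ^ j / fact j" for j
    unfolding norm_f using pos[of j] by (simp add: integral_exp_half_line)
  then have sum_int: "summable (\<lambda>j. \<integral>t. norm (f j t) \<partial>half_line)"
    using summable_exp[of "\<bar>\<eta>\<bar>"] by (simp add: divide_inverse mult.commute)
  have split: "exp (- ((r + real j) * t)) = exp (- (r * t)) * exp (- t) ^ j" for j t
    by (simp add: exp_of_nat_mult [symmetric] mult_exp_exp algebra_simps)
  have summ: "AE t in half_line. summable (\<lambda>j. norm (f j t))"
  proof (rule AE_half_line)
    fix t :: real
    have "(\<lambda>j. exp (- (r * t)) * ((of_real r + real j) * ((\<bar>\<eta>\<bar> * exp (- t)) ^ j / fact j)))
        sums (exp (- (r * t)) * ((of_real r + \<bar>\<eta>\<bar> * exp (- t)) * exp (\<bar>\<eta>\<bar> * exp (- t))))"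
      by (intro sums_mult exp_series_weighted)
    then show "summable (\<lambda>j. norm (f j t))"
      unfolding norm_f split by (simp add: sums_iff power_mult_distrib mult_ac)
  qed
  have "(\<Sum>j. \<integral>t. f j t \<partial>half_line) = (\<integral>t. (\<Sum>j. f j t) \<partial>half_line)"
    by (rule integral_suminf[OF f summ sum_int, symmetric])
  also have "(\<lambda>j. \<integral>t. f j t \<partial>half_line) = (\<lambda>j. cis (u * ln (r + real j)) * ?c j * osc_const u)"
  proof
    fix j
    have "(\<integral>t. f j t \<partial>half_line) = ?c j * (\<integral>t. ?g j t \<partial>half_line)"
      unfolding f_def by (rule integral_mult_right_zero)
    then show "(\<integral>t. f j t \<partial>half_line) = cis (u * ln (r + real j)) * ?c j * osc_const u"
      unfolding osc_const_scale[OF pos] by (simp only: mult_ac)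
  qed
  also have "(\<Sum>j. cis (u * ln (r + real j)) * ?c j * osc_const u) = (\<Sum>j. cis (u * ln (r + real j)) * ?c j) * osc_const u"
  proof (rule suminf_mult2 [symmetric])
    have "summable (\<lambda>j. norm (cis (u * ln (r + real j)) * ?c j))"
      using summable_exp[of "\<bar>\<eta>\<bar>"] by (simp add: norm_mult norm_divide norm_inverse norm_power divide_inverse mult.commute)
    then show "summable (\<lambda>j. cis (u * ln (r + real j)) * ?c j)"
      by (rule summable_norm_cancel)
  qed
  also have "(\<lambda>t. \<Sum>j. f j t) = (\<lambda>t. log_osc u t * (of_real (exp (- (r * t)))
      * ((of_real r + \<i> * of_real (\<eta> * exp (- t))) * cis (\<eta> * exp (- t)))))"
  proof
    fix t :: real
    let ?z = "\<i> * complex_of_real (\<eta> * exp (- t))"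
    have "(\<lambda>j. log_osc u t * (of_real (exp (- (r * t))) * ((of_real r + of_nat j) * (?z ^ j / fact j))))
        sums (log_osc u t * (of_real (exp (- (r * t))) * ((of_real r + ?z) * exp ?z)))"
      by (intro sums_mult exp_series_weighted)
    moreover have "log_osc u t * (of_real (exp (- (r * t))) * ((of_real r + of_nat j) * (?z ^ j / fact j))) = f j t" for j
      unfolding f_def split by (simp add: power_mult_distrib mult_ac del: of_real_exp)
    ultimately show "(\<Sum>j. f j t) = log_osc u t * (of_real (exp (- (r * t))) * ((of_real r + ?z) * cis (\<eta> * exp (- t))))"
      by (simp only: sums_iff cis_conv_exp)
  qed
  finally show ?thesis
    by simp
qed

text \<open>The binomial series plus \<open>v\<close> times its image under w d/dw; the latter
  follows from k (a choose k) = a ((a - 1) choose (k - 1)).\<close>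

lemma gbinomial_weighted:
  fixes a w v :: complex
  assumes "norm w < 1"
  shows "(\<lambda>k. (a gchoose k) * w ^ k * (of_real r + of_nat k * v)) sums (of_real r * (1 + w) powr a + v * (a * (w * (1 + w) powr (a - 1))))"
proof -
  have "(\<lambda>k. a * (w * (((a - 1) gchoose k) * w ^ k))) sums (a * (w * (1 + w) powr (a - 1)))"
    by (intro sums_mult gen_binomial_complex assms)
  moreover have "a * (w * (((a - 1) gchoose k) * w ^ k)) = of_nat (Suc k) * (a gchoose Suc k) * w ^ Suc k" for k
  proof -
    have "of_nat (Suc k) * (a gchoose Suc k) = a * ((a - 1) gchoose k)"
      using Suc_times_gbinomial[of k "a - 1"] by simp
    then show ?thesis by (simp only: power_Suc mult_ac)
  qed
  ultimately have "(\<lambda>k. of_nat (Suc k) * (a gchoose Suc k) * w ^ Suc k) sums (a * (w * (1 + w) powr (a - 1)))"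
    by simp
  then have "(\<lambda>k. of_nat k * (a gchoose k) * w ^ k) sums (a * (w * (1 + w) powr (a - 1)))"
    by (subst (asm) sums_Suc_iff) simp
  from sums_add[OF sums_mult[OF gen_binomial_complex[OF assms], of "of_real r" a] sums_mult[OF this, of v]]
  show ?thesis
    by (simp add: algebra_simps)
qed

lemma gbinomial_abs_summable:
  fixes a :: complex
  assumes "0 \<le> q" "q < 1"
  shows "summable (\<lambda>k. norm (a gchoose k) * q ^ k)"
    and "summable (\<lambda>k. norm (a gchoose k) * q ^ k * real k)"
proof -
  have conv: "ereal (norm (complex_of_real q)) < conv_radius (\<lambda>k. b gchoose k)" for b :: complex
    using assms by (simp add: conv_radius_gchoose)
  have 1: "summable (\<lambda>k. norm (b gchoose k) * q ^ k)" for b :: complex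
    using abs_summable_in_conv_radius[OF conv, of b] assms by (simp add: norm_mult norm_power)
  then show "summable (\<lambda>k. norm (a gchoose k) * q ^ k)" .
  have "summable (\<lambda>k. norm a * (q * (norm ((a - 1) gchoose k) * q ^ k)))"
    by (intro summable_mult 1)
  moreover have "norm a * (q * (norm ((a - 1) gchoose k) * q ^ k)) = norm (a gchoose Suc k) * q ^ Suc k * real (Suc k)" for k
  proof -
    have "of_nat (Suc k) * (a gchoose Suc k) = a * ((a - 1) gchoose k)"
      using Suc_times_gbinomial[of k "a - 1"] by simp
    then have "real (Suc k) * norm (a gchoose Suc k) = norm a * norm ((a - 1) gchoose k)"
      by (metis norm_mult norm_of_nat)
    then show ?thesis by (simp add: mult_ac del: of_nat_Suc)
  qed
  ultimately have "summable (\<lambda>k. norm (a gchoose Suc k) * q ^ Suc k * real (Suc k))"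
    by simp
  then show "summable (\<lambda>k. norm (a gchoose k) * q ^ k * real k)"
    by (subst (asm) summable_Suc_iff)
qed

section \<open>The binomial test function\<close>

text \<open>The base of the binomial test function along y = exp(-t), the orbit of y = 1 under the
  contraction generated by - y d/dy.\<close>

abbreviation flow_z :: "real \<Rightarrow> real \<Rightarrow> complex" where
  "flow_z q t \<equiv> 1 - of_real q * cis (exp (- t) - 1)"

text \<open>For q < 1 the base stays in the right half-plane, away from the branch cut, and has
  modulus at least 1 - q.\<close>

lemma Re_one_minus_cis_ge:
  assumes "0 \<le> q"
  shows "1 - q \<le> Re (1 - of_real q * cis y)"
  using mult_left_mono[OF cos_le_one[of y] assms] by simp

lemma norm_one_minus_cis_ge:
  assumes "0 \<le> q"
  shows "1 - q \<le> norm (1 - of_real q * cis y)"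
  using Re_one_minus_cis_ge[OF assms, of y] complex_Re_le_cmod[of "1 - of_real q * cis y"] by linarith

text \<open>The modulus of an imaginary power depends only on the argument, which is at most pi in
  absolute value. This makes the test functions bounded uniformly in q.\<close>

lemma norm_powr_imaginary_le: "norm (w powr (\<i> * of_real u)) \<le> exp (pi * \<bar>u\<bar>)"
proof (cases "w = 0")
  case False
  have "\<bar>u * Arg w\<bar> \<le> \<bar>u\<bar> * pi"
    unfolding abs_mult using mpi_less_Arg[of w] Arg_le_pi[of w] by (intro mult_left_mono) auto
  then show ?thesis
    using False by (simp add: norm_powr_complex mult.commute)
qed simp

lemma norm_powr_imaginary_minus_1_le: "norm (w powr (\<i> * of_real u - 1)) \<le> exp (pi * \<bar>u\<bar>) / norm w"
proof (cases "w = 0")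
  case False
  have "w powr (\<i> * of_real u - 1) = w powr (\<i> * of_real u) / w"
    using False by (simp add: powr_diff)
  then show ?thesis
    using norm_powr_imaginary_le[of w u] by (simp add: norm_divide divide_right_mono)
qed simp

lemma flow_z_powr_measurable [measurable]:
  assumes "0 \<le> q" "q < 1"
  shows "(\<lambda>t. flow_z q t powr a) \<in> borel_measurable borel"
proof (rule borel_measurable_continuous_onI)
  show "continuous_on UNIV (\<lambda>t. flow_z q t powr a)"
  proof (rule continuous_on_powr_complex)
    show "UNIV \<subseteq> {t. 0 \<le> Re (flow_z q t) \<or> Im (flow_z q t) \<noteq> 0}"
      using Re_one_minus_cis_ge[OF assms(1)] assms(2) by (smt (verit) UNIV_I mem_Collect_eq subsetI)
    show "0 < Re a" if "flow_z q t = 0" for t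
      using norm_one_minus_cis_ge[OF assms(1), of "exp (- t) - 1"] assms(2) that by simp
  qed (intro continuous_intros)+
qed

text \<open>Multiplied by u, this is exp(- r t) times -d/dt of the test function along the
  flow.\<close>

definition flow_kernel :: "real \<Rightarrow> real \<Rightarrow> real \<Rightarrow> real \<Rightarrow> complex" where
  "flow_kernel r u q t =
     of_real (q * exp (- ((r + 1) * t))) * (cis (exp (- t) - 1) * flow_z q t powr (\<i> * of_real u - 1))"

lemma flow_kernel_measurable [measurable]:
  assumes "0 \<le> q" "q < 1"
  shows "flow_kernel r u q \<in> borel_measurable borel"
proof -
  have [measurable]: "(\<lambda>t. cis (exp (- t) - 1)) \<in> borel_measurable borel"
    by (intro borel_measurable_continuous_onI continuous_intros)
  note [measurable] = flow_z_powr_measurable[OF assms]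
  show ?thesis
    unfolding flow_kernel_def by measurable
qed

lemma norm_flow_kernel_le:
  assumes "0 \<le> q" "q < 1" "r > 0" "t > 0"
  shows "norm (flow_kernel r u q t) \<le> exp (pi * \<bar>u\<bar>) * exp (- t) / norm (flow_z q t)"
proof -
  have "exp (- ((r + 1) * t)) \<le> exp (- t)"
    using assms by (simp add: algebra_simps)
  then have "q * exp (- ((r + 1) * t)) \<le> 1 * exp (- t)"
    using assms by (intro mult_mono) auto
  then have "\<bar>q * exp (- ((r + 1) * t))\<bar> * norm (flow_z q t powr (\<i> * of_real u - 1)) \<le> exp (- t) * (exp (pi * \<bar>u\<bar>) / norm (flow_z q t))"
    using assms by (intro mult_mono norm_powr_imaginary_minus_1_le) auto
  then show ?thesis
    by (simp add: flow_kernel_def norm_mult abs_mult mult_ac)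
qed

lemma integrable_flow_kernel:
  assumes "0 \<le> q" "q < 1" "r > 0"
  shows "integrable half_line (\<lambda>t. log_osc u t * flow_kernel r u q t)"
proof (rule integrable_log_osc_mult)
  show "flow_kernel r u q \<in> borel_measurable half_line"
    using flow_kernel_measurable[OF assms(1,2)] by measurable
  fix t :: real assume "t > 0"
  have "exp (pi * \<bar>u\<bar>) * exp (- t) / norm (flow_z q t) \<le> exp (pi * \<bar>u\<bar>) * exp (- t) / (1 - q)"
    using assms norm_one_minus_cis_ge[OF assms(1), of "exp (- t) - 1"] by (intro divide_left_mono mult_pos_pos) auto
  with norm_flow_kernel_le[OF assms \<open>t > 0\<close>, of u]
  show "norm (flow_kernel r u q t) \<le> exp (pi * \<bar>u\<bar>) / (1 - q) * exp (- (1 * t))"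
    by simp
qed simp

lemma norm_flow_z_powr_le:
  assumes "r > 0"
  shows "norm (of_real (r * exp (- (r * t))) * flow_z q t powr (\<i> * of_real u)) \<le> exp (pi * \<bar>u\<bar>) * r * exp (- (r * t))"
  using norm_powr_imaginary_le[of "flow_z q t" u] assms
  unfolding norm_mult norm_of_real by (simp add: abs_mult mult_ac)

lemma integrable_flow_z_powr:
  assumes "0 \<le> q" "q < 1" "r > 0"
  shows "integrable half_line (\<lambda>t. log_osc u t * (of_real (r * exp (- (r * t))) * flow_z q t powr (\<i> * of_real u)))"
proof (rule integrable_log_osc_mult[OF _ assms(3) norm_flow_z_powr_le[OF assms(3)]])
  note [measurable] = flow_z_powr_measurable[OF assms(1,2)]
  show "(\<lambda>t. of_real (r * exp (- (r * t))) * flow_z q t powr (\<i> * of_real u)) \<in> borel_measurable half_line"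
    by measurable
qed

text \<open>The functional applied to the full binomial series: frequency k in the k-th term, and
  \<open>cis (- real k)\<close> places the near-singularity at y = 1. The two integrals are the two
  terms of the product rule; the second carries the divergence.\<close>

lemma gbinomial_osc_sum:
  fixes u r q :: real
  assumes q: "0 < q" "q < 1" and r: "r > 0"
  defines "a \<equiv> \<i> * complex_of_real u"
  shows "(\<lambda>k. (a gchoose k) * (- of_real q) ^ k * cis (- real k)
            * ((\<Sum>j. cis (u * ln (r + real j)) * ((\<i> * of_real (real k)) ^ j / fact j)) * osc_const u))
    sums ((\<integral>t. log_osc u t * (of_real (r * exp (- (r * t))) * flow_z q t powr a) \<partial>half_line)
          + of_real u * (\<integral>t. log_osc u t * flow_kernel r u q t \<partial>half_line))"
proof -
  let ?w = "\<lambda>t. - (of_real q * cis (exp (- t) - 1))"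
  define f where "f k t = log_osc u t * (of_real (exp (- (r * t))) *
      ((a gchoose k) * ?w t ^ k * (of_real r + of_nat k * (\<i> * of_real (exp (- t))))))" for k t
  have nw: "norm (?w t) = q" for t
    using q by (simp add: norm_mult)
  have meas [measurable]: "(\<lambda>t. cis (exp (- t) - 1)) \<in> borel_measurable borel"
    by (intro borel_measurable_continuous_onI continuous_intros)
  have norm_f: "norm (f k t) \<le> (norm (a gchoose k) * q ^ k * (r + real k)) * exp (- (r * t))" if "t > 0" for k t
  proof -
    have "norm (of_real r + of_nat k * (\<i> * of_real (exp (- t)))) \<le> r + real k * exp (- t)"
      using r by (intro order_trans[OF norm_triangle_ineq]) (simp add: norm_mult)
    also have "\<dots> \<le> r + real k"
      using that by (simp add: mult_left_le)
    finally have "norm (a gchoose k) * q ^ k * norm (of_real r + of_nat k * (\<i> * of_real (exp (- t)))) \<le> norm (a gchoose k) * q ^ k * (r + real k)"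
      using q by (intro mult_left_mono) auto
    from mult_left_mono[OF this, of "exp (- (r * t))"] show ?thesis
      unfolding f_def norm_mult norm_power nw by (simp add: mult_ac)
  qed
  have int: "integrable half_line (f k)" for k
    unfolding f_def
  proof (rule integrable_log_osc_mult[OF _ r])
    fix t :: real assume "t > 0"
    from norm_f[OF this, of k]
    show "norm (of_real (exp (- (r * t))) * ((a gchoose k) * ?w t ^ k * (of_real r + of_nat k * (\<i> * of_real (exp (- t))))))
        \<le> (norm (a gchoose k) * q ^ k * (r + real k)) * exp (- (r * t))"
      by (simp add: f_def norm_mult)
  qed measurable
  have summ: "summable (\<lambda>k. norm (a gchoose k) * q ^ k * (r + real k))"
    using summable_add[OF summable_mult2[OF gbinomial_abs_summable(1)[of q a], of r] gbinomial_abs_summable(2)[of q a]] q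
    by (simp add: distrib_left)
  have AE: "AE t in half_line. summable (\<lambda>k. norm (f k t))"
  proof (rule AE_half_line)
    fix t :: real assume "t > 0"
    then show "summable (\<lambda>k. norm (f k t))"
      by (intro summable_comparison_test'[OF summable_mult2[OF summ, of "exp (- (r * t))"], of 0]) (simp add: norm_f)
  qed
  have sum_int: "summable (\<lambda>k. \<integral>t. norm (f k t) \<partial>half_line)"
  proof (rule summable_comparison_test'[OF summable_mult2[OF summ, of "1 / r"]])
    fix k
    have "(\<integral>t. norm (f k t) \<partial>half_line) \<le> (\<integral>t. (norm (a gchoose k) * q ^ k * (r + real k)) * exp (- (r * t)) \<partial>half_line)"
      using r by (intro integral_mono_AE integrable_norm int integrable_mult_right integrable_exp_half_line AE_half_line norm_f)
    then show "norm (\<integral>t. norm (f k t) \<partial>half_line) \<le> norm (a gchoose k) * q ^ k * (r + real k) * (1 / r)"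
      using r by (simp add: integral_exp_half_line)
  qed
  have "(\<lambda>k. \<integral>t. f k t \<partial>half_line) sums (\<integral>t. (\<Sum>k. f k t) \<partial>half_line)"
    by (rule sums_integral[OF int AE sum_int])
  also have "(\<lambda>t. \<Sum>k. f k t) = (\<lambda>t. log_osc u t * (of_real (r * exp (- (r * t))) * flow_z q t powr a)
      + of_real u * (log_osc u t * flow_kernel r u q t))"
  proof
    fix t :: real
    have "(\<lambda>k. f k t) sums (log_osc u t * (of_real (exp (- (r * t))) *
        (of_real r * (1 + ?w t) powr a + (\<i> * of_real (exp (- t))) * (a * (?w t * (1 + ?w t) powr (a - 1))))))"
      unfolding f_def by (intro sums_mult gbinomial_weighted) (simp only: nw q)
    also have "(\<i> * of_real (exp (- t))) * (a * (?w t * (1 + ?w t) powr (a - 1)))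
        = of_real u * (of_real (q * exp (- t)) * (cis (exp (- t) - 1) * flow_z q t powr (a - 1)))"
      by (simp add: a_def algebra_simps)
    finally have "(\<lambda>k. f k t) sums (log_osc u t * (of_real (exp (- (r * t))) *
        (of_real r * flow_z q t powr a + of_real u * (of_real (q * exp (- t)) * (cis (exp (- t) - 1) * flow_z q t powr (a - 1))))))"
      by simp
    moreover have "exp (- ((r + 1) * t)) = exp (- (r * t)) * exp (- t)"
      by (simp add: mult_exp_exp algebra_simps)
    ultimately show "(\<Sum>k. f k t) = log_osc u t * (of_real (r * exp (- (r * t))) * flow_z q t powr a)
      + of_real u * (log_osc u t * flow_kernel r u q t)"
      by (simp add: sums_iff flow_kernel_def a_def [symmetric] algebra_simps)
  qed
  also have "(\<integral>t. log_osc u t * (of_real (r * exp (- (r * t))) * flow_z q t powr a)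
      + of_real u * (log_osc u t * flow_kernel r u q t) \<partial>half_line) =
      (\<integral>t. log_osc u t * (of_real (r * exp (- (r * t))) * flow_z q t powr a) \<partial>half_line)
          + of_real u * (\<integral>t. log_osc u t * flow_kernel r u q t \<partial>half_line)"
  proof (subst Bochner_Integration.integral_add)
    show "integrable half_line (\<lambda>t. log_osc u t * (of_real (r * exp (- (r * t))) * flow_z q t powr a))"
      unfolding a_def using q r by (intro integrable_flow_z_powr) auto
    show "integrable half_line (\<lambda>t. of_real u * (log_osc u t * flow_kernel r u q t))"
      using q r by (intro integrable_mult_right integrable_flow_kernel) auto
  qed simp
  also have "(\<lambda>k. \<integral>t. f k t \<partial>half_line) = (\<lambda>k. (a gchoose k) * (- of_real q) ^ k * cis (- real k)
            * ((\<Sum>j. cis (u * ln (r + real j)) * ((\<i> * of_real (real k)) ^ j / fact j)) * osc_const u))"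
  proof
    fix k
    have "f k t = (a gchoose k) * (- of_real q) ^ k * cis (- real k) * (log_osc u t * (of_real (exp (- (r * t)))
        * ((of_real r + \<i> * of_real (real k * exp (- t))) * cis (real k * exp (- t)))))" for t
    proof -
      have "?w t ^ k = (- of_real q) ^ k * cis (exp (- t) - 1) ^ k"
        by (simp only: power_mult_distrib [symmetric] mult_minus_left)
      also have "cis (exp (- t) - 1) ^ k = cis (- real k) * cis (real k * exp (- t))"
        unfolding Complex.DeMoivre cis_mult by (simp add: algebra_simps)
      finally show ?thesis
        by (simp add: f_def mult_ac)
    qed
    then show "(\<integral>t. f k t \<partial>half_line) = (a gchoose k) * (- of_real q) ^ k * cis (- real k)
            * ((\<Sum>j. cis (u * ln (r + real j)) * ((\<i> * of_real (real k)) ^ j / fact j)) * osc_const u)"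
      unfolding osc_const_exp_series[OF r] by simp
  qed
  finally show ?thesis .
qed

section \<open>Logarithmic divergence\<close>

text \<open>The power i^(1-iu), which removes the constant left over when t^(-iu) meets (i
  t)^(iu-1).\<close>

definition phase :: "real \<Rightarrow> complex" where
  "phase u = exp ((1 - \<i> * of_real u) * (\<i> * of_real (pi / 2)))"

text \<open>In the limit case q = 1 the base vanishes at t = 0 with derivative i, so it behaves like
  i t.\<close>

lemma flow_difference_quotient:
  "((\<lambda>t. (1 - cis (exp (- t) - 1)) / (\<i> * of_real t)) \<longlongrightarrow> 1) (at_right 0)"
proof -
  let ?F = "\<lambda>w :: complex. 1 - exp (\<i> * (exp (- w) - 1))"
  have "(?F has_field_derivative \<i>) (at 0)"
    by (auto intro!: derivative_eq_intros)
  then have "((\<lambda>h. ?F h / h) \<longlongrightarrow> \<i>) (at 0)"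
    unfolding DERIV_def by simp
  moreover have "filterlim complex_of_real (at 0) (at_right 0)"
  proof (rule filterlim_atI)
    show "(complex_of_real \<longlongrightarrow> 0) (at_right 0)"
      by (rule tendsto_eq_intros refl)+ simp
    show "eventually (\<lambda>t. complex_of_real t \<noteq> 0) (at_right 0)"
      by (simp add: eventually_at_right_less eventually_mono[OF eventually_at_right_less])
  qed
  ultimately have "((\<lambda>t. ?F (of_real t) / of_real t) \<longlongrightarrow> \<i>) (at_right 0)"
    by (rule filterlim_compose)
  then have "((\<lambda>t. ?F (of_real t) / of_real t / \<i>) \<longlongrightarrow> \<i> / \<i>) (at_right 0)"
    by (intro tendsto_intros) auto
  moreover have "?F (of_real t) / of_real t / \<i> = (1 - cis (exp (- t) - 1)) / (\<i> * of_real t)" for t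
  proof -
    have "exp (\<i> * (exp (- complex_of_real t) - 1)) = cis (exp (- t) - 1)"
      by (simp add: cis_conv_exp exp_of_real [symmetric])
    then show ?thesis
      by (simp only: divide_divide_eq_left mult.commute)
  qed
  ultimately show ?thesis by simp
qed

text \<open>At times \<open>t\<close> well above \<open>1 - q\<close> the number \<open>flow_z q t\<close> is close to \<open>\<i> t\<close>, so the oscillation
  of its imaginary power cancels that of \<open>log_osc u t\<close>.\<close>

lemma flow_kernel_main_region:
  obtains \<tau> K :: real where "0 < \<tau>" "\<tau> < 1" "1 \<le> K"
    "\<And>d t. 0 < d \<Longrightarrow> K * d \<le> t \<Longrightarrow> t \<le> \<tau> \<Longrightarrow> 1 / (2 * t) \<le> Re (phase u * (log_osc u t * flow_kernel r u (1 - d) t))"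
proof -
  \<comment> \<open>In terms of t, d = 1 - q and the ratio v of the base to i t, the kernel with its
    phases is \<Phi>(t, d, v) / t. Continuity at (0, 0, 1), where \<Phi> = 1, gives the lower bound
    1/(2t).\<close>
  define \<Phi> :: "real \<times> real \<times> complex \<Rightarrow> complex" where
    "\<Phi> p = of_real ((1 - fst (snd p)) * exp (- ((r + 1) * fst p))) *
       (cis (exp (- fst p) - 1) * exp ((\<i> * of_real u - 1) * Ln (snd (snd p))))" for p
  have "isCont \<Phi> (0, 0, 1)"
    unfolding \<Phi>_def cis_conv_exp by (intro continuous_intros) auto
  moreover have "\<Phi> (0, 0, 1) = 1"
    by (simp add: \<Phi>_def)
  ultimately obtain D where D: "D > 0" "\<And>p. dist p (0, 0, 1) < D \<Longrightarrow> dist (\<Phi> p) 1 < 1 / 2"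
    unfolding continuous_at_eps_delta by (metis half_gt_zero_iff zero_less_one)
  \<comment> \<open>Below, t and d are at most e and |v - 1| \<le> 2e, so the distance to (0, 0, 1)
    is at most 4e < D; e \<le> 1/8 also forces Re v > 0. The constant K will be 1/e, so that d/t
    \<le> e.\<close>
  define e where "e = min (D / 8) (1 / 8)"
  have e: "0 < e" "8 * e \<le> D" "e \<le> 1 / 8"
    using D by (auto simp: e_def)
  define s where "s t = (1 - cis (exp (- t) - 1)) / (\<i> * of_real t)" for t
  have "eventually (\<lambda>t. dist (s t) 1 < e) (at_right 0)"
    using flow_difference_quotient e(1) unfolding s_def by (rule tendstoD)
  then obtain b where b: "b > 0" "\<And>t. 0 < t \<Longrightarrow> t < b \<Longrightarrow> dist (s t) 1 < e"
    unfolding eventually_at_right_field by auto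
  define \<tau> where "\<tau> = min b e / 2"
  show ?thesis
  proof
    show "0 < \<tau>" "\<tau> < 1" "1 \<le> 1 / e"
      using b e by (auto simp: \<tau>_def)
    fix d t :: real assume d: "0 < d" and dt: "1 / e * d \<le> t" and t\<tau>: "t \<le> \<tau>"
    have "0 < 1 / e * d"
      using d e by simp
    then have t: "t > 0" "t < b" "t < e" "t < 1"
      using dt t\<tau> b e by (auto simp: \<tau>_def)
    have dt': "d / t \<le> e"
      using dt t e by (simp add: field_simps)
    have "d \<le> e * t"
      using dt' t by (simp add: field_simps)
    also have "\<dots> \<le> e * 1"
      using t e by (intro mult_left_mono) auto
    finally have de: "d \<le> e" by simp
    define v where "v = flow_z (1 - d) t / (\<i> * of_real t)"
    \<comment> \<open>Passing from q = 1 to q = 1 - d perturbs the quotient by a term of modulus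
      d/t, hence the restriction to t \<ge> K d.\<close>
    have "v = s t + of_real (d / t) * cis (exp (- t) - 1) / \<i>"
      using t by (simp add: v_def s_def field_simps)
    then have v_minus_1: "v - 1 = (s t - 1) + of_real (d / t) * cis (exp (- t) - 1) / \<i>"
      by simp
    have "norm (v - 1) \<le> norm (s t - 1) + norm (of_real (d / t) * cis (exp (- t) - 1) / \<i>)"
      unfolding v_minus_1 by (rule norm_triangle_ineq)
    also have "\<dots> \<le> e + e"
      using b(2)[OF t(1,2)] dt' d t by (intro add_mono) (simp_all add: dist_norm norm_mult norm_divide)
    finally have v1: "norm (v - 1) \<le> 2 * e" by simp
    have "norm ((t, d, v) - (0, 0, 1)) \<le> norm t + (norm d + norm (v - 1))"
      using norm_Pair_le[of t "(d, v - 1)"] norm_Pair_le[of d "v - 1"] by simp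
    also have "\<dots> < D"
      using t d de v1 e by simp
    finally have "dist (\<Phi> (t, d, v)) 1 < 1 / 2"
      by (intro D(2)) (simp add: dist_norm)
    then have Re\<Phi>: "1 / 2 \<le> Re (\<Phi> (t, d, v))"
      using abs_Re_le_cmod[of "\<Phi> (t, d, v) - 1"] by (simp add: dist_norm)
    have "\<bar>Re (v - 1)\<bar> \<le> 2 * e"
      using abs_Re_le_cmod[of "v - 1"] v1 by linarith
    then have Rev: "Re v > 0"
      using e by simp
    then have v0: "v \<noteq> 0" by auto
    have z: "flow_z (1 - d) t = \<i> * of_real t * v"
      using t by (simp add: v_def)
    \<comment> \<open>The logarithms of t, i and v add up to the principal one: with |Im Ln v| <
      pi/2 the total argument lies between 0 and pi.\<close>
    have "exp (of_real (ln t) + \<i> * of_real (pi / 2) + Ln v) = flow_z (1 - d) t"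
      unfolding z exp_add using t v0 by (simp add: exp_of_real exp_Euler [of "of_real (pi / 2)", simplified])
    moreover have "\<bar>Im (Ln v)\<bar> < pi / 2"
      using Rev by (simp only: Re_Ln_pos_lt [OF v0])
    ultimately have Ln: "Ln (flow_z (1 - d) t) = of_real (ln t) + \<i> * of_real (pi / 2) + Ln v"
      by (intro Ln_unique) auto
    have z0: "flow_z (1 - d) t \<noteq> 0"
      using z v0 t by simp
    let ?a = "\<i> * complex_of_real u"
    \<comment> \<open>All factors go into one exponent, where the oscillation in ln t and the
      constant phase cancel and only - ln t and the contribution of v remain.\<close>
    have "phase u * log_osc u t * (w powr (?a - 1))
        = exp ((1 - ?a) * (\<i> * of_real (pi / 2)) + (- ?a * of_real (ln t))
            + (?a - 1) * (of_real (ln t) + \<i> * of_real (pi / 2) + Ln v))"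
      if "w \<noteq> 0" "Ln w = of_real (ln t) + \<i> * of_real (pi / 2) + Ln v" for w
      using that by (simp add: phase_def log_osc_def cis_conv_exp powr_def mult_exp_exp mult_ac add_ac)
    from this[OF z0 Ln] have "phase u * log_osc u t * (flow_z (1 - d) t powr (?a - 1))
        = exp ((1 - ?a) * (\<i> * of_real (pi / 2)) + (- ?a * of_real (ln t))
            + (?a - 1) * (of_real (ln t) + \<i> * of_real (pi / 2) + Ln v))" .
    also have "\<dots> = exp ((?a - 1) * Ln v - of_real (ln t))"
      by (intro arg_cong[where f = exp]) (simp add: field_simps)
    also have "\<dots> = exp ((?a - 1) * Ln v) / of_real t"
      using t by (simp add: exp_diff exp_of_real)
    finally have key: "phase u * log_osc u t * (flow_z (1 - d) t powr (?a - 1)) = exp ((?a - 1) * Ln v) / of_real t" .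
    have "phase u * (log_osc u t * flow_kernel r u (1 - d) t)
        = (of_real ((1 - d) * exp (- ((r + 1) * t))) * cis (exp (- t) - 1))
          * (phase u * log_osc u t * (flow_z (1 - d) t powr (?a - 1)))"
      by (simp only: flow_kernel_def mult_ac)
    also have "\<dots> = \<Phi> (t, d, v) / of_real t"
      unfolding key by (simp add: \<Phi>_def mult_ac)
    finally have "phase u * (log_osc u t * flow_kernel r u (1 - d) t) = \<Phi> (t, d, v) / of_real t" .
    then have "Re (phase u * (log_osc u t * flow_kernel r u (1 - d) t)) = Re (\<Phi> (t, d, v)) / t"
      by (simp only: Re_divide_of_real)
    then show "1 / (2 * t) \<le> Re (phase u * (log_osc u t * flow_kernel r u (1 - d) t))"
      using Re\<Phi> t by (simp add: field_simps)
  qed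
qed

text \<open>Away from t = 0 the angle 1 - exp(-t) lies between 1 - exp(-\<tau>) and 1, so its sine,
  and with it the imaginary part of the base, stays bounded below for all q \<ge> 1/2.\<close>

lemma norm_flow_z_ge:
  assumes "0 < \<tau>" "\<tau> \<le> t" "1 / 2 \<le> q"
  shows "sin (1 - exp (- \<tau>)) / 2 \<le> norm (flow_z q t)"
proof -
  have "sin (1 - exp (- \<tau>)) \<le> sin (1 - exp (- t))"
  proof (rule sin_monotone_2pi_le)
    have "1 - exp (- t) \<le> (1 :: real)" by simp
    also have "1 \<le> pi / 2" using pi_ge_two by simp
    finally show "1 - exp (- t) \<le> pi / 2" .
    have "- (pi / 2) \<le> 0" by simp
    also have "0 \<le> 1 - exp (- \<tau>)" using assms by simp
    finally show "- (pi / 2) \<le> 1 - exp (- \<tau>)" .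
  qed (use assms in simp)
  moreover have "0 \<le> sin (1 - exp (- \<tau>))"
  proof (rule sin_ge_zero)
    show "1 - exp (- \<tau>) \<le> pi" using pi_ge_two by (smt (verit) exp_gt_zero)
  qed (use assms in simp)
  ultimately have "1 / 2 * sin (1 - exp (- \<tau>)) \<le> q * sin (1 - exp (- t))"
    using assms by (intro mult_mono) auto
  also have "\<dots> = Im (flow_z q t)"
    using sin_minus[of "1 - exp (- t)"] by simp
  also have "\<dots> \<le> norm (flow_z q t)"
    using abs_Im_le_cmod[of "flow_z q t"] by linarith
  finally show ?thesis by simp
qed

text \<open>Only the range K d \<le> t \<le> \<tau> matters: it contributes at least half of
  ln(\<tau> / (K d)), while the times below K d and above \<tau> contribute amounts bounded
  independently of d = 1 - q.\<close>

lemma integral_flow_kernel_unbounded: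
  assumes "r > 0"
  obtains q where "0 < q" "q < 1" "B < norm (\<integral>t. log_osc u t * flow_kernel r u q t \<partial>half_line)"
proof -
  obtain \<tau> K where \<tau>: "0 < \<tau>" "\<tau> < 1" and K: "1 \<le> K"
    and main: "\<And>d t. 0 < d \<Longrightarrow> K * d \<le> t \<Longrightarrow> t \<le> \<tau> \<Longrightarrow>
        1 / (2 * t) \<le> Re (phase u * (log_osc u t * flow_kernel r u (1 - d) t))"
    by (rule flow_kernel_main_region[of u r]) blast
  define c where "c = sin (1 - exp (- \<tau>)) / 2"
  have c: "c > 0"
  proof -
    have "1 - exp (- \<tau>) < pi" using pi_ge_two by (smt (verit) exp_gt_zero)
    then show ?thesis unfolding c_def using \<tau> by (intro divide_pos_pos sin_gt_zero) auto
  qed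
  define D where "D = norm (phase u) * exp (pi * \<bar>u\<bar>)"
  have D: "D \<ge> 0" by (simp add: D_def)
  \<comment> \<open>The desired length of the logarithmic range. Half of it exceeds the two error
    terms D K and D / c by more than the norm of \<open>phase u\<close> times |B|.\<close>
  define L where "L = 2 * (norm (phase u) * \<bar>B\<bar> + D * K + D / c) + 2"
  have half_L: "1 / 2 * L = (norm (phase u) * \<bar>B\<bar> + D * K + D / c) + 1"
    unfolding L_def by (subst distrib_left) simp
  \<comment> \<open>This makes ln \<tau> - ln (K d) equal to L; since L \<ge> 1, also d \<le> 1/2,
    as \<open>norm_flow_z_ge\<close> requires of q = 1 - d.\<close>
  define d where "d = \<tau> / K * exp (- L)"
  have "L \<ge> 1"
    unfolding L_def using D K c by (simp add: add_nonneg_nonneg)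
  then have "exp (- L) \<le> exp (- 1)" by simp
  also have "\<dots> \<le> (1 / 2 :: real)"
    using exp_ge_add_one_self[of "1 :: real"] by (simp add: exp_minus field_simps)
  finally have L2: "exp (- L) \<le> 1 / 2" .
  have \<tau>K: "0 < \<tau> / K" "\<tau> / K \<le> 1"
    using \<tau> K by (auto simp: field_simps)
  have "0 < d"
    unfolding d_def by (intro mult_pos_pos \<tau>K) simp
  moreover have "d \<le> 1 * (1 / 2)"
    unfolding d_def by (intro mult_mono \<tau>K L2) auto
  ultimately have d: "0 < d" "d \<le> 1 / 2"
    by simp_all
  have Kd: "K * d = \<tau> * exp (- L)" "K * d > 0" "K * d \<le> \<tau>"
    using K d \<tau> \<open>L \<ge> 1\<close> by (auto simp: d_def mult_left_le)
  let ?W = "\<lambda>t. phase u * (log_osc u t * flow_kernel r u (1 - d) t)"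
  \<comment> \<open>An integrable minorant of the real part of \<open>?W\<close>. D / d comes from
    |base| \<ge> 1 - q = d, and D / c from the bound beyond \<tau>; subtracting both errors on
    overlapping ranges only lowers it.\<close>
  let ?g = "\<lambda>t. (1 / 2) * (1 / t * indicator {K * d..\<tau>} t) - D / d * indicator {0..K * d} t - D / c * exp (- (1 * t))"
  have W: "integrable half_line ?W"
    using d assms by (intro integrable_mult_right integrable_flow_kernel) auto
  have S: "{0<..} \<inter> space lborel \<in> sets (lborel :: real measure)"
    by simp
  have ln: "has_bochner_integral lborel (\<lambda>t. 1 / t * indicator {K * d..\<tau>} t) (ln \<tau> - ln (K * d))"
  proof (rule has_bochner_integral_FTC_Icc_real)
    fix t assume "K * d \<le> t" "t \<le> \<tau>"
    then have "t > 0" using Kd by linarith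
    then show "DERIV ln t :> 1 / t" "isCont (\<lambda>t. 1 / t) t"
      by (auto intro!: derivative_eq_intros continuous_intros)
  qed (use Kd in simp)
  have restrict: "indicator {0<..} t *\<^sub>R (1 / t * indicator {K * d..\<tau>} t) = 1 / t * indicator {K * d..\<tau>} t" for t :: real
    using Kd by (auto split: split_indicator)
  have g1: "integrable half_line (\<lambda>t. 1 / t * indicator {K * d..\<tau>} t)"
    "(\<integral>t. 1 / t * indicator {K * d..\<tau>} t \<partial>half_line) = ln \<tau> - ln (K * d)"
    unfolding integrable_restrict_space[OF S] integral_restrict_space[OF S] restrict
    using ln by (simp_all only: has_bochner_integral_iff)
  have restrict': "indicator {0<..} t *\<^sub>R indicator {0..K * d} t = (indicator {0<..K * d} t :: real)" for t :: real
    by (auto split: split_indicator)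
  have g2: "integrable half_line (indicator {0..K * d} :: real \<Rightarrow> real)"
    "(\<integral>t. indicator {0..K * d} t \<partial>half_line) = K * d"
    unfolding integrable_restrict_space[OF S] integral_restrict_space[OF S] restrict'
    using Kd by simp_all
  have g3: "integrable half_line (\<lambda>t. exp (- (1 * t)))" "(\<integral>t. exp (- (1 * t)) \<partial>half_line) = 1"
    using exp_half_line[of 1] by simp_all
  have g: "integrable half_line ?g"
    by (intro Bochner_Integration.integrable_diff integrable_mult_right g1 g2 g3)
  have "1 / 2 * L - D * K - D / c = (\<integral>t. ?g t \<partial>half_line)"
  proof -
    have "ln \<tau> - ln (K * d) = L"
      unfolding Kd(1) using \<tau> by (simp add: ln_mult)
    moreover have "D / d * (K * d) = D * K"
      using d by simp
    moreover have "(\<integral>t. ?g t \<partial>half_line) = 1 / 2 * (ln \<tau> - ln (K * d)) - D / d * (K * d) - D / c * 1"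
      using g1 g2 g3 by (simp only: Bochner_Integration.integral_diff Bochner_Integration.integrable_diff
          integrable_mult_right integral_mult_right_zero)
    ultimately show ?thesis by simp
  qed
  also have "\<dots> \<le> (\<integral>t. Re (?W t) \<partial>half_line)"
  proof (rule integral_mono_AE[OF g integrable_Re[OF W]], rule AE_half_line)
    fix t :: real assume t: "t > 0"
    have nW: "norm (?W t) \<le> D * exp (- t) / norm (flow_z (1 - d) t)"
      using mult_left_mono[OF norm_flow_kernel_le[of "1 - d" r t u], of "norm (phase u)"] d t assms
      by (simp add: norm_mult D_def mult_ac)
    have Re: "- norm (?W t) \<le> Re (?W t)"
      using abs_Re_le_cmod[of "?W t"] by linarith
    have i2: "0 \<le> D / d * indicator {0..K * d} t" and i3: "0 \<le> D / c * exp (- (1 * t))"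
      using D d c by auto
    show "?g t \<le> Re (?W t)"
    proof (cases "K * d \<le> t \<and> t \<le> \<tau>")
      case True
      then show ?thesis
        using main[OF d(1), of t] i2 i3 by simp
    next
      case False
      then have i1: "indicator {K * d..\<tau>} t = (0 :: real)" by simp
      show ?thesis
      proof (cases "t < K * d")
        case True
        have "D * exp (- t) / norm (flow_z (1 - d) t) \<le> D * 1 / d"
          using norm_one_minus_cis_ge[of "1 - d" "exp (- t) - 1"] d D t
          by (intro frac_le mult_left_mono) auto
        then show ?thesis
          using nW Re i1 i3 True t by simp
      next
        case False
        with \<open>\<not> (K * d \<le> t \<and> t \<le> \<tau>)\<close> have "t > \<tau>" by simp
        then have "c \<le> norm (flow_z (1 - d) t)"
          unfolding c_def using \<tau> d by (intro norm_flow_z_ge) auto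
        then have "D * exp (- t) / norm (flow_z (1 - d) t) \<le> D * exp (- t) / c"
          using c D by (intro divide_left_mono mult_pos_pos) auto
        then show ?thesis
          using nW Re i1 i2 by simp
      qed
    qed
  qed
  also have "\<dots> = Re (\<integral>t. ?W t \<partial>half_line)"
    using W by (rule integral_Re)
  also have "\<dots> \<le> norm (\<integral>t. ?W t \<partial>half_line)"
    by (rule complex_Re_le_cmod)
  also have "\<dots> = norm (phase u) * norm (\<integral>t. log_osc u t * flow_kernel r u (1 - d) t \<partial>half_line)"
    unfolding integral_mult_right_zero norm_mult ..
  finally have "norm (phase u) * \<bar>B\<bar> < norm (phase u) * norm (\<integral>t. log_osc u t * flow_kernel r u (1 - d) t \<partial>half_line)"
    using half_L by linarith
  then have "\<bar>B\<bar> < norm (\<integral>t. log_osc u t * flow_kernel r u (1 - d) t \<partial>half_line)"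
    by (simp add: phase_def)
  then show ?thesis
    using d by (intro that[of "1 - d"]) auto
qed

section \<open>Unboundedness\<close>

text \<open>\<open>OU_spectral_bound\<close> accepts finite sums only. A partial sum differs from
  the full power by at most the tail of an absolutely convergent series, which is independent of y
  and tends to 0 as \<open>N\<close> grows.\<close>

lemma gbinomial_cis_partial_sum_le:
  assumes q: "0 < q" "q < 1"
  shows "norm (\<Sum>k<N. ((\<i> * of_real u) gchoose k) * (- of_real q) ^ k * cis (- real k) * cis (real k * y))
    \<le> exp (pi * \<bar>u\<bar>) + ((\<Sum>k. norm ((\<i> * complex_of_real u) gchoose k) * q ^ k) - (\<Sum>k<N. norm ((\<i> * complex_of_real u) gchoose k) * q ^ k))"
proof -
  let ?a = "\<i> * complex_of_real u"
  define w where "w = - (of_real q * cis (y - 1))"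
  have nw: "norm w = q"
    using q by (simp add: w_def norm_mult)
  define f where "f k = (?a gchoose k) * w ^ k" for k
  have norm_f: "norm (f k) = norm (?a gchoose k) * q ^ k" for k
    by (simp add: f_def norm_mult norm_power nw)
  have summ: "summable (\<lambda>k. norm (f k))"
    unfolding norm_f using q by (intro gbinomial_abs_summable) auto
  have "f sums (1 + w) powr ?a"
    unfolding f_def using q by (intro gen_binomial_complex) (simp add: nw)
  then have "norm (suminf f) \<le> exp (pi * \<bar>u\<bar>)"
    using norm_powr_imaginary_le[of "1 + w" u] by (simp add: sums_iff)
  moreover have "norm (\<Sum>k. f (k + N)) \<le> suminf (\<lambda>k. norm (f k)) - (\<Sum>k<N. norm (f k))"
    using summable_norm[OF summable_ignore_initial_segment[OF summ, of N]] suminf_minus_initial_segment[OF summ, of N] by simp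
  moreover have "(\<Sum>k<N. f k) = suminf f - (\<Sum>k. f (k + N))"
    using suminf_minus_initial_segment[OF summable_norm_cancel[OF summ], of N] by simp
  ultimately have "norm (\<Sum>k<N. f k) \<le> exp (pi * \<bar>u\<bar>) + (suminf (\<lambda>k. norm (f k)) - (\<Sum>k<N. norm (f k)))"
    using norm_triangle_ineq4[of "suminf f" "\<Sum>k. f (k + N)"] by simp
  moreover have "f k = (?a gchoose k) * (- of_real q) ^ k * cis (- real k) * cis (real k * y)" for k
  proof -
    have "w ^ k = (- of_real q) ^ k * cis (y - 1) ^ k"
      unfolding w_def by (simp only: power_mult_distrib [symmetric] mult_minus_left)
    also have "cis (y - 1) ^ k = cis (- real k) * cis (real k * y)"
      unfolding Complex.DeMoivre cis_mult by (simp add: algebra_simps)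
    finally show ?thesis
      by (simp add: f_def mult_ac)
  qed
  ultimately show ?thesis
    unfolding norm_f by simp
qed

text \<open>A uniform L^1 bound would control the functional on all binomial test functions
  independently of q, against the logarithmic divergence as q tends to 1.\<close>

lemma OU_spectral_ball_atoms_unbounded:
  fixes k :: "'n :: finite"
  assumes "u \<noteq> 0" "r > 0"
  shows "\<exists>n. C < L1_norm (OU_spectral (\<lambda>j. cis (u * ln (r + real j))) (ball_atom k n))"
proof (rule ccontr)
  let ?m = "\<lambda>j. cis (u * ln (r + real j))"
  let ?a = "\<i> * complex_of_real u"
  assume "\<not> ?thesis"
  then have C: "L1_norm (OU_spectral ?m (ball_atom k n)) \<le> C" for n
    by (simp add: not_less)
  define E where "E = exp (pi * \<bar>u\<bar>)"
  \<comment> \<open>The bound on the kernel integral \<open>?J\<close> implied by the assumption: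
    the functional is at most |\<open>osc_const u\<close>| C E, the undifferentiated term
    \<open>?I\<close> at most E, and \<open>?J\<close> enters with factor u, which is
    nonzero.\<close>
  define B where "B = (norm (osc_const u) * (C * E) + E) / \<bar>u\<bar>"
  obtain q where q: "0 < q" "q < 1" and large: "B < norm (\<integral>t. log_osc u t * flow_kernel r u q t \<partial>half_line)"
    using integral_flow_kernel_unbounded[OF assms(2)] by blast
  let ?J = "\<integral>t. log_osc u t * flow_kernel r u q t \<partial>half_line"
  let ?I = "\<integral>t. log_osc u t * (of_real (r * exp (- (r * t))) * flow_z q t powr ?a) \<partial>half_line"
  define b where "b k = (?a gchoose k) * (- of_real q) ^ k * cis (- real k)" for k
  define A where "A k = (\<Sum>j. ?m j * ((\<i> * of_real (real k)) ^ j / fact j))" for k :: nat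
  let ?s = "\<lambda>k. norm (?a gchoose k) * q ^ k"
  have "norm (\<Sum>k<N. b k * (A k * osc_const u)) \<le> norm (osc_const u) * (C * (E + (suminf ?s - (\<Sum>k<N. ?s k))))" for N
  proof -
    have "norm (\<Sum>i<N. b i * cis (real i * y)) \<le> E + (suminf ?s - (\<Sum>k<N. ?s k))" for y
      unfolding b_def E_def by (rule gbinomial_cis_partial_sum_le[OF q])
    then have "norm (\<Sum>k<N. b k * A k) \<le> C * (E + (suminf ?s - (\<Sum>k<N. ?s k)))"
      unfolding A_def by (intro OU_spectral_bound[of ?m k C] C) auto
    then have "norm (osc_const u) * norm (\<Sum>k<N. b k * A k) \<le> norm (osc_const u) * (C * (E + (suminf ?s - (\<Sum>k<N. ?s k))))"
      by (intro mult_left_mono) auto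
    moreover have "(\<Sum>k<N. b k * (A k * osc_const u)) = osc_const u * (\<Sum>k<N. b k * A k)"
      by (simp add: sum_distrib_left mult_ac)
    ultimately show ?thesis
      by (simp only: norm_mult)
  qed
  moreover have "(\<lambda>N. norm (\<Sum>k<N. b k * (A k * osc_const u))) \<longlonglongrightarrow> norm (?I + of_real u * ?J)"
    using gbinomial_osc_sum[OF q assms(2), of u] unfolding sums_def b_def A_def by (rule tendsto_norm)
  \<comment> \<open>As \<open>N\<close> tends to infinity with q fixed, the excess of the partial
    sums vanishes and a bound free of q remains.\<close>
  moreover have "(\<lambda>N. norm (osc_const u) * (C * (E + (suminf ?s - (\<Sum>k<N. ?s k)))))
      \<longlonglongrightarrow> norm (osc_const u) * (C * (E + (suminf ?s - suminf ?s)))"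
    using gbinomial_abs_summable(1)[of q ?a] q
    by (intro tendsto_intros summable_LIMSEQ) auto
  ultimately have "norm (?I + of_real u * ?J) \<le> norm (osc_const u) * (C * (E + (suminf ?s - suminf ?s)))"
    by (intro LIMSEQ_le[rotated 2]) auto
  moreover have "norm ?I \<le> E"
  proof -
    have "norm ?I \<le> (\<integral>t. E * (r * exp (- (r * t))) \<partial>half_line)"
    proof (rule Bochner_Integration.integral_norm_bound_integral)
      show "integrable half_line (\<lambda>t. E * (r * exp (- (r * t))))"
        by (intro integrable_mult_right integrable_exp_half_line assms)
      show "integrable half_line (\<lambda>t. log_osc u t * (of_real (r * exp (- (r * t))) * flow_z q t powr ?a))"
        using q assms by (intro integrable_flow_z_powr) auto
      show "norm (log_osc u t * (of_real (r * exp (- (r * t))) * flow_z q t powr ?a)) \<le> E * (r * exp (- (r * t)))" for t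
        using norm_flow_z_powr_le[OF assms(2), of t q u] unfolding norm_mult[of "log_osc u t"] E_def by simp
    qed
    also have "\<dots> = E"
      using assms by (simp add: integral_exp_half_line)
    finally show ?thesis .
  qed
  ultimately have "\<bar>u\<bar> * norm ?J \<le> norm (osc_const u) * (C * E) + E"
    using norm_triangle_ineq4[of "?I + of_real u * ?J" ?I] by (simp add: norm_mult)
  then have "norm ?J \<le> B"
    using assms(1) by (simp add: B_def field_simps)
  with large show False by simp
qed

section \<open>Atomic norm of a single atom and conclusion\<close>

lemma global_atom_atomic_decomp:
  assumes "global_atom a"
  shows "atomic_decomp a (\<lambda>j. if j = 0 then 1 else 0) (\<lambda>_. a)"
proof -
  have "a \<in> L1"
    using assms L2_integrable by (auto simp: global_atom_def L1_def)
  moreover have "summable (\<lambda>j. norm (if j = (0 :: nat) then 1 else 0 :: complex))"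
    by (rule summable_finite[of "{0}"]) auto
  moreover have "(\<lambda>N. L1_norm (\<lambda>x. a x - (\<Sum>j<N. (if j = 0 then 1 else 0) * a x))) \<longlonglongrightarrow> 0"
  proof (rule tendsto_eventually, rule eventually_mono[OF eventually_gt_at_top])
    fix N :: nat assume "0 < N"
    then have "(\<Sum>j<N. (if j = 0 then 1 else 0) * a x) = a x" for x
      by (simp add: if_distrib[of "\<lambda>c. c * _"] cong: if_cong)
    then show "L1_norm (\<lambda>x. a x - (\<Sum>j<N. (if j = 0 then 1 else 0) * a x)) = 0"
      by (simp add: L1_norm_def)
  qed
  ultimately show ?thesis
    using assms by (simp add: atomic_decomp_def h1_atom_def)
qed

text \<open>The one-term decomposition gives the upper bound. The lower bound permits replacing an
  operator constant of unknown sign by its absolute value.\<close>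

lemma h1_norm_bounds:
  assumes "global_atom a"
  shows h1_norm_nonneg: "0 \<le> h1_norm a" and h1_norm_global_atom_le: "h1_norm a \<le> 1"
proof -
  let ?S = "{(\<Sum>j. norm (l j)) | l. \<exists>b. atomic_decomp a l b}"
  have nonneg: "0 \<le> x" if "x \<in> ?S" for x
    using that by (auto simp: atomic_decomp_def intro!: suminf_nonneg)
  have "(\<Sum>j. norm (if j = (0 :: nat) then 1 else 0 :: complex)) = 1"
    by (subst suminf_finite[of "{0}"]) auto
  then have mem: "1 \<in> ?S"
    using global_atom_atomic_decomp[OF assms] by (intro CollectI exI[of _ "\<lambda>j. if j = 0 then 1 else 0"]) auto
  show "0 \<le> h1_norm a"
    unfolding h1_norm_def using mem nonneg by (intro cInf_greatest) auto
  show "h1_norm a \<le> 1"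
    unfolding h1_norm_def using mem nonneg by (intro cInf_lower bdd_belowI[of _ 0]) auto
qed

theorem theorem3p5:
  fixes u r :: real
  assumes "u \<noteq> 0" and "r > 0"
  shows "unbounded_h1_L1
           (OU_imag_power r u :: (real ^ 'n \<Rightarrow> complex) \<Rightarrow> real ^ 'n \<Rightarrow> complex)"
  unfolding unbounded_h1_L1_def
proof (rule notI, elim exE conjE)
  fix T :: "(real ^ 'n \<Rightarrow> complex) \<Rightarrow> real ^ 'n \<Rightarrow> complex"
  assume T: "bounded_linear_h1_L1 T" and ext: "\<forall>f\<in>h1_fin. AE x in gauss. T f x = OU_imag_power r u f x"
  obtain C where C: "\<And>f. f \<in> h1 \<Longrightarrow> L1_norm (T f) \<le> C * h1_norm f" and L1: "\<And>f. f \<in> h1 \<Longrightarrow> T f \<in> L1"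
    using T unfolding bounded_linear_h1_L1_def by blast
  let ?m = "\<lambda>j. cis (u * ln (r + real j))"
  have "complex_of_real (r + real j) powr (\<i> * of_real u) = ?m j" for j
    using assms(2) by (simp add: powr_def cis_conv_exp Ln_of_real mult_ac del: of_real_add)
  then have OU: "OU_imag_power r u = (OU_spectral ?m :: (real ^ 'n \<Rightarrow> complex) \<Rightarrow> _)"
    by (simp add: OU_imag_power_def)
  \<comment> \<open>Any coordinate direction serves, and index types are nonempty.\<close>
  fix k :: 'n
  have "L1_norm (OU_spectral ?m (ball_atom k n)) \<le> \<bar>C\<bar>" for n
  proof -
    let ?a = "ball_atom k n"
    have atom: "global_atom ?a"
      by (rule ball_atom_global_atom)
    have h1: "?a \<in> h1"
      using global_atom_atomic_decomp[OF atom] by (auto simp: h1_def)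
    have "?a \<in> h1_fin"
      using atom unfolding h1_fin_def h1_atom_def
      by (intro CollectI exI[of _ 1] exI[of _ "\<lambda>_. 1"] exI[of _ "\<lambda>_. ?a"]) auto
    with ext have AE: "AE x in gauss. T ?a x = OU_spectral ?m ?a x"
      unfolding OU by blast
    have "OU_spectral ?m ?a \<in> borel_measurable gauss"
      using L2_measurable[OF OU_spectral_L2[OF ball_atom_L2, of ?m]] by simp
    moreover have "T ?a \<in> borel_measurable gauss"
      using L1[OF h1] unfolding L1_def by auto
    ultimately have "L1_norm (OU_spectral ?m ?a) = L1_norm (T ?a)"
      unfolding L1_norm_def using AE by (intro integral_cong_AE) auto
    also have "\<dots> \<le> C * h1_norm ?a"
      by (rule C[OF h1])
    \<comment> \<open>The definition of boundedness leaves the sign of \<open>C\<close>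
      open.\<close>
    also have "\<dots> \<le> \<bar>C\<bar> * 1"
      using h1_norm_nonneg[OF atom] h1_norm_global_atom_le[OF atom] by (intro mult_mono) auto
    finally show ?thesis by simp
  qed
  with OU_spectral_ball_atoms_unbounded[OF assms, of "\<bar>C\<bar>" k] show False
    by (simp add: not_less [symmetric])
qed

end
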